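(* Let $T$ and $T'$ be semi-standard simple operators in Pontryagin spaces $\mathfrak H$ and $\mathfrak H'$ belonging to the class $\mathcal C_\Delta$, i.e. $\Delta_0(T)=\Delta_0(T')=\Delta$. Let $\Pi_\Gamma=(\mathfrak L,\Gamma_0,\Gamma_1)$ and $\Pi_{\Gamma'}=(\mathfrak L,\Gamma'_0,\Gamma'_1)$ be boundary triples for $T^+$ and $T'^{+}$ (with the same Hilbert space $\mathfrak L$), with Weyl families $M_\Gamma$, $M_{\Gamma'}$. If $M_\Gamma(z)=M_{\Gamma'}(z)$ for all $z\in\Delta$, then $\Pi_\Gamma$ and $\Pi_{\Gamma'}$ are similar, i.e. there is a standard unitary operator $U\colon\mathfrak H\to\mathfrak H'$ such that $\Gamma'=\Gamma\widetilde U^{-1}$ with $\widetilde U=\begin{pmatrix}U&0\\0&U\end{pmatrix}\colon\mathfrak H^2\to\mathfrak H'^2$. In particular, for every linear relation $\Theta$ in $\mathfrak L$ the canonical extensions satisfy $\Gamma'^{-1}(\Theta)=U\,\Gamma^{-1}(\Theta)\,U^{-1}$.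
   Context: All spaces are complex. Relations are linear subsets of product spaces; operators are identified with graphs; inverses, products, images are in the sense of relations. The Pontryagin space $(\mathfrak H,[\cdot,\cdot])$ (Krein space with finite rank of indefiniteness) with fundamental symmetry $J$ has inner product conjugate-linear in the first factor; $(\mathfrak H,[\cdot,J\cdot])$ is a Hilbert space, which defines the topology. $T^+=\{(g,g')\in\mathfrak H^2:[f,g']=[f',g]\ \forall(f,f')\in T\}$; $T$ is symmetric if $T\subseteq T^+$. $\mathfrak N_z(T)=\ker(T-zI)$. $T$ has equal defect numbers $(d,d)$, $d\le\infty$, if $\dim\ker(JT^+-iI)=\dim\ker(JT^++iI)=d$, $JT^+=\{(f,Jf'):(f,f')\in T^+\}$. $\mathbb C_*=\mathbb C\setminus\mathbb R$; $\sigma_p^0(T)$ is the set of $z\in\mathbb C_*$ with $\mathfrak N_z(T)\ne\{0\}$; $\hat\rho(T)$ is the set of $z\in\mathbb C$ with $\mathfrak N_z(T)=\{0\}$ and $\operatorname{ran}(T-zI)$ closed; $\delta(T)=\{z\in\mathbb C_*: z,\bar z\in\hat\rho(T)\}$. A closed symmetric relation is standard if $\delta(T)\ne\emptyset$. $T$ has property $(P)$ if $\operatorname{dom}T+\operatorname{ran}T$ is dense in $\mathfrak H$. $\mathfrak K=\mathfrak H^2$ is a Krein space with $[\hat f,\hat g]=-i[f,g']+i[f',g]$ and fundamental symmetry $\widehat J(f,f')=(-iJf',iJf)$; $\bot$ in $\mathfrak K$ refers to the Hilbert inner product $[\hat f,\widehat J\hat g]=[f,Jg]+[f',Jg']$.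 $\mathcal N$ is the set of all neutral subspaces (closed linear subsets on which $[\hat f,\hat f]=0$) $N$ of $\mathfrak K$ with $N\subseteq T^+\cap T^\bot$ and such that the orthogonal sum $T\,\widehat\oplus\,N$ is hyper-maximal neutral (equal to its own orthogonal complement in the indefinite inner product of $\mathfrak K$). For $N\in\mathcal N$, $O_s(T,N)$ is the set of $z\in\delta(T)$ such that $\operatorname{ran}(T-wI)\cap\operatorname{ran}(N-wI)=\{0\}$ for both $w=z$ and $w=\bar z$. A semi-standard simple operator in a Pontryagin space is a standard symmetric operator $T$ with property $(P)$ and equal defect numbers such that (i) the set $\Delta_0(T)=\bigcap_{N\in\mathcal N}\{z\in O_s(T,N): z,\bar z\notin\sigma_p^0(N)\}$ is nonempty, and (ii) the closed linear span of $\bigcup_{z\in\Delta_0(T)}\mathfrak N_z(T^+)$ is $\mathfrak H$. Boundary triple: $(\mathfrak L,\Gamma_0,\Gamma_1)$, $(\mathfrak L,\langle\cdot,\cdot\rangle)$ a Hilbert space, is a boundary triple for $T^+$ if $\Gamma=(\Gamma_0,\Gamma_1)\colon T^+\to\mathfrak L^2$ is linear, surjective and $[f,g']-[f',g]=\langle\Gamma_0\hat f,\Gamma_1\hat g\rangle-\langle\Gamma_1\hat f,\Gamma_0\hat g\rangle$ for all $\hat f=(f,f'),\hat g=(g,g')\in T^+$. Its Weyl family is $M_\Gamma(z)=\Gamma(zI\cap T^+)$, $zI=\{(f,zf)\}$. A canonical extension of $T$ is a relation between $T$ and $T^+$. A standard unitary operator $U\colon\mathfrak H\to\mathfrak H'$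 is a bounded everywhere defined bijective operator with $[Uf,Ug]'=[f,g]$. *)

theory Defs
  imports "HOL-Analysis.Analysis" "HOL-Library.Extended_Nat"
begin

section \<open>Complex Hilbert spaces\<close>

text \<open>A complex Hilbert space is a real Hilbert space (which supplies the norm and the topology)
  with a compatible complex structure; its real inner product is the real part of the complex one.
  The complex inner product is conjugate-linear in the first argument. No separability and no
  lower bound on the dimension is assumed.\<close>

class complex_hilbert_space = real_inner + complete_space +
  fixes scaleC :: "complex \<Rightarrow> 'a \<Rightarrow> 'a"  (infixr "*\<^sub>C" 75)
    and cinner :: "'a \<Rightarrow> 'a \<Rightarrow> complex"
  assumes scaleC_add_right: "a *\<^sub>C (x + y) = a *\<^sub>C x + a *\<^sub>C y"
    and scaleC_add_left: "(a + b) *\<^sub>C x = a *\<^sub>C x + b *\<^sub>C x"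
    and scaleC_scaleC: "a *\<^sub>C (b *\<^sub>C x) = (a * b) *\<^sub>C x"
    and scaleC_of_real: "complex_of_real r *\<^sub>C x = scaleR r x"
    and cinner_commute: "cinner x y = cnj (cinner y x)"
    and cinner_add_right: "cinner x (y + z) = cinner x y + cinner x z"
    and cinner_scaleC_right: "cinner x (a *\<^sub>C y) = a * cinner x y"
    and Re_cinner: "Re (cinner x y) = inner x y"

global_interpretation complex_vec:
  vector_space "scaleC :: complex \<Rightarrow> 'a \<Rightarrow> 'a::complex_hilbert_space"
  defines csubspace = complex_vec.subspace
    and cspan = complex_vec.span
    and cdim = complex_vec.dim
proof
  fix x :: 'a
  show "1 *\<^sub>C x = x"
    using scaleC_of_real[of 1 x] by simp
qed (simp_all add: scaleC_add_right scaleC_add_left scaleC_scaleC)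

instantiation complex :: complex_hilbert_space
begin
definition scaleC_complex :: "complex \<Rightarrow> complex \<Rightarrow> complex" where
  "scaleC_complex a x = a * x"
definition cinner_complex :: "complex \<Rightarrow> complex \<Rightarrow> complex" where
  "cinner_complex x y = cnj x * y"
instance
  by standard
    (simp_all add: scaleC_complex_def cinner_complex_def algebra_simps scaleR_conv_of_real
      inner_complex_def)
end

instantiation prod :: (complex_hilbert_space, complex_hilbert_space) complex_hilbert_space
begin
definition scaleC_prod :: "complex \<Rightarrow> 'a \<times> 'b \<Rightarrow> 'a \<times> 'b" where
  "scaleC_prod a x = (a *\<^sub>C fst x, a *\<^sub>C snd x)"
definition cinner_prod :: "'a \<times> 'b \<Rightarrow> 'a \<times> 'b \<Rightarrow> complex" where
  "cinner_prod x y = cinner (fst x) (fst y) + cinner (snd x) (snd y)"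
instance
proof
  fix x y :: "'a \<times> 'b"
  show "cinner x y = cnj (cinner y x)"
    using cinner_commute[of "fst x" "fst y"] cinner_commute[of "snd x" "snd y"]
    by (simp add: cinner_prod_def)
qed (auto simp add: scaleC_prod_def cinner_prod_def scaleC_add_right scaleC_add_left
      scaleC_scaleC scaleC_of_real cinner_add_right cinner_scaleC_right Re_cinner
      inner_prod_def scaleR_prod_def algebra_simps)
end

text \<open>Dimension in $\{0, 1, 2, \ldots, \infty\}$; infinite cardinalities are not distinguished.\<close>

definition ecdim :: "'a::complex_hilbert_space set \<Rightarrow> enat" where
  "ecdim V = (if \<exists>B. finite B \<and> V \<subseteq> cspan B then enat (cdim V) else \<infinity>)"

abbreviation clinear_map ::
  "('a::complex_hilbert_space \<Rightarrow> 'b::complex_hilbert_space) \<Rightarrow> bool" where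
  "clinear_map \<equiv> Vector_Spaces.linear scaleC scaleC"


section \<open>Krein and Pontryagin spaces\<close>

text \<open>A Krein space with a chosen fundamental symmetry \<open>J\<close>: the indefinite inner product is \<open>ip\<close>,
  and the Hilbert inner product of the type is $[f, J g]$. As in the Hilbert case, \<open>ip\<close> is
  conjugate-linear in the first argument.\<close>

definition krein_space ::
  "('h::complex_hilbert_space \<Rightarrow> 'h \<Rightarrow> complex) \<Rightarrow> ('h \<Rightarrow> 'h) \<Rightarrow> bool" where
  "krein_space ip J \<longleftrightarrow>
     (\<forall>f g. ip f g = cnj (ip g f)) \<and>
     (\<forall>f g h. ip f (g + h) = ip f g + ip f h) \<and>
     (\<forall>f g c. ip f (c *\<^sub>C g) = c * ip f g) \<and>
     clinear_map J \<and> (\<forall>f. J (J f) = f) \<and>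
     (\<forall>f g. cinner f g = ip f (J g))"

text \<open>The two components of the canonical decomposition are the eigenspaces of \<open>J\<close> for
  $1$ and $-1$.\<close>

definition rank_of_indefiniteness :: "('h::complex_hilbert_space \<Rightarrow> 'h) \<Rightarrow> enat" where
  "rank_of_indefiniteness J = min (ecdim {f. J f = f}) (ecdim {f. J f = - f})"

definition pontryagin_space ::
  "('h::complex_hilbert_space \<Rightarrow> 'h \<Rightarrow> complex) \<Rightarrow> ('h \<Rightarrow> 'h) \<Rightarrow> bool" where
  "pontryagin_space ip J \<longleftrightarrow> krein_space ip J \<and> rank_of_indefiniteness J < \<infinity>"

definition standard_unitary ::
  "('h::complex_hilbert_space \<Rightarrow> 'h \<Rightarrow> complex) \<Rightarrow>
   ('k::complex_hilbert_space \<Rightarrow> 'k \<Rightarrow> complex) \<Rightarrow> ('h \<Rightarrow> 'k) \<Rightarrow> bool" where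
  "standard_unitary ip ip' U \<longleftrightarrow>
     clinear_map U \<and> bounded_linear U \<and> bij U \<and> (\<forall>f g. ip' (U f) (U g) = ip f g)"


section \<open>Linear relations\<close>

text \<open>A linear relation in \<open>'h\<close> is a set \<open>T :: ('h \<times> 'h) set\<close> with \<open>csubspace T\<close>. The relation
  product $S R$ (first $R$, then $S$) is \<open>R O S\<close>, the inverse is \<open>converse\<close>.\<close>

definition graph :: "'a set \<Rightarrow> ('a \<Rightarrow> 'b) \<Rightarrow> ('a \<times> 'b) set" where
  "graph A F = {(x, F x) | x. x \<in> A}"

definition rel_ker :: "('a \<times> 'b::zero) set \<Rightarrow> 'a set" where
  "rel_ker T = {f. (f, 0) \<in> T}"

definition rel_shift :: "('h \<times> 'h::complex_hilbert_space) set \<Rightarrow> complex \<Rightarrow> ('h \<times> 'h) set" where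
  "rel_shift T z = {(f, f' - z *\<^sub>C f) | f f'. (f, f') \<in> T}"

definition eigenspace :: "('h \<times> 'h::complex_hilbert_space) set \<Rightarrow> complex \<Rightarrow> 'h set" where
  "eigenspace T z = rel_ker (rel_shift T z)"

definition scalar_rel :: "complex \<Rightarrow> ('h \<times> 'h::complex_hilbert_space) set" where
  "scalar_rel z = {(f, z *\<^sub>C f) | f. True}"

definition krein_adjoint ::
  "('h::complex_hilbert_space \<Rightarrow> 'h \<Rightarrow> complex) \<Rightarrow> ('h \<times> 'h) set \<Rightarrow> ('h \<times> 'h) set" where
  "krein_adjoint ip T = {(g, g'). \<forall>(f, f') \<in> T. ip f g' = ip f' g}"

definition symmetric_rel ::
  "('h::complex_hilbert_space \<Rightarrow> 'h \<Rightarrow> complex) \<Rightarrow> ('h \<times> 'h) set \<Rightarrow> bool" where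
  "symmetric_rel ip T \<longleftrightarrow> csubspace T \<and> T \<subseteq> krein_adjoint ip T"

definition equal_defect_numbers ::
  "('h::complex_hilbert_space \<Rightarrow> 'h \<Rightarrow> complex) \<Rightarrow> ('h \<Rightarrow> 'h) \<Rightarrow> ('h \<times> 'h) set \<Rightarrow> bool" where
  "equal_defect_numbers ip J T \<longleftrightarrow>
     (let JA = {(f, J f') | f f'. (f, f') \<in> krein_adjoint ip T}
      in ecdim (eigenspace JA \<i>) = ecdim (eigenspace JA (- \<i>)))"

definition sigma_p0 :: "('h \<times> 'h::complex_hilbert_space) set \<Rightarrow> complex set" where
  "sigma_p0 T = {z. z \<notin> \<real> \<and> eigenspace T z \<noteq> {0}}"

definition rho_hat :: "('h \<times> 'h::complex_hilbert_space) set \<Rightarrow> complex set" where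
  "rho_hat T = {z. eigenspace T z = {0} \<and> closed (Range (rel_shift T z))}"

definition delta :: "('h \<times> 'h::complex_hilbert_space) set \<Rightarrow> complex set" where
  "delta T = {z. z \<notin> \<real> \<and> z \<in> rho_hat T \<and> cnj z \<in> rho_hat T}"

definition standard_symmetric ::
  "('h::complex_hilbert_space \<Rightarrow> 'h \<Rightarrow> complex) \<Rightarrow> ('h \<times> 'h) set \<Rightarrow> bool" where
  "standard_symmetric ip T \<longleftrightarrow> symmetric_rel ip T \<and> closed T \<and> delta T \<noteq> {}"

definition property_P :: "('h \<times> 'h::complex_hilbert_space) set \<Rightarrow> bool" where
  "property_P T \<longleftrightarrow> closure {f + g | f g. f \<in> Domain T \<and> g \<in> Range T} = UNIV"

definition canonical_extension ::
  "('h::complex_hilbert_space \<Rightarrow> 'h \<Rightarrow> complex) \<Rightarrow> ('h \<times> 'h) set \<Rightarrow> ('h \<times> 'h) set \<Rightarrow> bool" where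
  "canonical_extension ip T S \<longleftrightarrow> csubspace S \<and> T \<subseteq> S \<and> S \<subseteq> krein_adjoint ip T"


section \<open>The Krein space $\mathfrak{K} = \mathfrak{H}^2$\<close>

fun ip_sq ::
  "('h::complex_hilbert_space \<Rightarrow> 'h \<Rightarrow> complex) \<Rightarrow> 'h \<times> 'h \<Rightarrow> 'h \<times> 'h \<Rightarrow> complex" where
  "ip_sq ip (f, f') (g, g') = - \<i> * ip f g' + \<i> * ip f' g"

fun J_sq :: "('h::complex_hilbert_space \<Rightarrow> 'h) \<Rightarrow> 'h \<times> 'h \<Rightarrow> 'h \<times> 'h" where
  "J_sq J (f, f') = (- \<i> *\<^sub>C J f', \<i> *\<^sub>C J f)"

definition orth_compl ::
  "('h::complex_hilbert_space \<Rightarrow> 'h \<Rightarrow> complex) \<Rightarrow> ('h \<Rightarrow> 'h) \<Rightarrow> ('h \<times> 'h) set \<Rightarrow> ('h \<times> 'h) set" where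
  "orth_compl ip J T = {v. \<forall>u \<in> T. ip_sq ip u (J_sq J v) = 0}"

definition neutral_subspace ::
  "('h::complex_hilbert_space \<Rightarrow> 'h \<Rightarrow> complex) \<Rightarrow> ('h \<times> 'h) set \<Rightarrow> bool" where
  "neutral_subspace ip N \<longleftrightarrow> csubspace N \<and> closed N \<and> (\<forall>u \<in> N. ip_sq ip u u = 0)"

definition hyper_maximal_neutral ::
  "('h::complex_hilbert_space \<Rightarrow> 'h \<Rightarrow> complex) \<Rightarrow> ('h \<times> 'h) set \<Rightarrow> bool" where
  "hyper_maximal_neutral ip L \<longleftrightarrow> L = {v. \<forall>u \<in> L. ip_sq ip u v = 0}"

text \<open>Since \<open>N \<subseteq> orth_compl ip J T\<close>, the sum of \<open>T\<close> and \<open>N\<close> below is the orthogonal sum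
  $T \mathbin{\widehat\oplus} N$ in the Hilbert space $\mathfrak{K}$.\<close>

definition neutral_class ::
  "('h::complex_hilbert_space \<Rightarrow> 'h \<Rightarrow> complex) \<Rightarrow> ('h \<Rightarrow> 'h) \<Rightarrow> ('h \<times> 'h) set \<Rightarrow> ('h \<times> 'h) set set" where
  "neutral_class ip J T =
     {N. neutral_subspace ip N \<and> N \<subseteq> krein_adjoint ip T \<inter> orth_compl ip J T \<and>
         hyper_maximal_neutral ip {t + n | t n. t \<in> T \<and> n \<in> N}}"

definition O_s ::
  "('h \<times> 'h::complex_hilbert_space) set \<Rightarrow> ('h \<times> 'h) set \<Rightarrow> complex set" where
  "O_s T N = {z \<in> delta T. \<forall>w \<in> {z, cnj z}.
     Range (rel_shift T w) \<inter> Range (rel_shift N w) = {0}}"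

definition Delta_0 ::
  "('h::complex_hilbert_space \<Rightarrow> 'h \<Rightarrow> complex) \<Rightarrow> ('h \<Rightarrow> 'h) \<Rightarrow> ('h \<times> 'h) set \<Rightarrow> complex set" where
  "Delta_0 ip J T =
     (\<Inter>N \<in> neutral_class ip J T. {z \<in> O_s T N. z \<notin> sigma_p0 N \<and> cnj z \<notin> sigma_p0 N})"

definition semi_standard_simple ::
  "('h::complex_hilbert_space \<Rightarrow> 'h \<Rightarrow> complex) \<Rightarrow> ('h \<Rightarrow> 'h) \<Rightarrow> ('h \<times> 'h) set \<Rightarrow> bool" where
  "semi_standard_simple ip J T \<longleftrightarrow>
     standard_symmetric ip T \<and> single_valued T \<and> property_P T \<and> equal_defect_numbers ip J T \<and>
     Delta_0 ip J T \<noteq> {} \<and>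
     closure (cspan (\<Union>z \<in> Delta_0 ip J T. eigenspace (krein_adjoint ip T) z)) = UNIV"


section \<open>Boundary triples\<close>

text \<open>In a boundary triple for $S = T^+$ only the restrictions of the total functions
  \<open>\<Gamma>0\<close>, \<open>\<Gamma>1\<close> to \<open>S\<close> are relevant; $\Gamma$ itself is the relation \<open>bmap S \<Gamma>0 \<Gamma>1\<close>.\<close>

definition bmap ::
  "('h \<times> 'h) set \<Rightarrow> ('h \<times> 'h \<Rightarrow> 'l) \<Rightarrow> ('h \<times> 'h \<Rightarrow> 'l) \<Rightarrow> (('h \<times> 'h) \<times> ('l \<times> 'l)) set" where
  "bmap S \<Gamma>0 \<Gamma>1 = graph S (\<lambda>u. (\<Gamma>0 u, \<Gamma>1 u))"

definition boundary_triple ::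
  "('h::complex_hilbert_space \<Rightarrow> 'h \<Rightarrow> complex) \<Rightarrow> ('h \<times> 'h) set \<Rightarrow>
   ('h \<times> 'h \<Rightarrow> 'l::complex_hilbert_space) \<Rightarrow> ('h \<times> 'h \<Rightarrow> 'l) \<Rightarrow> bool" where
  "boundary_triple ip S \<Gamma>0 \<Gamma>1 \<longleftrightarrow>
     csubspace (bmap S \<Gamma>0 \<Gamma>1) \<and> Range (bmap S \<Gamma>0 \<Gamma>1) = UNIV \<and>
     (\<forall>(f, f') \<in> S. \<forall>(g, g') \<in> S.
        ip f g' - ip f' g =
        cinner (\<Gamma>0 (f, f')) (\<Gamma>1 (g, g')) - cinner (\<Gamma>1 (f, f')) (\<Gamma>0 (g, g')))"

definition weyl_family ::
  "('h \<times> 'h::complex_hilbert_space) set \<Rightarrow> ('h \<times> 'h \<Rightarrow> 'l) \<Rightarrow> ('h \<times> 'h \<Rightarrow> 'l) \<Rightarrow>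
   complex \<Rightarrow> ('l \<times> 'l) set" where
  "weyl_family S \<Gamma>0 \<Gamma>1 z = bmap S \<Gamma>0 \<Gamma>1 `` (scalar_rel z \<inter> S)"

end

theory Submission
  imports Defs
begin

text \<open>
Write \<open>N_z\<close> for the defect subspace \<open>ker (T\<^sup>+ - z)\<close>, and call the pair \<open>(\<Gamma>0 u, \<Gamma>1 u)\<close> the boundary
values of \<open>u \<in> T\<^sup>+\<close>. For \<open>f \<in> N_z\<close> and \<open>g \<in> N_w\<close> Green's identity says that \<open>(w - cnj z) [f, g]\<close> is
a function of the boundary values of \<open>(f, z f)\<close> and \<open>(g, w g)\<close> alone. Equality of the Weyl families
on \<open>\<Delta>\<close> means that every defect vector of one model at a point of \<open>\<Delta>\<close> is matched with a defect vector
of the other one at the same point with the same boundary values. Matched pairs therefore span a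
linear relation from \<open>H\<close> to \<open>H'\<close> that ought to be isometric, and its domain and range are dense
because the defect subspaces over \<open>\<Delta>\<close> are total. In a Pontryagin space such a relation extends to
a standard unitary operator \<open>U\<close> (\<open>isometric_relation_extends_to_unitary\<close>). Finally, \<open>T\<close> consists
exactly of the pairs \<open>(x, x')\<close> with \<open>[x, w f] = [x', f]\<close> for all \<open>f \<in> N_w\<close>, \<open>w \<in> \<Delta>\<close>
(\<open>graph_determined_by_defects\<close>). By Green's identity, elements of the two adjoints with the same
boundary values thus correspond to each other under \<open>U\<close> modulo \<open>T'\<close>, and since the boundary maps
vanish on \<open>T\<close> and \<open>T'\<close>, the operator \<open>U\<close> carries \<open>\<Gamma>\<close> to \<open>\<Gamma>'\<close>.

Two points of this argument need more. Green's identity says nothing about \<open>[f, g]\<close> if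
\<open>w = cnj z\<close>, and the description of \<open>T\<close> needs the totality of the defect subspaces when one point of
\<open>\<Delta>\<close> is left out. Both are settled by approximation from neighbouring points, so what is needed is
that \<open>\<Delta>\<close> has no isolated points.

In fact \<open>\<Delta>\<close> is open. A boundary triple provides, through any neutral vector
of \<open>N_z\<close>, a hyper-maximal neutral extension of \<open>T\<close>; it follows that \<open>z \<in> \<Delta>\<close> exactly if \<open>z\<close> lies in
\<open>\<delta>(T)\<close> and neither \<open>N_z\<close> nor the defect subspace at \<open>cnj z\<close> contains a nonzero neutral vector
(\<open>Delta_imp_neutral_free\<close>, \<open>neutral_free_imp_mem_Delta_0\<close>). In a Pontryagin space a closed subspace
without nonzero neutral vectors is uniformly definite (\<open>neutral_free_imp_uniformly_definite\<close>). Uniform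
definiteness survives small perturbations of the subspace, and \<open>N_w\<close> is close to \<open>N_z\<close> for \<open>w\<close> near
\<open>z\<close>, because closed range of \<open>T - z\<close> gives a lower bound for \<open>T - z\<close> by the open mapping theorem.

For \<open>w = cnj z\<close> one takes \<open>f_n \<in> N_{z_n}\<close> with \<open>z_n \<rightarrow> z\<close> and \<open>f_n \<rightarrow> f\<close>. The vectors matched with
the \<open>f_n\<close> are not known to converge in norm, but uniform definiteness bounds them, and their products
with a total set converge, so they converge weakly (\<open>matched_pairing\<close>).
\<close>

section \<open>Complex Hilbert spaces\<close>

instance complex_hilbert_space \<subseteq> banach ..

lemma cinner_add_left: "cinner (x + y) z = cinner x z + cinner y z"
  by (metis cinner_add_right cinner_commute complex_cnj_add)

lemma cinner_scaleC_left: "cinner (a *\<^sub>C x) y = cnj a * cinner x y"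
  by (metis cinner_commute cinner_scaleC_right complex_cnj_mult)

lemma cinner_zero [simp]: "cinner 0 y = 0" "cinner x 0 = 0"
  using cinner_scaleC_left[of 0 0 y] cinner_scaleC_right[of x 0 0] by simp_all

lemma cinner_minus_left: "cinner (- x) y = - cinner x y"
  using cinner_add_left[of x "- x" y] by (simp add: eq_neg_iff_add_eq_0 add.commute)

lemma cinner_minus_right: "cinner x (- y) = - cinner x y"
  using cinner_add_right[of x y "- y"] by (simp add: eq_neg_iff_add_eq_0 add.commute)

lemma cinner_diff_left: "cinner (x - y) z = cinner x z - cinner y z"
  using cinner_add_left[of x "- y" z] by (simp add: cinner_minus_left)

lemma cinner_diff_right: "cinner x (y - z) = cinner x y - cinner x z"
  using cinner_add_right[of x y "- z"] by (simp add: cinner_minus_right)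

lemma cinner_self: "cinner x x = complex_of_real ((norm x)\<^sup>2)"
proof (rule complex_eqI)
  show "Re (cinner x x) = Re (complex_of_real ((norm x)\<^sup>2))"
    by (simp add: Re_cinner power2_norm_eq_inner)
  have "Im (cinner x x) = - Im (cinner x x)"
    by (metis cinner_commute cnj.simps(2))
  then show "Im (cinner x x) = Im (complex_of_real ((norm x)\<^sup>2))" by simp
qed

lemma norm_scaleC [simp]: "norm (a *\<^sub>C x) = cmod a * norm x"
proof -
  have "complex_of_real ((norm (a *\<^sub>C x))\<^sup>2) = complex_of_real ((cmod a * norm x)\<^sup>2)"
    unfolding cinner_self[symmetric] cinner_scaleC_left cinner_scaleC_right
    by (simp add: cinner_self power_mult_distrib complex_norm_square[symmetric] mult.assoc[symmetric]
        mult.commute[of "cnj a"] del: of_real_power)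
  then show ?thesis
    by (metis norm_ge_zero mult_nonneg_nonneg of_real_eq_iff power2_eq_imp_eq)
qed

lemma scaleC_diff_right: "a *\<^sub>C (x - y) = a *\<^sub>C x - a *\<^sub>C y"
  by (rule complex_vec.scale_right_diff_distrib)

lemma scaleC_diff_left: "(a - b) *\<^sub>C x = a *\<^sub>C x - b *\<^sub>C x"
  by (rule complex_vec.scale_left_diff_distrib)

lemma scaleC_Pair [simp]: "a *\<^sub>C (x, y) = (a *\<^sub>C x, a *\<^sub>C y)"
  by (simp add: scaleC_prod_def)

lemma scaleR_eq_scaleC: "r *\<^sub>R x = complex_of_real r *\<^sub>C x"
  by (simp add: scaleC_of_real)

lemma cmod_cinner_le: "cmod (cinner x y) \<le> norm x * norm y"
proof (cases "cinner x y = 0")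
  case False
  define a where "a = cnj (cinner x y) / cmod (cinner x y)"
  have a: "cmod a = 1" using False by (simp add: a_def norm_divide)
  have "complex_of_real (cmod (cinner x y)) = cinner x (a *\<^sub>C y)"
    using False unfolding cinner_scaleC_right a_def
    by (simp add: field_simps complex_norm_square[symmetric] flip: power2_eq_square)
  then have "cmod (cinner x y) = inner x (a *\<^sub>C y)"
    by (metis Re_cinner Re_complex_of_real)
  also have "\<dots> \<le> norm x * norm (a *\<^sub>C y)" by (rule norm_cauchy_schwarz)
  finally show ?thesis using a by simp
qed simp

lemma bounded_linear_scaleC: "bounded_linear (\<lambda>x. a *\<^sub>C x)"
  by (rule bounded_linear_intro[where K = "cmod a"])
    (simp_all add: scaleC_add_right scaleC_scaleC scaleR_eq_scaleC mult.commute)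

lemmas tendsto_scaleC [tendsto_intros] = bounded_linear.tendsto[OF bounded_linear_scaleC]
lemmas continuous_on_scaleC [continuous_intros] =
  bounded_linear.continuous_on[OF bounded_linear_scaleC]

lemma bounded_bilinear_cinner: "bounded_bilinear cinner"
proof
  show "\<exists>K. \<forall>a b. cmod (cinner a b) \<le> norm a * norm b * K"
    using cmod_cinner_le by (intro exI[of _ 1]) auto
qed (simp_all add: cinner_add_left cinner_add_right scaleR_eq_scaleC cinner_scaleC_left
    cinner_scaleC_right scaleR_conv_of_real scaleC_complex_def)

lemma csubspaceI:
  assumes "0 \<in> S" "\<And>x y. x \<in> S \<Longrightarrow> y \<in> S \<Longrightarrow> x + y \<in> S" "\<And>c x. x \<in> S \<Longrightarrow> c *\<^sub>C x \<in> S"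
  shows "csubspace S"
  using assms by (auto simp: complex_vec.subspace_def)

lemma csubspace_closure:
  assumes "csubspace S"
  shows "csubspace (closure S)"
proof (rule csubspaceI)
  show "0 \<in> closure S"
    using assms closure_subset complex_vec.subspace_0 by blast
next
  fix x y assume "x \<in> closure S" "y \<in> closure S"
  then obtain u v where "\<And>n. u n \<in> S" "u \<longlonglongrightarrow> x" "\<And>n. v n \<in> S" "v \<longlonglongrightarrow> y"
    unfolding closure_sequential by blast
  then show "x + y \<in> closure S"
    unfolding closure_sequential
    by (intro exI[of _ "\<lambda>n. u n + v n"]) (auto intro: tendsto_add complex_vec.subspace_add[OF assms])
next
  fix c x assume "x \<in> closure S"
  then obtain u where "\<And>n. u n \<in> S" "u \<longlonglongrightarrow> x" unfolding closure_sequential by blast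
  then show "c *\<^sub>C x \<in> closure S"
    unfolding closure_sequential
    by (intro exI[of _ "\<lambda>n. c *\<^sub>C u n"])
      (auto intro: tendsto_scaleC complex_vec.subspace_scale[OF assms])
qed

lemma csubspace_converse:
  assumes V: "csubspace V"
  shows "csubspace (V\<inverse>)"
proof (rule csubspaceI)
  show "0 \<in> V\<inverse>" using complex_vec.subspace_0[OF V] by (simp add: zero_prod_def)
next
  fix p r assume "p \<in> V\<inverse>" "r \<in> V\<inverse>"
  then show "p + r \<in> V\<inverse>"
    using complex_vec.subspace_add[OF V, of "(snd p, fst p)" "(snd r, fst r)"] by (cases p; cases r) simp
next
  fix c p assume "p \<in> V\<inverse>"
  then show "c *\<^sub>C p \<in> V\<inverse>"
    using complex_vec.subspace_scale[OF V, of "(snd p, fst p)" c] by (cases p) simp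
qed

lemma csubspace_Domain:
  assumes V: "csubspace V"
  shows "csubspace (Domain V)"
proof (rule csubspaceI)
  show "0 \<in> Domain V" using complex_vec.subspace_0[OF V] by (auto simp: zero_prod_def)
next
  fix x y assume "x \<in> Domain V" "y \<in> Domain V"
  then obtain x' y' where "(x, x') \<in> V" "(y, y') \<in> V" by blast
  from complex_vec.subspace_add[OF V this] show "x + y \<in> Domain V" by auto
next
  fix c x assume "x \<in> Domain V"
  then obtain x' where "(x, x') \<in> V" by blast
  from complex_vec.subspace_scale[OF V this] show "c *\<^sub>C x \<in> Domain V" by auto
qed

lemma csubspace_Range:
  assumes "csubspace V"
  shows "csubspace (Range V)"
  using csubspace_Domain[OF csubspace_converse[OF assms]] by simp

text \<open>The form in which the parallelogram law delivers the Cauchy property.\<close>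

lemma Cauchy_if_norm_square_le:
  fixes y :: "nat \<Rightarrow> 'a::real_normed_vector"
  assumes "a \<longlonglongrightarrow> (0::real)" and le: "\<And>m n. (norm (y m - y n))\<^sup>2 \<le> a m + a n"
  shows "Cauchy y"
proof (rule CauchyI)
  fix e :: real assume e: "e > 0"
  from LIMSEQ_D[OF assms(1), of "e\<^sup>2 / 2"] e obtain N where N: "\<And>n. n \<ge> N \<Longrightarrow> \<bar>a n\<bar> < e\<^sup>2 / 2"
    by auto
  show "\<exists>N. \<forall>m\<ge>N. \<forall>n\<ge>N. norm (y m - y n) < e"
  proof (intro exI allI impI)
    fix m n assume "m \<ge> N" "n \<ge> N"
    then have "(norm (y m - y n))\<^sup>2 < e\<^sup>2"
      using le[of m n] N[of m] N[of n] by linarith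
    then show "norm (y m - y n) < e" using e power2_less_imp_less[of _ e] by simp
  qed
qed

lemma norm_parallelogram:
  "(norm (x + y))\<^sup>2 + (norm (x - y))\<^sup>2 = 2 * (norm x)\<^sup>2 + 2 * (norm (y::'a::real_inner))\<^sup>2"
  by (simp add: power2_norm_eq_inner inner_add_left inner_add_right inner_diff_left inner_diff_right
      inner_commute)

text \<open>A minimizing sequence for the distance from \<open>x\<close> to \<open>X\<close> is Cauchy by the parallelogram law. At a
  point \<open>p\<close> of minimal distance, orthogonality of \<open>x - p\<close> to \<open>v \<in> X\<close> follows by comparison with the
  point \<open>p + c v\<close> for the coefficient \<open>c\<close> that projects \<open>x - p\<close> onto the line of \<open>v\<close>.\<close>

lemma orthogonal_projection_exists:
  fixes X :: "'a::complex_hilbert_space set"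
  assumes X: "csubspace X" "closed X"
  obtains p where "p \<in> X" "\<And>y. y \<in> X \<Longrightarrow> cinner y (x - p) = 0"
proof -
  define d where "d = infdist x X"
  have ne: "X \<noteq> {}" using complex_vec.subspace_0[OF X(1)] by blast
  have d0: "d \<ge> 0" by (simp add: d_def infdist_nonneg)
  have dle: "d \<le> norm (x - y)" if "y \<in> X" for y
    using infdist_le[OF that, of x] by (simp add: d_def dist_norm)
  have "\<exists>y\<in>X. norm (x - y) < sqrt (d\<^sup>2 + 1 / real (Suc n))" for n
  proof (rule ccontr)
    assume "\<not> ?thesis"
    then have "sqrt (d\<^sup>2 + 1 / real (Suc n)) \<le> d"
      unfolding d_def infdist_notempty[OF ne] by (intro cINF_greatest[OF ne]) (auto simp: dist_norm)
    moreover have "d < sqrt (d\<^sup>2 + 1 / real (Suc n))"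
      by (rule real_less_rsqrt) simp
    ultimately show False by linarith
  qed
  then obtain y where y: "\<And>n. y n \<in> X" "\<And>n. norm (x - y n) < sqrt (d\<^sup>2 + 1 / real (Suc n))"
    by metis
  have ysq: "(norm (x - y n))\<^sup>2 \<le> d\<^sup>2 + 1 / real (Suc n)" for n
  proof -
    have "(norm (x - y n))\<^sup>2 \<le> (sqrt (d\<^sup>2 + 1 / real (Suc n)))\<^sup>2"
      using y(2)[of n] by (intro power_mono) auto
    then show ?thesis by (simp add: add_nonneg_nonneg)
  qed
  have "Cauchy y"
  proof (rule Cauchy_if_norm_square_le)
    show "(\<lambda>n. 2 * (1 / real (Suc n))) \<longlonglongrightarrow> 0"
      using tendsto_mult_right_zero[OF LIMSEQ_inverse_real_of_nat, of 2] by (simp add: inverse_eq_divide)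
    fix m n
    have mid: "(1/2::real) *\<^sub>R (y m + y n) \<in> X"
      using y(1) X(1) by (simp add: scaleR_eq_scaleC complex_vec.subspace_add complex_vec.subspace_scale)
    have "(x - y m) + (x - y n) = 2 *\<^sub>R (x - (1/2::real) *\<^sub>R (y m + y n))"
      by (simp add: algebra_simps scaleR_2)
    then have "norm ((x - y m) + (x - y n)) = 2 * norm (x - (1/2::real) *\<^sub>R (y m + y n))"
      by simp
    then have "2 * d \<le> norm ((x - y m) + (x - y n))" using dle[OF mid] by simp
    then have "(2 * d)\<^sup>2 \<le> (norm ((x - y m) + (x - y n)))\<^sup>2"
      using d0 by (intro power_mono) auto
    moreover have "norm ((x - y m) - (x - y n)) = norm (y m - y n)"
      by (simp add: norm_minus_commute)
    ultimately show "(norm (y m - y n))\<^sup>2 \<le> 2 * (1 / real (Suc m)) + 2 * (1 / real (Suc n))"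
      using norm_parallelogram[of "x - y m" "x - y n"] ysq[of m] ysq[of n]
      by (simp add: power_mult_distrib)
  qed
  then obtain p where p: "y \<longlonglongrightarrow> p" using Cauchy_convergent convergent_def by blast
  have pX: "p \<in> X" using X(2) p y(1) closed_sequentially by blast
  have pd: "norm (x - p) \<le> d"
  proof (rule power2_le_imp_le[OF _ d0], rule LIMSEQ_le)
    show "(\<lambda>n. (norm (x - y n))\<^sup>2) \<longlonglongrightarrow> (norm (x - p))\<^sup>2" by (intro tendsto_intros p)
    show "(\<lambda>n. d\<^sup>2 + 1 / real (Suc n)) \<longlonglongrightarrow> d\<^sup>2"
      using tendsto_add[OF tendsto_const LIMSEQ_inverse_real_of_nat, of "d\<^sup>2"] by (simp add: inverse_eq_divide)
    show "\<exists>N. \<forall>n\<ge>N. (norm (x - y n))\<^sup>2 \<le> d\<^sup>2 + 1 / real (Suc n)" using ysq by blast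
  qed
  show thesis
  proof (rule that[OF pX])
    fix v assume v: "v \<in> X"
    define q where "q = x - p"
    show "cinner v (x - p) = 0"
    proof (cases "v = 0")
      case False
      define c where "c = cinner v q / complex_of_real ((norm v)\<^sup>2)"
      have "p + c *\<^sub>C v \<in> X"
        using pX v X(1) by (simp add: complex_vec.subspace_add complex_vec.subspace_scale)
      then have "norm q \<le> norm (q - c *\<^sub>C v)"
        using dle[of "p + c *\<^sub>C v"] pd by (simp add: q_def algebra_simps)
      then have "(norm q)\<^sup>2 \<le> (norm (q - c *\<^sub>C v))\<^sup>2" by (intro power_mono) auto
      moreover have "complex_of_real ((norm (q - c *\<^sub>C v))\<^sup>2)
          = complex_of_real ((norm q)\<^sup>2 - (cmod (cinner v q))\<^sup>2 / (norm v)\<^sup>2)"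
      proof -
        have vq: "cinner q v = cnj (cinner v q)" by (rule cinner_commute)
        have "complex_of_real ((norm (q - c *\<^sub>C v))\<^sup>2)
            = cinner q q - c * cnj (cinner v q) - cnj c * cinner v q + cnj c * c * cinner v v"
          unfolding cinner_self[symmetric]
          by (simp add: cinner_diff_left cinner_diff_right cinner_scaleC_left cinner_scaleC_right vq
              algebra_simps)
        also have "\<dots> = complex_of_real ((norm q)\<^sup>2) - cinner v q * cnj (cinner v q) / complex_of_real ((norm v)\<^sup>2)"
          using False by (simp add: c_def cinner_self field_simps power2_eq_square)
        also have "\<dots> = complex_of_real ((norm q)\<^sup>2 - (cmod (cinner v q))\<^sup>2 / (norm v)\<^sup>2)"
          by (simp add: complex_norm_square del: of_real_power)
        finally show ?thesis .
      qed
      ultimately have "(norm q)\<^sup>2 \<le> (norm q)\<^sup>2 - (cmod (cinner v q))\<^sup>2 / (norm v)\<^sup>2"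
        by (simp only: of_real_eq_iff)
      then have "(cmod (cinner v q))\<^sup>2 / (norm v)\<^sup>2 \<le> 0" by simp
      then have "cinner v q = 0" using False by (simp add: divide_le_0_iff)
      then show ?thesis by (simp add: q_def)
    qed simp
  qed
qed

section \<open>Bounded inverses of injective operators with closed range\<close>

text \<open>Baire's category theorem for a closed subset of a complete metric space.\<close>

lemma closed_cover_has_interior:
  fixes Y :: "'a::{complete_space} set" and C :: "nat \<Rightarrow> 'a set"
  assumes Y: "closed Y" "Y \<noteq> {}" and C: "\<And>n. closed (C n)" and cover: "Y \<subseteq> (\<Union>n. C n)"
  obtains n y e where "y \<in> Y" "e > 0" "Y \<inter> ball y e \<subseteq> C n"
proof -
  interpret S: Submetric UNIV dist Y by unfold_locales auto
  have comp: "S.sub.mcomplete"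
  proof (rule S.closedin_mcomplete_imp_mcomplete)
    show "closedin Met_TC.mtopology Y" using Y(1) by simp
    show "Met_TC.mcomplete TYPE('a)" unfolding mcomplete_iff_complete by (rule complete_UNIV)
  qed
  have mt: "S.sub.mtopology = top_of_set Y"
    using S.mtopology_submetric by simp
  show thesis
  proof (rule ccontr)
    assume no: "\<not> thesis"
    have "S.sub.mtopology interior_of \<Union>((\<lambda>n. Y \<inter> C n) ` UNIV) = {}"
    proof (rule S.sub.metric_Baire_category_alt[OF comp])
      show "countable ((\<lambda>n. Y \<inter> C n) ` UNIV)" by simp
      fix D assume "D \<in> range (\<lambda>n. Y \<inter> C n)"
      then obtain n where D: "D = Y \<inter> C n" by blast
      have "closedin S.sub.mtopology D" unfolding mt D using C by (simp add: closedin_closed_Int)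
      moreover have "S.sub.mtopology interior_of D = {}"
      proof (rule ccontr)
        assume "S.sub.mtopology interior_of D \<noteq> {}"
        then obtain y where "y \<in> S.sub.mtopology interior_of D" by blast
        then obtain V where V: "openin (top_of_set Y) V" "y \<in> V" "V \<subseteq> D"
          unfolding mt interior_of_def by blast
        then obtain e where "e > 0" "Y \<inter> ball y e \<subseteq> V" "y \<in> Y"
          unfolding openin_contains_ball by (metis inf_commute subsetD)
        then have "Y \<inter> ball y e \<subseteq> C n" using V(3) D by blast
        then show False using no that \<open>e > 0\<close> \<open>y \<in> Y\<close> by blast
      qed
      ultimately show "closedin S.sub.mtopology D \<and> S.sub.mtopology interior_of D = {}" by blast
    qed
    moreover have "\<Union>((\<lambda>n. Y \<inter> C n) ` UNIV) = Y" using cover by blast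
    ultimately have "top_of_set Y interior_of Y = {}" by (simp add: mt)
    then show False using Y(2) by (metis interior_of_topspace topspace_euclidean_subtopology)
  qed
qed

text \<open>The open mapping theorem for \<open>F\<close> as a map from \<open>X\<close> onto \<open>F ` X\<close>. By Baire's theorem the closure of
  the image of some ball has interior points. Hence every \<open>u \<in> F ` X\<close> is, up to an error of half its
  norm, the image of a vector of norm at most \<open>K * norm u\<close>, and iterating this on the error gives a
  preimage of norm at most \<open>2 * K * norm u\<close>.\<close>

lemma bounded_below_if_closed_range:
  fixes F :: "'a::banach \<Rightarrow> 'b::banach"
  assumes F: "bounded_linear F" and X: "subspace X" "closed X" and R: "closed (F ` X)"
    and inj: "\<And>x. x \<in> X \<Longrightarrow> F x = 0 \<Longrightarrow> x = 0"
  obtains c where "c > 0" "\<And>x. x \<in> X \<Longrightarrow> c * norm x \<le> norm (F x)"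
proof -
  interpret F: bounded_linear F by (rule F)
  define C where "C n = closure (F ` (X \<inter> cball 0 (real n)))" for n
  have cover: "F ` X \<subseteq> (\<Union>n. C n)"
  proof
    fix y assume "y \<in> F ` X"
    then obtain x where x: "x \<in> X" "y = F x" by blast
    obtain n where "norm x \<le> real n" using real_arch_simple by blast
    then have "y \<in> F ` (X \<inter> cball 0 (real n))" using x by auto
    then have "y \<in> C n" unfolding C_def by (rule closure_subset[THEN subsetD])
    then show "y \<in> (\<Union>n. C n)" by (rule UN_I[OF UNIV_I])
  qed
  obtain n y e where y: "y \<in> F ` X" "e > 0" and sub: "F ` X \<inter> ball y e \<subseteq> C n"
  proof (rule closed_cover_has_interior[OF R _ _ cover])
    show "F ` X \<noteq> {}" using subspace_0[OF X(1)] by blast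
    show "closed (C n)" for n by (simp add: C_def)
  qed
  have FX: "subspace (F ` X)"
    using X(1) F.linear_axioms by (simp add: linear_subspace_image)
  \<comment> \<open>Differences of points of \<open>C n\<close> are limits of images of vectors of norm at most \<open>2 * n\<close>.\<close>
  have approx: "\<exists>x\<in>X. norm x \<le> 2 * real n \<and> norm (u - F x) < d" if u: "u \<in> F ` X" "norm u < e" "d > 0" for u d
  proof -
    have "y + u \<in> F ` X" using FX y(1) u(1) by (rule subspace_add)
    then have "y + u \<in> C n" using sub u(2) by (metis Int_iff add_diff_cancel_left' dist_norm mem_ball norm_minus_commute subsetD)
    moreover have "y \<in> C n" using sub y by (auto simp: dist_norm)
    moreover have near: "\<exists>a\<in>X. norm a \<le> real n \<and> norm (F a - v) < d / 2" if "v \<in> C n" for v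
    proof -
      have "d / 2 > 0" using u(3) by simp
      then obtain w where "w \<in> F ` (X \<inter> cball 0 (real n))" "dist w v < d / 2"
        using \<open>v \<in> C n\<close> unfolding C_def closure_approachable by blast
      then show ?thesis by (auto simp: dist_norm)
    qed
    ultimately obtain a b where ab: "a \<in> X" "norm a \<le> real n" "norm (F a - (y + u)) < d / 2"
        "b \<in> X" "norm b \<le> real n" "norm (F b - y) < d / 2"
      by blast
    have "norm (u - F (a - b)) = norm ((F b - y) - (F a - (y + u)))"
      by (simp add: F.diff algebra_simps)
    also have "\<dots> \<le> norm (F b - y) + norm (F a - (y + u))" by (rule norm_triangle_ineq4)
    finally have "norm (u - F (a - b)) < d" using ab by linarith
    moreover have "norm (a - b) \<le> 2 * real n" using norm_triangle_ineq4[of a b] ab by linarith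
    moreover have "a - b \<in> X" using X(1) ab subspace_diff by blast
    ultimately show ?thesis by blast
  qed
  define K where "K = 4 * real n / e"
  have K0: "K \<ge> 0" using y(2) by (simp add: K_def)
  have half: "\<exists>x\<in>X. norm x \<le> K * norm u \<and> norm (u - F x) \<le> norm u / 2" if u: "u \<in> F ` X" for u
  proof (cases "u = 0")
    case True
    then show ?thesis using subspace_0[OF X(1)] by (intro bexI[of _ 0]) (auto simp: F.zero)
  next
    case False
    \<comment> \<open>Scaling by \<open>s\<close> moves \<open>u\<close> to norm \<open>e / 2\<close>, well inside the ball of radius \<open>e\<close>.\<close>
    define s where "s = e / (2 * norm u)"
    have s: "s > 0" using False y(2) by (simp add: s_def)
    have "s *\<^sub>R u \<in> F ` X" using FX u by (rule subspace_scale)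
    moreover have "norm (s *\<^sub>R u) < e" using False y(2) by (simp add: s_def)
    moreover have "e / 4 > 0" using y(2) by simp
    ultimately obtain x where x: "x \<in> X" "norm x \<le> 2 * real n" "norm (s *\<^sub>R u - F x) < e / 4"
      using approx by blast
    have "u - F ((1 / s) *\<^sub>R x) = (1 / s) *\<^sub>R (s *\<^sub>R u - F x)"
      using s by (simp add: F.scaleR scaleR_diff_right)
    then have "norm (u - F ((1 / s) *\<^sub>R x)) = norm (s *\<^sub>R u - F x) / s" using s by simp
    also have "\<dots> \<le> (e / 4) / s" using x s by (intro divide_right_mono) auto
    also have "\<dots> = norm u / 2" using y(2) False by (simp add: s_def field_simps)
    finally have "norm (u - F ((1 / s) *\<^sub>R x)) \<le> norm u / 2" .
    moreover have "norm ((1 / s) *\<^sub>R x) \<le> K * norm u"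
    proof -
      have "norm ((1 / s) *\<^sub>R x) = norm x / s" using s by simp
      also have "\<dots> \<le> 2 * real n / s" using x s by (intro divide_right_mono) auto
      also have "\<dots> = K * norm u" using y(2) False by (simp add: s_def K_def field_simps)
      finally show ?thesis .
    qed
    moreover have "(1 / s) *\<^sub>R x \<in> X" using X(1) x(1) by (rule subspace_scale)
    ultimately show ?thesis by blast
  qed
  then obtain g where g: "\<And>u. u \<in> F ` X \<Longrightarrow> g u \<in> X \<and> norm (g u) \<le> K * norm u \<and> norm (u - F (g u)) \<le> norm u / 2"
    by metis
  have bound: "norm x \<le> 2 * K * norm (F x)" if x: "x \<in> X" for x
  proof -
    define r where "r k = ((\<lambda>u. u - F (g u)) ^^ k) (F x)" for k
    have r0: "r 0 = F x" and rS: "r (Suc k) = r k - F (g (r k))" for k by (simp_all add: r_def)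
    have rX: "r k \<in> F ` X" for k
    proof (induction k)
      case (Suc k)
      then show ?case unfolding rS using FX g by (intro subspace_diff) auto
    qed (use x r0 in auto)
    have rn: "norm (r k) \<le> norm (F x) * (1/2) ^ k" for k
    proof (induction k)
      case (Suc k)
      then show ?case using g[OF rX[of k]] unfolding rS by simp
    qed (simp add: r0)
    have gn: "norm (g (r k)) \<le> K * norm (F x) * (1/2) ^ k" for k
      using g[OF rX[of k]] mult_left_mono[OF rn[of k] K0] by (simp add: mult.assoc)
    have geo_sums: "(\<lambda>k. K * norm (F x) * (1/2) ^ k) sums (2 * K * norm (F x))"
      using sums_mult[OF geometric_sums[of "1/2 :: real"], of "K * norm (F x)"] by (simp add: mult_ac)
    then have geo: "summable (\<lambda>k. K * norm (F x) * (1/2) ^ k)" by (rule sums_summable)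
    have sn: "summable (\<lambda>k. norm (g (r k)))"
      by (rule summable_comparison_test[OF _ geo]) (use gn in auto)
    then have sg: "summable (\<lambda>k. g (r k))" by (rule summable_norm_cancel)
    define s where "s = (\<Sum>k. g (r k))"
    have part: "F (\<Sum>k<m. g (r k)) = F x - r m" for m
      by (induction m) (simp_all add: F.zero F.add r0 rS)
    have lim: "(\<lambda>m. \<Sum>k<m. g (r k)) \<longlonglongrightarrow> s" unfolding s_def using sg by (rule summable_LIMSEQ)
    have sX: "s \<in> X"
    proof (rule closed_sequentially[OF X(2) _ lim])
      show "(\<Sum>k<m. g (r k)) \<in> X" for m
        using g rX by (intro subspace_sum[OF X(1)]) simp
    qed
    have "r \<longlonglongrightarrow> 0"
    proof (rule Lim_null_comparison[where g = "\<lambda>k. norm (F x) * (1/2) ^ k"])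
      show "\<forall>\<^sub>F k in sequentially. norm (r k) \<le> norm (F x) * (1/2) ^ k" using rn by simp
      show "(\<lambda>k. norm (F x) * (1/2) ^ k) \<longlonglongrightarrow> 0" by (intro tendsto_mult_right_zero LIMSEQ_realpow_zero) auto
    qed
    then have "(\<lambda>m. F (\<Sum>k<m. g (r k))) \<longlonglongrightarrow> F x"
      unfolding part using tendsto_diff[OF tendsto_const] by fastforce
    then have "F s = F x" using F.tendsto[OF lim] LIMSEQ_unique by blast
    then have "s = x" using inj[of "s - x"] X(1) sX x by (simp add: F.diff subspace_diff)
    moreover have "norm s \<le> (\<Sum>k. norm (g (r k)))" unfolding s_def using sn by (rule summable_norm)
    moreover have "(\<Sum>k. norm (g (r k))) \<le> (\<Sum>k. K * norm (F x) * (1/2) ^ k)"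
      by (rule suminf_le[OF gn sn geo])
    moreover have "(\<Sum>k. K * norm (F x) * (1/2) ^ k) = 2 * K * norm (F x)"
      using geo_sums by (rule sums_unique[symmetric])
    ultimately show ?thesis by simp
  qed
  show thesis
  proof (rule that[of "1 / (2 * K + 1)"])
    show "1 / (2 * K + 1) > 0" using K0 by simp
    fix x assume "x \<in> X"
    then have "norm x \<le> (2 * K + 1) * norm (F x)" 
      using bound[of x] norm_ge_zero[of "F x"] unfolding distrib_right by linarith
    then show "1 / (2 * K + 1) * norm x \<le> norm (F x)" using K0 by (simp add: field_simps)
  qed
qed

section \<open>Krein spaces\<close>

locale krein =
  fixes ip :: "'h::complex_hilbert_space \<Rightarrow> 'h \<Rightarrow> complex" and J :: "'h \<Rightarrow> 'h"
  assumes krein: "krein_space ip J"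
begin

lemma ip_commute: "ip f g = cnj (ip g f)"
  and ip_add_right: "ip f (g + h) = ip f g + ip f h"
  and ip_scaleC_right: "ip f (c *\<^sub>C g) = c * ip f g"
  and J_J [simp]: "J (J f) = f"
  and cinner_eq_ip: "cinner f g = ip f (J g)"
  using krein unfolding krein_space_def by blast+

lemma J_add: "J (f + g) = J f + J g" and J_scaleC: "J (c *\<^sub>C f) = c *\<^sub>C J f"
  using krein unfolding krein_space_def Vector_Spaces.linear_iff by blast+

lemma ip_eq_cinner: "ip f g = cinner f (J g)"
  by (simp add: cinner_eq_ip)

lemma J_minus: "J (- f) = - J f"
  using J_scaleC[of "-1" f] by simp

lemma J_diff: "J (f - g) = J f - J g"
  using J_add[of f "- g"] by (simp add: J_minus)

lemma ip_add_left: "ip (f + g) h = ip f h + ip g h"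
  and ip_scaleC_left: "ip (c *\<^sub>C f) g = cnj c * ip f g"
  and ip_zero [simp]: "ip 0 g = 0" "ip f 0 = 0"
  and ip_minus_right: "ip f (- g) = - ip f g"
  and ip_diff_left: "ip (f - g) h = ip f h - ip g h"
  and ip_diff_right: "ip f (g - h) = ip f g - ip f h"
proof -
  have "J 0 = 0" using J_scaleC[of 0 0] by simp
  then show "ip f 0 = 0" by (simp add: ip_eq_cinner)
qed (simp_all add: ip_eq_cinner cinner_add_left cinner_scaleC_left cinner_minus_left cinner_minus_right
    cinner_diff_left cinner_diff_right J_minus J_diff)

lemma ip_sum_right: "ip f (\<Sum>i\<in>I. g i) = (\<Sum>i\<in>I. ip f (g i))"
  by (induction I rule: infinite_finite_induct) (simp_all add: ip_add_right)

lemma ip_sum_left: "ip (\<Sum>i\<in>I. g i) f = (\<Sum>i\<in>I. ip (g i) f)"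
  by (induction I rule: infinite_finite_induct) (simp_all add: ip_add_left)

lemma Im_ip_self [simp]: "Im (ip f f) = 0"
  by (metis ip_commute cnj.simps(2) equal_neg_zero)

lemma ip_self: "ip f f = complex_of_real (Re (ip f f))"
  by (simp add: complex_eq_iff)

lemma cmod_ip_self: "cmod (ip f f) = \<bar>Re (ip f f)\<bar>"
  by (metis ip_self norm_of_real)

lemma Re_ip_scaleR_self: "Re (ip (r *\<^sub>R f) (r *\<^sub>R f)) = r\<^sup>2 * Re (ip f f)"
  by (simp add: scaleR_eq_scaleC ip_scaleC_left ip_scaleC_right power2_eq_square)

lemma norm_J [simp]: "norm (J f) = norm f"
proof -
  have "cinner (J f) (J f) = cnj (cinner f f)"
    unfolding cinner_eq_ip by (simp add: ip_commute[of "J f" f])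
  then have "(norm (J f))\<^sup>2 = (norm f)\<^sup>2"
    by (metis cinner_self complex_cnj_complex_of_real of_real_eq_iff)
  then show ?thesis by (simp add: power2_eq_iff_nonneg)
qed

lemma cmod_ip_le: "cmod (ip f g) \<le> norm f * norm g"
  using cmod_cinner_le[of f "J g"] by (simp add: ip_eq_cinner)

lemma bounded_bilinear_ip: "bounded_bilinear ip"
proof
  show "\<exists>K. \<forall>a b. cmod (ip a b) \<le> norm a * norm b * K"
    using cmod_ip_le by (intro exI[of _ 1]) auto
qed (simp_all add: ip_add_left ip_add_right scaleR_eq_scaleC ip_scaleC_left ip_scaleC_right
    scaleC_complex_def)

lemmas tendsto_ip = bounded_bilinear.tendsto[OF bounded_bilinear_ip]
lemmas continuous_on_ip = bounded_bilinear.continuous_on[OF bounded_bilinear_ip]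

lemma closed_ip_right: "closed {f. ip f g = 0}" and closed_ip_left: "closed {f. ip g f = 0}"
  by (intro closed_Collect_eq continuous_on_ip continuous_intros)+

text \<open>A bounded sequence that tends to zero against a total set tends to zero weakly; the next two
  lemmas are this fact in the form of a closed subspace.\<close>

lemma csubspace_weak_null: "csubspace {x. (\<lambda>n. ip (a n) x) \<longlonglongrightarrow> 0}"
proof (rule csubspaceI; unfold mem_Collect_eq)
  show "(\<lambda>n. ip (a n) 0) \<longlonglongrightarrow> 0" by simp
  show "(\<lambda>n. ip (a n) (x + y)) \<longlonglongrightarrow> 0"
    if "(\<lambda>n. ip (a n) x) \<longlonglongrightarrow> 0" "(\<lambda>n. ip (a n) y) \<longlonglongrightarrow> 0" for x y
    using tendsto_add[OF that] by (simp add: ip_add_right)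
  show "(\<lambda>n. ip (a n) (c *\<^sub>C x)) \<longlonglongrightarrow> 0" if "(\<lambda>n. ip (a n) x) \<longlonglongrightarrow> 0" for c x
    using tendsto_mult_right_zero[OF that] by (simp add: ip_scaleC_right)
qed

lemma closed_weak_null:
  assumes bound: "\<And>n. norm (a n) \<le> M"
  shows "closed {x. (\<lambda>n. ip (a n) x) \<longlonglongrightarrow> 0}"
  unfolding closed_sequential_limits
proof (intro allI impI)
  fix x l assume xl: "(\<forall>k. x k \<in> {x. (\<lambda>n. ip (a n) x) \<longlonglongrightarrow> 0}) \<and> x \<longlonglongrightarrow> l"
  have M: "M \<ge> 0" using order_trans[OF norm_ge_zero bound] .
  have "(\<lambda>n. ip (a n) l) \<longlonglongrightarrow> 0"
  proof (rule LIMSEQ_I)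
    fix e :: real assume e: "e > 0"
    then have "e / (2 * (M + 1)) > 0" using M by simp
    then obtain k where k: "norm (x k - l) < e / (2 * (M + 1))"
      using LIMSEQ_D[OF conjunct2[OF xl]] by blast
    have "(\<lambda>n. ip (a n) (x k)) \<longlonglongrightarrow> 0" using xl by simp
    then obtain n0 where n0: "\<And>n. n \<ge> n0 \<Longrightarrow> cmod (ip (a n) (x k)) < e / 2"
      using LIMSEQ_D[of "\<lambda>n. ip (a n) (x k)" 0 "e / 2"] e by auto
    show "\<exists>no. \<forall>n\<ge>no. norm (ip (a n) l - 0) < e"
    proof (intro exI allI impI)
      fix n assume n: "n \<ge> n0"
      have "ip (a n) l = ip (a n) (x k) - ip (a n) (x k - l)" by (simp add: ip_diff_right)
      then have "cmod (ip (a n) l) \<le> cmod (ip (a n) (x k)) + cmod (ip (a n) (x k - l))"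
        by (metis norm_triangle_ineq4)
      also have "cmod (ip (a n) (x k - l)) \<le> M * norm (x k - l)"
        using cmod_ip_le[of "a n" "x k - l"] mult_right_mono[OF bound[of n], of "norm (x k - l)"]
        by simp
      also have "M * norm (x k - l) \<le> (M + 1) * norm (x k - l)" by (simp add: mult_right_mono)
      also have "(M + 1) * norm (x k - l) < e / 2" using k M by (simp add: field_simps)
      finally show "norm (ip (a n) l - 0) < e" using n0[OF n] by simp
    qed
  qed
  then show "l \<in> {x. (\<lambda>n. ip (a n) x) \<longlonglongrightarrow> 0}" by simp
qed

lemma eq_zero_if_orthogonal_to_dense:
  assumes D: "closure D = UNIV" and f: "\<And>g. g \<in> D \<Longrightarrow> ip g f = 0"
  shows "f = 0"
proof -
  have "closure D \<subseteq> {g. ip g f = 0}"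
    using f by (intro closure_minimal closed_ip_right) auto
  then have "ip (J f) f = 0" using D by auto
  then have "cinner f f = 0" by (metis cinner_eq_ip ip_commute complex_cnj_zero)
  then show ?thesis by (simp add: cinner_self)
qed

text \<open>Passing to the negative inner product exchanges the two eigenspaces of \<open>J\<close>, so that in a
  Pontryagin space the eigenspace for \<open>-1\<close> may be taken as the finite-dimensional one.\<close>

lemma krein_uminus: "krein (\<lambda>f g. - ip f g) (\<lambda>f. - J f)"
proof
  have "vector_space (scaleC :: complex \<Rightarrow> 'h \<Rightarrow> 'h)" ..
  then show "krein_space (\<lambda>f g. - ip f g) (\<lambda>f. - J f)"
    unfolding krein_space_def Vector_Spaces.linear_iff
    by (auto simp: ip_add_right ip_scaleC_right J_add J_scaleC J_minus cinner_eq_ip ip_minus_right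
        intro: ip_commute)
qed

text \<open>The vector \<open>(f - J f) / 2\<close> is the component of \<open>f\<close> in the eigenspace of \<open>J\<close> for \<open>-1\<close>: the identity
  compares the two signs in the canonical decomposition.\<close>

lemma ip_self_neg_part: "(norm f)\<^sup>2 = Re (ip f f) + 2 * (norm ((1/2::real) *\<^sub>R (f - J f)))\<^sup>2"
proof -
  have "inner f (J f) = Re (ip f f)" by (metis Re_cinner ip_eq_cinner)
  then have "(norm (f - J f))\<^sup>2 = 2 * (norm f)\<^sup>2 - 2 * Re (ip f f)"
    using dot_norm_neg[of f "J f"] by simp
  moreover have "(norm ((1/2::real) *\<^sub>R (f - J f)))\<^sup>2 = (norm (f - J f))\<^sup>2 / 4"
    by (simp add: power_mult_distrib power2_eq_square)
  ultimately show ?thesis by simp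
qed

definition neg_orthonormal :: "'h set \<Rightarrow> bool" where
  "neg_orthonormal E \<longleftrightarrow> (\<forall>e\<in>E. \<forall>e'\<in>E. ip e e' = (if e = e' then -1 else 0))"

lemma ip_neg_orthonormal_sum:
  assumes "finite E" "neg_orthonormal E" "e \<in> E"
  shows "ip e (\<Sum>e'\<in>E. c e' *\<^sub>C e') = - c e"
proof -
  have "ip e (\<Sum>e'\<in>E. c e' *\<^sub>C e') = (\<Sum>e'\<in>E. if e' = e then - c e' else 0)"
    unfolding ip_sum_right ip_scaleC_right
    using assms by (intro sum.cong) (auto simp: neg_orthonormal_def)
  then show ?thesis using assms by simp
qed

lemma Re_ip_neg_orthonormal_sum:
  assumes "finite E" "neg_orthonormal E"
  shows "Re (ip (\<Sum>e\<in>E. c e *\<^sub>C e) (\<Sum>e\<in>E. c e *\<^sub>C e)) = - (\<Sum>e\<in>E. (cmod (c e))\<^sup>2)"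
proof -
  have "ip (\<Sum>e\<in>E. c e *\<^sub>C e) (\<Sum>e\<in>E. c e *\<^sub>C e) = (\<Sum>e\<in>E. - complex_of_real ((cmod (c e))\<^sup>2))"
    unfolding ip_sum_left ip_scaleC_left
    using assms
    by (intro sum.cong) (auto simp: ip_neg_orthonormal_sum complex_norm_square simp del: of_real_power)
  then show ?thesis by (simp add: sum_negf)
qed

text \<open>On the span of a negative orthonormal system the projection to the eigenspace of \<open>J\<close> for \<open>-1\<close> is
  injective, since a vector in its kernel is nonnegative. Hence the cardinality of such systems is bounded, and
  a system in \<open>D\<close> of largest cardinality leaves only nonnegative vectors in its orthogonal complement
  in \<open>D\<close>, as a negative one could be normalized and added. One application takes for \<open>D\<close> the domain of a
  densely defined relation.\<close>

lemma maximal_neg_orthonormal: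
  assumes D: "csubspace D" and B: "finite B" "{f. J f = - f} \<subseteq> cspan B"
  obtains E where "finite E" "E \<subseteq> D" "neg_orthonormal E"
    "\<And>f. f \<in> D \<Longrightarrow> (\<And>e. e \<in> E \<Longrightarrow> ip e f = 0) \<Longrightarrow> 0 \<le> Re (ip f f)"
proof -
  define P where "P E \<longleftrightarrow> finite E \<and> E \<subseteq> D \<and> neg_orthonormal E" for E
  have bound: "card E \<le> card B" if E: "finite E" "neg_orthonormal E" for E
  proof -
    define Q where "Q f = (1/2::complex) *\<^sub>C (f - J f)" for f
    have Qsum: "Q (\<Sum>e\<in>E. c e *\<^sub>C e) = (\<Sum>e\<in>E. c e *\<^sub>C Q e)" for c
    proof -
      have "Q (f + g) = Q f + Q g" for f g
        by (simp add: Q_def J_add algebra_simps scaleC_add_right scaleC_diff_right)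
      moreover have "Q 0 = 0" using J_scaleC[of 0 0] by (simp add: Q_def)
      ultimately have "Q (\<Sum>e\<in>E. c e *\<^sub>C e) = (\<Sum>e\<in>E. Q (c e *\<^sub>C e))"
        by (rule sum_comp_morphism[unfolded o_def, symmetric, rotated])
      then show ?thesis
        by (simp add: Q_def J_scaleC scaleC_scaleC scaleC_diff_right mult.commute)
    qed
    have zero: "c e = 0" if Q0: "(\<Sum>e\<in>E. c e *\<^sub>C Q e) = 0" and e: "e \<in> E" for c e
    proof -
      define f where "f = (\<Sum>e\<in>E. c e *\<^sub>C e)"
      have "Q f = 0" unfolding f_def Qsum by (rule Q0)
      moreover have "(1/2::real) *\<^sub>R (f - J f) = Q f" by (simp add: Q_def scaleR_eq_scaleC)
      ultimately have "(1/2::real) *\<^sub>R (f - J f) = 0" by simp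
      then have "Re (ip f f) = (norm f)\<^sup>2" using ip_self_neg_part[of f] by simp
      then have "Re (ip f f) \<ge> 0" by (metis zero_le_power2)
      then have "(\<Sum>e\<in>E. (cmod (c e))\<^sup>2) \<le> 0"
        unfolding f_def Re_ip_neg_orthonormal_sum[OF E] by simp
      then have "(\<Sum>e\<in>E. (cmod (c e))\<^sup>2) = 0" by (simp add: antisym sum_nonneg)
      then show ?thesis using e E(1) by (simp add: sum_nonneg_eq_0_iff)
    qed
    have inj: "inj_on Q E"
    proof (rule inj_onI, rule ccontr)
      fix a b assume ab: "a \<in> E" "b \<in> E" "Q a = Q b" "a \<noteq> b"
      define c where "c e = (if e = a then 1 else if e = b then -1 else (0::complex))" for e
      have "(\<Sum>e\<in>E. c e *\<^sub>C Q e) = (\<Sum>e\<in>{a,b}. c e *\<^sub>C Q e)"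
        using ab E(1) by (intro sum.mono_neutral_right) (auto simp: c_def)
      also have "\<dots> = 0" using ab by (simp add: c_def)
      finally show False using zero ab(1) by (fastforce simp: c_def)
    qed
    have "\<not> complex_vec.dependent (Q ` E)"
    proof
      assume "complex_vec.dependent (Q ` E)"
      then obtain u e where *: "(\<Sum>v\<in>Q ` E. u v *\<^sub>C v) = 0" "e \<in> E" "u (Q e) \<noteq> 0"
        unfolding complex_vec.dependent_finite[OF finite_imageI[OF E(1)]] by auto
      have "(\<Sum>e\<in>E. (u \<circ> Q) e *\<^sub>C Q e) = 0" using *(1) inj by (simp add: sum.reindex)
      from zero[OF this *(2)] show False using *(3) by simp
    qed
    moreover have "Q ` E \<subseteq> cspan B"
      using B(2) by (auto simp: Q_def J_scaleC J_diff subset_iff simp flip: complex_vec.scale_minus_right)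
    ultimately have "card (Q ` E) \<le> card B"
      using complex_vec.independent_span_bound[OF B(1)] by blast
    then show ?thesis using inj by (simp add: card_image)
  qed
  have "P {}" by (simp add: P_def neg_orthonormal_def)
  moreover have "\<forall>E. P E \<longrightarrow> card E < Suc (card B)" using bound by (simp add: P_def less_Suc_eq_le)
  ultimately have "\<exists>E. P E \<and> (\<forall>E'. P E' \<longrightarrow> card E' \<le> card E)"
    by (rule ex_has_greatest_nat)
  then obtain E where E: "P E" "\<And>E'. P E' \<Longrightarrow> card E' \<le> card E" by blast
  show thesis
  proof (rule that[of E])
    fix f assume f: "f \<in> D" "\<And>e. e \<in> E \<Longrightarrow> ip e f = 0"
    show "0 \<le> Re (ip f f)"
    proof (rule ccontr)
      assume "\<not> ?thesis"
      then have neg: "Re (ip f f) < 0" by simp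
      define r where "r = 1 / sqrt (- Re (ip f f))"
      define g where "g = complex_of_real r *\<^sub>C f"
      have "ip g g = complex_of_real (r\<^sup>2 * Re (ip f f))"
        unfolding g_def ip_scaleC_left ip_scaleC_right
        by (subst ip_self) (simp add: power2_eq_square)
      also have "r\<^sup>2 * Re (ip f f) = -1" using neg by (simp add: r_def power_divide)
      finally have gg: "ip g g = -1" by simp
      have eg: "ip e g = 0" if "e \<in> E" for e
        using f(2)[OF that] by (simp add: g_def ip_scaleC_right)
      have ge: "ip g e = 0" if "e \<in> E" for e
        using eg[OF that] by (metis ip_commute complex_cnj_zero)
      have "g \<notin> E" using gg eg by force
      moreover have "P (insert g E)"
        using E(1) f(1) D gg eg ge
        by (auto simp: P_def neg_orthonormal_def g_def intro: complex_vec.subspace_scale)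
      ultimately show False using E(2)[of "insert g E"] E(1) by (simp add: P_def)
    qed
  qed (use E(1) in \<open>auto simp: P_def\<close>)
qed

end

lemma compact_bounded_combinations:
  fixes E :: "'a::complex_hilbert_space set"
  assumes "finite E"
  obtains K where "compact K" "\<And>c. (\<And>e. e \<in> E \<Longrightarrow> cmod (c e) \<le> 1) \<Longrightarrow> (\<Sum>e\<in>E. c e *\<^sub>C e) \<in> K"
proof -
  have "\<exists>K. compact K \<and> (\<forall>c. (\<forall>e\<in>E. cmod (c e) \<le> 1) \<longrightarrow> (\<Sum>e\<in>E. c e *\<^sub>C e) \<in> K)"
    using assms
  proof (induction E)
    case empty
    show ?case by (intro exI[of _ "{0}"]) simp
  next
    case (insert a E)
    then obtain K where K: "compact K" "\<And>c. \<forall>e\<in>E. cmod (c e) \<le> 1 \<Longrightarrow> (\<Sum>e\<in>E. c e *\<^sub>C e) \<in> K"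
      by blast
    have cont: "continuous_on (cball 0 1) (\<lambda>c::complex. c *\<^sub>C a)"
    proof (rule bounded_linear.continuous_on[OF _ continuous_on_id])
      show "bounded_linear (\<lambda>c::complex. c *\<^sub>C a)"
        by (rule bounded_linear_intro[where K = "norm a"])
          (simp_all add: scaleC_add_left scaleR_eq_scaleC scaleC_scaleC scaleC_complex_def)
    qed
    show ?case
    proof (intro exI conjI allI impI)
      show "compact {x + y | x y. x \<in> (\<lambda>c. c *\<^sub>C a) ` cball 0 1 \<and> y \<in> K}"
        using compact_continuous_image[OF cont compact_cball] K(1) by (rule compact_sums)
      fix c assume "\<forall>e\<in>insert a E. cmod (c e) \<le> 1"
      then have "c a *\<^sub>C a \<in> (\<lambda>c. c *\<^sub>C a) ` cball 0 1" "(\<Sum>e\<in>E. c e *\<^sub>C e) \<in> K"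
        using K(2)[of c] by auto
      moreover have "(\<Sum>e\<in>insert a E. c e *\<^sub>C e) = c a *\<^sub>C a + (\<Sum>e\<in>E. c e *\<^sub>C e)"
        using insert.hyps by simp
      ultimately show "(\<Sum>e\<in>insert a E. c e *\<^sub>C e) \<in> {x + y | x y. x \<in> (\<lambda>c. c *\<^sub>C a) ` cball 0 1 \<and> y \<in> K}"
        by blast
    qed
  qed
  then show thesis using that by blast
qed

context krein
begin

text \<open>The projection onto the finite-dimensional eigenspace of \<open>J\<close> is a compact operator. The eigenspace is
  spanned by a maximal negative orthonormal system in it, because its form is minus the Hilbert inner
  product; the coefficients of a vector with respect to this system are bounded by its norm.\<close>

lemma neg_part_in_compact:
  assumes B: "finite B" "{f. J f = - f} \<subseteq> cspan B"
  obtains K where "compact K" "\<And>f. norm f \<le> 1 \<Longrightarrow> (1/2::real) *\<^sub>R (f - J f) \<in> K"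
proof -
  let ?D = "{f. J f = - f}"
  have D: "csubspace ?D"
    by (rule csubspaceI) (use J_scaleC[of 0 0] in \<open>auto simp: J_add J_scaleC\<close>)
  have ipD: "ip g f = - cinner g f" if "f \<in> ?D" for f g
    using that by (simp add: ip_eq_cinner cinner_minus_right)
  obtain E where E: "finite E" "E \<subseteq> ?D" "neg_orthonormal E"
    and max: "\<And>f. f \<in> ?D \<Longrightarrow> (\<And>e. e \<in> E \<Longrightarrow> ip e f = 0) \<Longrightarrow> 0 \<le> Re (ip f f)"
    using maximal_neg_orthonormal[OF D B] by blast
  have expand: "(\<Sum>e\<in>E. (- ip e g) *\<^sub>C e) = g" if g: "g \<in> ?D" for g
  proof -
    define s where "s = (\<Sum>e\<in>E. (- ip e g) *\<^sub>C e)"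
    define h where "h = g - s"
    have "s \<in> ?D" unfolding s_def
      using E(2) by (intro complex_vec.subspace_sum[OF D] complex_vec.subspace_scale[OF D]) auto
    with g have h: "h \<in> ?D" unfolding h_def by (intro complex_vec.subspace_diff[OF D])
    have "ip e s = ip e g" if "e \<in> E" for e
      unfolding s_def using ip_neg_orthonormal_sum[OF E(1,3) that, of "\<lambda>e. - ip e g"] by simp
    then have "0 \<le> Re (ip h h)" using h by (intro max) (auto simp: h_def ip_diff_right)
    then have "h = 0" using ipD[OF h, of h] by (simp add: cinner_self)
    then show ?thesis by (simp add: h_def s_def)
  qed
  obtain K where K: "compact K"
      "\<And>c. (\<And>e. e \<in> E \<Longrightarrow> cmod (c e) \<le> 1) \<Longrightarrow> (\<Sum>e\<in>E. c e *\<^sub>C e) \<in> K"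
    using compact_bounded_combinations[OF E(1)] by blast
  show thesis
  proof (rule that[OF K(1)])
    fix f :: 'h assume f: "norm f \<le> 1"
    define g where "g = (1/2::real) *\<^sub>R (f - J f)"
    have g: "g \<in> ?D" by (simp add: g_def scaleR_eq_scaleC J_scaleC J_diff flip: complex_vec.scale_minus_right)
    have "norm (f - J f) \<le> 2" using norm_triangle_ineq4[of f "J f"] f by simp
    then have ng: "norm g \<le> 1" by (simp add: g_def)
    have "cmod (- ip e g) \<le> 1" if e: "e \<in> E" for e
    proof -
      have "cinner e e = 1"
        using ipD[of e e] e E(2,3) by (auto simp: neg_orthonormal_def minus_equation_iff)
      then have "(norm e)\<^sup>2 = 1" by (simp add: cinner_self flip: of_real_power)
      then have "norm e = 1" using power2_eq_iff_nonneg[of "norm e" 1] by simp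
      then show ?thesis using cmod_ip_le[of e g] ng by simp
    qed
    then have "(\<Sum>e\<in>E. (- ip e g) *\<^sub>C e) \<in> K" by (rule K(2))
    then show "(1/2::real) *\<^sub>R (f - J f) \<in> K" using expand[OF g] by (simp add: g_def)
  qed
qed

text \<open>If the form took both signs on \<open>N\<close>, it would vanish somewhere on the segment between a negative and
  a positive vector. The segment misses \<open>0\<close>, for otherwise the endpoints would be proportional.\<close>

lemma neutral_free_imp_semidefinite:
  assumes N: "csubspace N" and free: "\<And>f. f \<in> N \<Longrightarrow> ip f f = 0 \<Longrightarrow> f = 0"
  obtains s :: real where "\<bar>s\<bar> = 1" "\<And>f. f \<in> N \<Longrightarrow> cmod (ip f f) = s * Re (ip f f)"
proof -
  have "(\<forall>f\<in>N. 0 \<le> Re (ip f f)) \<or> (\<forall>f\<in>N. Re (ip f f) \<le> 0)"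
  proof (rule ccontr)
    assume "\<not> ?thesis"
    then obtain f g where f: "f \<in> N" "Re (ip f f) < 0" and g: "g \<in> N" "0 < Re (ip g g)"
      by (auto simp: not_le)
    define h where "h t = (1 - t) *\<^sub>R f + t *\<^sub>R g" for t :: real
    have "continuous_on {0..1} (\<lambda>t. Re (ip (h t) (h t)))"
      unfolding h_def by (intro continuous_intros continuous_on_ip)
    from IVT'[of _ 0 0 1, OF _ _ _ this] f g obtain t where t: "0 \<le> t" "t \<le> 1" "Re (ip (h t) (h t)) = 0"
      by (auto simp: h_def)
    have hN: "h t \<in> N"
      using f g N by (simp add: h_def scaleR_eq_scaleC complex_vec.subspace_add complex_vec.subspace_scale)
    have "ip (h t) (h t) = 0" using t(3) by (subst ip_self) simp
    with hN have h0: "(1 - t) *\<^sub>R f = - t *\<^sub>R g"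
      using free[of "h t"] by (simp add: h_def eq_neg_iff_add_eq_0)
    have "(1 - t)\<^sup>2 * Re (ip f f) = (- t)\<^sup>2 * Re (ip g g)"
      using arg_cong[OF h0, of "\<lambda>x. Re (ip x x)"] unfolding Re_ip_scaleR_self by simp
    then have "(1 - t)\<^sup>2 * Re (ip f f) = t\<^sup>2 * Re (ip g g)" by simp
    moreover have "(1 - t)\<^sup>2 * Re (ip f f) \<le> 0" using f(2) by (simp add: mult_nonneg_nonpos)
    moreover have "0 \<le> t\<^sup>2 * Re (ip g g)" using g(2) by simp
    ultimately have "(1 - t)\<^sup>2 * Re (ip f f) = 0" "t\<^sup>2 * Re (ip g g) = 0" by linarith+
    then show False using f(2) g(2) by simp
  qed
  then show thesis
  proof
    assume "\<forall>f\<in>N. 0 \<le> Re (ip f f)"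
    then show thesis by (intro that[of 1]) (auto simp: cmod_ip_self)
  next
    assume "\<forall>f\<in>N. Re (ip f f) \<le> 0"
    then show thesis by (intro that[of "-1"]) (auto simp: cmod_ip_self)
  qed
qed

text \<open>If no \<open>c\<close> works, unit vectors \<open>f\<^sub>n \<in> N\<close> exist with \<open>[f\<^sub>n, f\<^sub>n] \<rightarrow> 0\<close>, and after passing to a
  subsequence their components in the finite-dimensional eigenspace converge. Since the form is
  semidefinite on \<open>N\<close>, the parallelogram identity shows \<open>[f\<^sub>m - f\<^sub>n, f\<^sub>m - f\<^sub>n] \<rightarrow> 0\<close>, so that the sequence
  is Cauchy. Its limit is a neutral unit vector of \<open>N\<close>.\<close>

lemma uniformly_definite_if_finite_negative_part:
  assumes B: "finite B" "{f. J f = - f} \<subseteq> cspan B"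
    and N: "csubspace N" "closed N" and free: "\<And>f. f \<in> N \<Longrightarrow> ip f f = 0 \<Longrightarrow> f = 0"
  obtains c where "c > 0" "\<And>f. f \<in> N \<Longrightarrow> c * (norm f)\<^sup>2 \<le> cmod (ip f f)"
proof (rule ccontr)
  assume no: "\<not> thesis"
  obtain s :: real where s: "\<bar>s\<bar> = 1" "\<And>f. f \<in> N \<Longrightarrow> cmod (ip f f) = s * Re (ip f f)"
    using neutral_free_imp_semidefinite[OF N(1) free] by blast
  have bad: "\<exists>f\<in>N. cmod (ip f f) < c * (norm f)\<^sup>2" if "c > 0" for c
    using no \<open>\<And>c. c > 0 \<Longrightarrow> (\<And>f. f \<in> N \<Longrightarrow> c * (norm f)\<^sup>2 \<le> cmod (ip f f)) \<Longrightarrow> thesis\<close> that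
    by (meson not_le)
  have "\<exists>f\<in>N. norm f = 1 \<and> cmod (ip f f) \<le> 1 / real (Suc n)" for n
  proof -
    obtain f where f: "f \<in> N" "cmod (ip f f) < 1 / real (Suc n) * (norm f)\<^sup>2"
      using bad[of "1 / real (Suc n)"] by auto
    then have nf: "norm f > 0" by (metis ip_zero(1) mult_zero_right norm_zero order_less_irrefl power_zero_numeral zero_less_norm_iff)
    define g where "g = complex_of_real (1 / norm f) *\<^sub>C f"
    have "cmod (ip g g) = cmod (ip f f) / (norm f)\<^sup>2"
      by (simp add: g_def ip_scaleC_left ip_scaleC_right norm_mult norm_divide power2_eq_square)
    also have "\<dots> \<le> 1 / real (Suc n)"
      using f(2) nf by (simp add: field_simps)
    finally have "cmod (ip g g) \<le> 1 / real (Suc n)" .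
    moreover have "norm g = 1" using nf by (simp add: g_def norm_divide)
    moreover have "g \<in> N" using N(1) f(1) by (simp add: g_def complex_vec.subspace_scale)
    ultimately show ?thesis by blast
  qed
  then obtain f where f: "\<And>n. f n \<in> N" "\<And>n. norm (f n) = 1"
      "\<And>n. cmod (ip (f n) (f n)) \<le> 1 / real (Suc n)" by metis
  define P where "P f = (1/2::real) *\<^sub>R (f - J f)" for f
  obtain K where K: "compact K" "\<And>f. norm f \<le> 1 \<Longrightarrow> P f \<in> K"
    using neg_part_in_compact[OF B] unfolding P_def by blast
  have "\<forall>n. P (f n) \<in> K" using K(2) f(2) by simp
  then obtain l r where "strict_mono r" "((\<lambda>n. P (f n)) \<circ> r) \<longlonglongrightarrow> l"
    using K(1)[unfolded compact_def, rule_format, of "\<lambda>n. P (f n)"] by blast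
  then have r: "strict_mono r" "(\<lambda>n. P (f (r n))) \<longlonglongrightarrow> l" by (simp_all add: o_def)
  define y where "y n = f (r n)" for n
  have y: "y n \<in> N" "norm (y n) = 1" for n using f by (simp_all add: y_def)
  have y0: "(\<lambda>n. ip (y n) (y n)) \<longlonglongrightarrow> 0"
  proof (rule Lim_null_comparison)
    show "\<forall>\<^sub>F n in sequentially. norm (ip (y n) (y n)) \<le> 1 / real (Suc (r n))"
      using f(3) by (simp add: y_def)
    show "(\<lambda>n. 1 / real (Suc (r n))) \<longlonglongrightarrow> 0"
      using LIMSEQ_subseq_LIMSEQ[OF LIMSEQ_inverse_real_of_nat r(1)]
      by (simp add: o_def inverse_eq_divide)
  qed
  have "Cauchy y"
  proof (rule Cauchy_if_norm_square_le)
    have "(\<lambda>n. 2 * cmod (ip (y n) (y n)) + 4 * (norm (P (y n) - l))\<^sup>2) \<longlonglongrightarrow>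
        2 * cmod 0 + 4 * (norm (l - l))\<^sup>2"
      using r(2) unfolding y_def[symmetric] by (intro tendsto_intros y0)
    then show "(\<lambda>n. 2 * cmod (ip (y n) (y n)) + 4 * (norm (P (y n) - l))\<^sup>2) \<longlonglongrightarrow> 0" by simp
  next
    fix m n
    let ?d = "y m - y n"
    have sub: "?d \<in> N" "y m + y n \<in> N"
      using y N(1) by (simp_all add: complex_vec.subspace_diff complex_vec.subspace_add)
    have "ip ?d ?d + ip (y m + y n) (y m + y n) = 2 * ip (y m) (y m) + 2 * ip (y n) (y n)"
      by (simp add: ip_diff_left ip_diff_right ip_add_left ip_add_right)
    from arg_cong[OF this, of "\<lambda>z. s * Re z"]
    have "s * Re (ip ?d ?d) + s * Re (ip (y m + y n) (y m + y n))
        = 2 * (s * Re (ip (y m) (y m))) + 2 * (s * Re (ip (y n) (y n)))"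
      by (simp add: distrib_left)
    then have "cmod (ip ?d ?d) + cmod (ip (y m + y n) (y m + y n))
        = 2 * cmod (ip (y m) (y m)) + 2 * cmod (ip (y n) (y n))"
      using sub y by (simp add: s(2))
    then have 1: "Re (ip ?d ?d) \<le> 2 * cmod (ip (y m) (y m)) + 2 * cmod (ip (y n) (y n))"
      using abs_Re_le_cmod[of "ip ?d ?d"] norm_ge_zero[of "ip (y m + y n) (y m + y n)"] by linarith
    have Pd: "P ?d = (P (y m) - l) - (P (y n) - l)"
      by (simp add: P_def J_diff flip: scaleR_diff_right)
    have 2: "(norm (P ?d))\<^sup>2 \<le> 2 * (norm (P (y m) - l))\<^sup>2 + 2 * (norm (P (y n) - l))\<^sup>2"
      unfolding Pd using norm_parallelogram[of "P (y m) - l" "P (y n) - l"]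
        zero_le_power2[of "norm ((P (y m) - l) + (P (y n) - l))"] by linarith
    show "(norm ?d)\<^sup>2 \<le> 2 * cmod (ip (y m) (y m)) + 4 * (norm (P (y m) - l))\<^sup>2
        + (2 * cmod (ip (y n) (y n)) + 4 * (norm (P (y n) - l))\<^sup>2)"
      using ip_self_neg_part[of ?d, folded P_def] 1 2 by linarith
  qed
  then obtain p where p: "y \<longlonglongrightarrow> p" using Cauchy_convergent convergent_def by blast
  have "p \<in> N" using closed_sequentially[OF N(2) _ p] y(1) by blast
  moreover have "ip p p = 0" using LIMSEQ_unique[OF tendsto_ip[OF p p] y0] .
  ultimately have "p = 0" by (rule free)
  moreover have "norm p = 1" using LIMSEQ_unique[OF tendsto_norm[OF p]] y(2) by simp
  ultimately show False by simp
qed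

end

lemma pontryagin_cases:
  assumes "pontryagin_space ip J"
  obtains B where "finite B" "{f. J f = - f} \<subseteq> cspan B"
    | B where "finite B" "{f. - J f = - f} \<subseteq> cspan B"
proof -
  have "ecdim {f. J f = f} < \<infinity> \<or> ecdim {f. J f = - f} < \<infinity>"
    using assms unfolding pontryagin_space_def rank_of_indefiniteness_def by (auto simp: min_less_iff_disj)
  then show thesis
    using that unfolding ecdim_def by (auto split: if_splits)
qed

lemma neutral_free_imp_uniformly_definite:
  assumes "pontryagin_space ip J"
    and N: "csubspace N" "closed N" and free: "\<And>f. f \<in> N \<Longrightarrow> ip f f = 0 \<Longrightarrow> f = 0"
  obtains c where "c > 0" "\<And>f. f \<in> N \<Longrightarrow> c * (norm f)\<^sup>2 \<le> cmod (ip f f)"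
  using assms(1)
proof (cases rule: pontryagin_cases)
  interpret krein ip J using assms(1) by unfold_locales (simp add: pontryagin_space_def)
  interpret neg: krein "\<lambda>f g. - ip f g" "\<lambda>f. - J f" by (rule krein_uminus)
  {
    case 1
    show thesis using uniformly_definite_if_finite_negative_part[OF 1 N free] that by blast
  next
    case 2
    obtain c where "c > 0" "\<And>f. f \<in> N \<Longrightarrow> c * (norm f)\<^sup>2 \<le> cmod (- ip f f)"
      using neg.uniformly_definite_if_finite_negative_part[OF 2 N] free by (metis neg_equal_0_iff_equal)
    then show thesis using that by simp
  }
qed

section \<open>Isometric relations with dense domain and range\<close>

lemma semidefinite_Cauchy_Schwarz:
  fixes b :: "'a::complex_hilbert_space \<Rightarrow> 'a \<Rightarrow> complex"
  assumes herm: "\<And>f g. b f g = cnj (b g f)"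
    and add: "\<And>f g h. b f (g + h) = b f g + b f h"
    and scale: "\<And>f g c. b f (c *\<^sub>C g) = c * b f g"
    and pos: "\<And>f. 0 \<le> Re (b f f)"
  shows "(cmod (b f g))\<^sup>2 \<le> Re (b f f) * Re (b g g)"
proof -
  have add': "b (f + g) h = b f h + b g h" for f g h
    by (metis herm add complex_cnj_add)
  have scale': "b (c *\<^sub>C f) g = cnj c * b f g" for c f g
    by (metis herm scale complex_cnj_mult)
  define m where "m = (cmod (b f g))\<^sup>2"
  have quad: "0 \<le> Re (b g g) - 2 * t * m + t\<^sup>2 * m * Re (b f f)" for t :: real
  proof -
    define a where "a = - complex_of_real t * b f g"
    have gf: "b g f = cnj (b f g)" by (rule herm)
    have m: "complex_of_real m = b f g * cnj (b f g)"
      unfolding m_def by (rule complex_norm_square)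
    have "b (g + a *\<^sub>C f) (g + a *\<^sub>C f)
        = b g g + a * b g f + cnj a * b f g + cnj a * a * b f f"
      by (simp add: add add' scale scale' algebra_simps)
    also have "\<dots> = b g g - 2 * complex_of_real t * complex_of_real m
          + (complex_of_real t)\<^sup>2 * complex_of_real m * b f f"
      unfolding m a_def gf by (simp add: algebra_simps power2_eq_square)
    finally have "Re (b (g + a *\<^sub>C f) (g + a *\<^sub>C f))
        = Re (b g g) - 2 * t * m + t\<^sup>2 * m * Re (b f f)"
      by (simp flip: of_real_power of_real_mult)
    then show ?thesis using pos[of "g + a *\<^sub>C f"] by simp
  qed
  show ?thesis
  proof (cases "Re (b f f) = 0")
    case True
    have "m = 0"
    proof (rule ccontr)
      assume "m \<noteq> 0"
      then have "0 \<le> Re (b g g) - 2 * ((Re (b g g) + 1) / (2 * m)) * m"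
        using quad[of "(Re (b g g) + 1) / (2 * m)"] True by simp
      then show False using \<open>m \<noteq> 0\<close> by simp
    qed
    then show ?thesis using True by (simp add: m_def)
  next
    case False
    then have p: "Re (b f f) > 0" using pos[of f] by simp
    then have "0 \<le> Re (b g g) - m / Re (b f f)"
      using quad[of "1 / Re (b f f)"] by (simp add: power2_eq_square)
    then show ?thesis using p by (simp add: m_def field_simps)
  qed
qed

context krein
begin

text \<open>Adding \<open>2 * \<Sum>i. \<bar>[e i, f]\<bar>\<^sup>2\<close> to the form amounts to reversing the sign on the span of the negative
  orthonormal system \<open>e\<close>; it is written in terms of the indefinite product only, so that an isometric
  map preserves it. If the result \<open>b\<close> is nonnegative, it is equivalent to the norm: with the reflection
  \<open>f = J g + 2 * \<Sum>i. [e i, J g] e i\<close> of \<open>J g\<close> one has \<open>b f g = (norm g)\<^sup>2\<close>, so that the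
  Cauchy-Schwarz inequality for \<open>b\<close> bounds \<open>norm g\<close> by a multiple of \<open>b g g\<close>.\<close>

lemma regularized_form_equivalent_to_norm:
  fixes e :: "'i \<Rightarrow> 'h"
  assumes I: "finite I" and e: "\<And>i j. i \<in> I \<Longrightarrow> j \<in> I \<Longrightarrow> ip (e i) (e j) = (if i = j then -1 else 0)"
    and pos: "\<And>f. 0 \<le> Re (ip f f) + 2 * (\<Sum>i\<in>I. (cmod (ip (e i) f))\<^sup>2)"
  obtains c C where "c > 0" "C > 0"
    "\<And>f. c * (norm f)\<^sup>2 \<le> Re (ip f f) + 2 * (\<Sum>i\<in>I. (cmod (ip (e i) f))\<^sup>2)"
    "\<And>f. Re (ip f f) + 2 * (\<Sum>i\<in>I. (cmod (ip (e i) f))\<^sup>2) \<le> C * (norm f)\<^sup>2"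
proof -
  define b where "b f g = ip f g + 2 * (\<Sum>i\<in>I. ip f (e i) * ip (e i) g)" for f g
  define S where "S = (\<Sum>i\<in>I. (norm (e i))\<^sup>2)"
  have S0: "S \<ge> 0" by (simp add: S_def sum_nonneg)
  have herm: "b f g = cnj (b g f)" for f g
    unfolding b_def by (simp add: ip_commute[symmetric] mult.commute)
  have b_self: "Re (b f f) = Re (ip f f) + 2 * (\<Sum>i\<in>I. (cmod (ip (e i) f))\<^sup>2)" for f
  proof -
    have "(\<Sum>i\<in>I. ip f (e i) * ip (e i) f) = complex_of_real (\<Sum>i\<in>I. (cmod (ip (e i) f))\<^sup>2)"
      unfolding of_real_sum complex_norm_square
      by (intro sum.cong refl) (metis ip_commute mult.commute)
    then show ?thesis by (simp add: b_def)
  qed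
  have upper: "Re (b f f) \<le> (1 + 2 * S) * (norm f)\<^sup>2" for f
  proof -
    have "(\<Sum>i\<in>I. (cmod (ip (e i) f))\<^sup>2) \<le> (\<Sum>i\<in>I. (norm (e i) * norm f)\<^sup>2)"
      by (intro sum_mono power_mono cmod_ip_le) simp
    also have "\<dots> = S * (norm f)\<^sup>2" by (simp add: S_def power_mult_distrib sum_distrib_right)
    finally have "(\<Sum>i\<in>I. (cmod (ip (e i) f))\<^sup>2) \<le> S * (norm f)\<^sup>2" .
    moreover have "Re (ip f f) \<le> (norm f)\<^sup>2"
      using cmod_ip_le[of f f] by (simp add: cmod_ip_self power2_eq_square)
    ultimately show ?thesis unfolding b_self by (simp add: algebra_simps)
  qed
  have pos_b: "0 \<le> Re (b f f)" for f unfolding b_self by (rule pos)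
  have cs: "(cmod (b f g))\<^sup>2 \<le> Re (b f f) * Re (b g g)" for f g
  proof (rule semidefinite_Cauchy_Schwarz[OF herm _ _ pos_b])
    show "b f (g + h) = b f g + b f h" for f g h
      by (simp add: b_def ip_add_right distrib_left sum.distrib)
    show "b f (c *\<^sub>C g) = c * b f g" for f g c
      by (simp add: b_def ip_scaleC_right distrib_left sum_distrib_left mult_ac)
  qed
  define L where "L = (1 + 2 * S) * (1 + 2 * S)\<^sup>2"
  have L: "L > 0" using S0 by (simp add: L_def)
  have lower: "(norm g)\<^sup>2 \<le> L * Re (b g g)" for g
  proof -
    define f where "f = J g + 2 *\<^sub>C (\<Sum>i\<in>I. ip (e i) (J g) *\<^sub>C e i)"
    have fe: "ip f (e j) = - ip (J g) (e j)" if "j \<in> I" for j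
    proof -
      have "(\<Sum>i\<in>I. cnj (ip (e i) (J g)) * ip (e i) (e j)) = (\<Sum>i\<in>I. if i = j then - cnj (ip (e i) (J g)) else 0)"
        using that by (intro sum.cong) (auto simp: e)
      then show ?thesis using that I
        by (simp add: f_def ip_add_left ip_scaleC_left ip_sum_left ip_commute[symmetric])
    qed
    have "ip f g = ip (J g) g + 2 * (\<Sum>i\<in>I. ip (J g) (e i) * ip (e i) g)"
      by (simp add: f_def ip_add_left ip_scaleC_left ip_sum_left ip_commute[symmetric])
    moreover have "(\<Sum>i\<in>I. ip f (e i) * ip (e i) g) = - (\<Sum>i\<in>I. ip (J g) (e i) * ip (e i) g)"
      by (simp add: fe sum_negf)
    ultimately have "b f g = ip (J g) g" by (simp add: b_def)
    also have "\<dots> = complex_of_real ((norm g)\<^sup>2)"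
      by (metis cinner_eq_ip cinner_self complex_cnj_complex_of_real ip_commute)
    finally have bfg: "(cmod (b f g))\<^sup>2 = (norm g)\<^sup>2 * (norm g)\<^sup>2"
      by (simp add: power2_eq_square norm_mult)
    have "norm f \<le> (1 + 2 * S) * norm g"
    proof -
      have "norm (\<Sum>i\<in>I. ip (e i) (J g) *\<^sub>C e i) \<le> (\<Sum>i\<in>I. norm (ip (e i) (J g) *\<^sub>C e i))"
        by (rule norm_sum)
      also have "\<dots> \<le> (\<Sum>i\<in>I. (norm (e i) * norm g) * norm (e i))"
      proof (rule sum_mono)
        fix i
        show "norm (ip (e i) (J g) *\<^sub>C e i) \<le> (norm (e i) * norm g) * norm (e i)"
          using mult_right_mono[OF cmod_ip_le[of "e i" "J g"], of "norm (e i)"] by simp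
      qed
      also have "\<dots> = S * norm g"
        unfolding S_def sum_distrib_right by (intro sum.cong) (simp_all add: power2_eq_square)
      finally show ?thesis
        unfolding f_def
        using norm_triangle_ineq[of "J g" "2 *\<^sub>C (\<Sum>i\<in>I. ip (e i) (J g) *\<^sub>C e i)"]
        by (simp add: algebra_simps)
    qed
    then have "(norm f)\<^sup>2 \<le> ((1 + 2 * S) * norm g)\<^sup>2" by (intro power_mono) auto
    then have "(1 + 2 * S) * (norm f)\<^sup>2 \<le> L * (norm g)\<^sup>2"
      using S0 by (simp add: L_def power_mult_distrib mult.assoc mult_left_mono)
    then have "Re (b f f) \<le> L * (norm g)\<^sup>2" using upper[of f] by linarith
    then have "Re (b f f) * Re (b g g) \<le> (L * (norm g)\<^sup>2) * Re (b g g)"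
      using pos_b by (rule mult_right_mono)
    then have *: "(norm g)\<^sup>2 * (norm g)\<^sup>2 \<le> (norm g)\<^sup>2 * (L * Re (b g g))"
      using cs[of f g] unfolding bfg by (simp add: mult_ac)
    show ?thesis
    proof (cases "g = 0")
      case False
      then show ?thesis using * by (intro mult_left_le_imp_le[OF *]) simp
    next
      case True
      then show ?thesis by (simp add: b_def)
    qed
  qed
  show thesis
  proof (rule that[of "1 / L" "1 + 2 * S"])
    show "1 / L * (norm f)\<^sup>2 \<le> Re (ip f f) + 2 * (\<Sum>i\<in>I. (cmod (ip (e i) f))\<^sup>2)" for f
      using lower[of f] L unfolding b_self[symmetric] by (simp add: field_simps)
  qed (use L S0 upper in \<open>auto simp: b_self\<close>)
qed

end

lemma bounded_relation_extends_to_closure_of_Domain: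
  fixes V :: "('a::complex_hilbert_space \<times> 'b::complex_hilbert_space) set"
  assumes V: "csubspace V" and bound: "\<And>f f'. (f, f') \<in> V \<Longrightarrow> norm f' \<le> a * norm f" and a: "a > 0"
    and x: "x \<in> closure (Domain V)"
  obtains u v y where "\<And>n. (u n, v n) \<in> V" "u \<longlonglongrightarrow> x" "v \<longlonglongrightarrow> y"
proof -
  obtain u where u: "\<And>n. u n \<in> Domain V" "u \<longlonglongrightarrow> x"
    using x unfolding closure_sequential by blast
  then have "\<forall>n. \<exists>y. (u n, y) \<in> V" by blast
  then obtain v where uv: "\<And>n. (u n, v n) \<in> V" by metis
  have "Cauchy u" using u(2) by (rule LIMSEQ_imp_Cauchy)
  have "Cauchy v"
  proof (rule CauchyI)
    fix d :: real assume "d > 0"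
    then have "d / a > 0" using a by simp
    then obtain M where M: "\<And>m n. m \<ge> M \<Longrightarrow> n \<ge> M \<Longrightarrow> norm (u m - u n) < d / a"
      using CauchyD[OF \<open>Cauchy u\<close>] by blast
    show "\<exists>M. \<forall>m\<ge>M. \<forall>n\<ge>M. norm (v m - v n) < d"
    proof (intro exI allI impI)
      fix m n assume "m \<ge> M" "n \<ge> M"
      from M[OF this] have "a * norm (u m - u n) < d" using a by (simp add: field_simps)
      moreover have "(u m - u n, v m - v n) \<in> V"
        using complex_vec.subspace_diff[OF V uv[of m] uv[of n]] by simp
      ultimately show "norm (v m - v n) < d" using bound by fastforce
    qed
  qed
  then obtain y where "v \<longlonglongrightarrow> y" using Cauchy_convergent convergent_def by blast
  then show thesis using that uv u(2) by blast
qed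

text \<open>The closure of \<open>V\<close> inherits the two norm estimates and the isometry by continuity. The estimates make
  it the graph of an injective operator, defined everywhere and surjective.\<close>

lemma bicontinuous_isometric_relation_extends:
  assumes "krein_space ip J" "krein_space ip' J'"
    and V: "csubspace V" and dom: "closure (Domain V) = UNIV" and ran: "closure (Range V) = UNIV"
    and iso: "\<And>f f' g g'. (f, f') \<in> V \<Longrightarrow> (g, g') \<in> V \<Longrightarrow> ip' f' g' = ip f g"
    and a: "a > 0" and fwd: "\<And>f f'. (f, f') \<in> V \<Longrightarrow> norm f' \<le> a * norm f"
    and bwd: "\<And>f f'. (f, f') \<in> V \<Longrightarrow> norm f \<le> a * norm f'"
  obtains U where "standard_unitary ip ip' U" "\<And>f f'. (f, f') \<in> V \<Longrightarrow> U f = f'"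
proof -
  interpret A: krein ip J by unfold_locales (rule assms(1))
  interpret B: krein ip' J' by unfold_locales (rule assms(2))
  define G where "G = closure V"
  have G: "csubspace G" unfolding G_def by (rule csubspace_closure[OF V])
  have GI: "(x, y) \<in> G" if "\<And>n. (u n, v n) \<in> V" "u \<longlonglongrightarrow> x" "v \<longlonglongrightarrow> y" for u v x y
    unfolding G_def closure_sequential using that
    by (intro exI[of _ "\<lambda>n. (u n, v n)"]) (auto intro: tendsto_Pair)
  have GE: "\<exists>u v. (\<forall>n. (u n, v n) \<in> V) \<and> u \<longlonglongrightarrow> x \<and> v \<longlonglongrightarrow> y" if xy: "(x, y) \<in> G" for x y
  proof -
    obtain p where "\<forall>n. p n \<in> V" "p \<longlonglongrightarrow> (x, y)"
      using xy unfolding G_def closure_sequential by blast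
    then show ?thesis
      using tendsto_fst[of p "(x, y)"] tendsto_snd[of p "(x, y)"]
      by (intro exI[of _ "\<lambda>n. fst (p n)"] exI[of _ "\<lambda>n. snd (p n)"]) auto
  qed
  have total: "\<exists>y. (x, y) \<in> G" for x
  proof -
    have x: "x \<in> closure (Domain V)" using dom by simp
    obtain u v y where "\<And>n. (u n, v n) \<in> V" "u \<longlonglongrightarrow> x" "v \<longlonglongrightarrow> y"
    proof (rule bounded_relation_extends_to_closure_of_Domain[OF V _ a x])
      show "norm f' \<le> a * norm f" if "(f, f') \<in> V" for f f' using that by (rule fwd)
    qed blast
    then show ?thesis using GI[of u v x y] by auto
  qed
  have onto: "\<exists>x. (x, y) \<in> G" for y
  proof -
    have y: "y \<in> closure (Domain (V\<inverse>))" using ran by simp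
    obtain v u x where "\<And>n. (v n, u n) \<in> V\<inverse>" "v \<longlonglongrightarrow> y" "u \<longlonglongrightarrow> x"
    proof (rule bounded_relation_extends_to_closure_of_Domain[OF csubspace_converse[OF V] _ a y])
      show "norm f' \<le> a * norm f" if "(f, f') \<in> V\<inverse>" for f f' using bwd that by blast
    qed blast
    then show ?thesis using GI[of u v x y] by auto
  qed
  have G_fwd: "norm y \<le> a * norm x" and G_bwd: "norm x \<le> a * norm y" if xy: "(x, y) \<in> G" for x y
  proof -
    obtain u v where uv: "\<And>n. (u n, v n) \<in> V" "u \<longlonglongrightarrow> x" "v \<longlonglongrightarrow> y" using GE[OF xy] by blast
    show "norm y \<le> a * norm x"
      by (rule LIMSEQ_le[of "\<lambda>n. norm (v n)" _ "\<lambda>n. a * norm (u n)"])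
        (use uv fwd in \<open>auto intro!: tendsto_intros\<close>)
    show "norm x \<le> a * norm y"
      by (rule LIMSEQ_le[of "\<lambda>n. norm (u n)" _ "\<lambda>n. a * norm (v n)"])
        (use uv bwd in \<open>auto intro!: tendsto_intros\<close>)
  qed
  have G_iso: "ip' y y' = ip x x'" if xy: "(x, y) \<in> G" and xy': "(x', y') \<in> G" for x y x' y'
  proof -
    obtain u v where uv: "\<And>n. (u n, v n) \<in> V" "u \<longlonglongrightarrow> x" "v \<longlonglongrightarrow> y" using GE[OF xy] by blast
    obtain u' v' where uv': "\<And>n. (u' n, v' n) \<in> V" "u' \<longlonglongrightarrow> x'" "v' \<longlonglongrightarrow> y'" using GE[OF xy'] by blast
    have "(\<lambda>n. ip' (v n) (v' n)) \<longlonglongrightarrow> ip' y y'" using uv uv' by (intro B.tendsto_ip)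
    moreover have "(\<lambda>n. ip' (v n) (v' n)) = (\<lambda>n. ip (u n) (u' n))" using uv(1) uv'(1) iso by blast
    moreover have "(\<lambda>n. ip (u n) (u' n)) \<longlonglongrightarrow> ip x x'" using uv uv' by (intro A.tendsto_ip)
    ultimately show ?thesis using LIMSEQ_unique by metis
  qed
  define U where "U x = (SOME y. (x, y) \<in> G)" for x
  have UG: "(x, U x) \<in> G" for x unfolding U_def using total by (rule someI_ex)
  have unique: "y = U x" if "(x, y) \<in> G" for x y
    using G_fwd[of 0 "y - U x"] complex_vec.subspace_diff[OF G that UG[of x]] by simp
  have add: "U (x + y) = U x + U y" for x y
    using unique complex_vec.subspace_add[OF G UG[of x] UG[of y]] by (metis add_Pair)
  have scale: "U (c *\<^sub>C x) = c *\<^sub>C U x" for c x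
    using unique complex_vec.subspace_scale[OF G UG[of x]] by (metis scaleC_Pair)
  show thesis
  proof (rule that)
    have "clinear_map U"
      unfolding Vector_Spaces.linear_iff
      using add scale by (auto simp: complex_vec.vector_space_axioms)
    moreover have "bounded_linear U"
      by (rule bounded_linear_intro[where K = a])
        (use G_fwd UG in \<open>auto simp: add scale scaleR_eq_scaleC mult.commute\<close>)
    moreover have "bij U"
    proof (rule bijI)
      show "inj U"
      proof (rule injI)
        fix x y assume "U x = U y"
        then have "(x - y, 0) \<in> G" using complex_vec.subspace_diff[OF G UG[of x] UG[of y]] by simp
        then show "x = y" using G_bwd[of "x - y" 0] by simp
      qed
      show "surj U" using onto unique unfolding surj_def by metis
    qed
    ultimately show "standard_unitary ip ip' U"
      unfolding standard_unitary_def using G_iso UG by blast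
    show "U f = f'" if "(f, f') \<in> V" for f f'
      using unique[of f f'] that closure_subset unfolding G_def by blast
  qed
qed

text \<open>Bicontinuity is automatic: choose a maximal negative orthonormal system in the domain of \<open>V\<close> and
  images \<open>\<phi> e\<close> of its members. The regularized forms \<open>q\<close> and \<open>q'\<close> of the two systems correspond under
  \<open>V\<close>. By maximality \<open>q\<close> is nonnegative on the domain, hence by density everywhere; transported by \<open>V\<close>,
  so is \<open>q'\<close>. Both forms are then equivalent to the respective norms.\<close>

lemma isometric_relation_extends_if_finite_negative_part:
  fixes ip :: "'h::complex_hilbert_space \<Rightarrow> 'h \<Rightarrow> complex"
    and ip' :: "'k::complex_hilbert_space \<Rightarrow> 'k \<Rightarrow> complex"
  assumes "krein_space ip J" "krein_space ip' J'" and B: "finite B" "{f. J f = - f} \<subseteq> cspan B"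
    and V: "csubspace V" and dom: "closure (Domain V) = UNIV" and ran: "closure (Range V) = UNIV"
    and iso: "\<And>f f' g g'. (f, f') \<in> V \<Longrightarrow> (g, g') \<in> V \<Longrightarrow> ip' f' g' = ip f g"
  obtains U where "standard_unitary ip ip' U" "\<And>f f'. (f, f') \<in> V \<Longrightarrow> U f = f'"
proof -
  interpret A: krein ip J by unfold_locales (rule assms(1))
  interpret B: krein ip' J' by unfold_locales (rule assms(2))
  have D: "csubspace (Domain V)" using V by (rule csubspace_Domain)
  obtain E where E: "finite E" "E \<subseteq> Domain V" "A.neg_orthonormal E"
    and max: "\<And>f. f \<in> Domain V \<Longrightarrow> (\<And>e. e \<in> E \<Longrightarrow> ip e f = 0) \<Longrightarrow> 0 \<le> Re (ip f f)"
    using A.maximal_neg_orthonormal[OF D B] by blast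
  have "\<exists>\<phi>. \<forall>e\<in>E. (e, \<phi> e) \<in> V" using E(2) by (intro bchoice) blast
  then obtain \<phi> where \<phi>: "\<And>e. e \<in> E \<Longrightarrow> (e, \<phi> e) \<in> V" by blast
  define q where "q f = Re (ip f f) + 2 * (\<Sum>e\<in>E. (cmod (ip e f))\<^sup>2)" for f
  define q' where "q' f = Re (ip' f f) + 2 * (\<Sum>e\<in>E. (cmod (ip' (\<phi> e) f))\<^sup>2)" for f
  have qq': "q' f' = q f" if "(f, f') \<in> V" for f f'
  proof -
    have "ip' (\<phi> e) f' = ip e f" if "e \<in> E" for e
      using \<phi>[OF that] \<open>(f, f') \<in> V\<close> by (rule iso)
    then show ?thesis using iso[OF that that] by (simp add: q_def q'_def)
  qed
  have pos_D: "0 \<le> q f" if f: "f \<in> Domain V" for f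
  proof -
    define s where "s = (\<Sum>e\<in>E. ip e f *\<^sub>C e)"
    have s: "s \<in> Domain V" unfolding s_def
      using E(2) by (intro complex_vec.subspace_sum[OF D] complex_vec.subspace_scale[OF D]) auto
    have orth: "ip e (f + s) = 0" if "e \<in> E" for e
      unfolding s_def using A.ip_neg_orthonormal_sum[OF E(1,3) that, of "\<lambda>e. ip e f"]
      by (simp add: A.ip_add_right)
    have "0 \<le> Re (ip (f + s) (f + s))"
      using orth s f by (intro max complex_vec.subspace_add[OF D])
    also have "ip (f + s) (f + s) = ip f (f + s) + ip s (f + s)" by (rule A.ip_add_left)
    also have "ip s (f + s) = 0" using orth by (simp add: s_def A.ip_sum_left A.ip_scaleC_left)
    also have "ip f (f + s) = ip f f + complex_of_real (\<Sum>e\<in>E. (cmod (ip e f))\<^sup>2)"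
    proof -
      have "ip f s = (\<Sum>e\<in>E. ip e f * cnj (ip e f))"
        unfolding s_def A.ip_sum_right A.ip_scaleC_right by (metis A.ip_commute)
      then show ?thesis by (simp add: A.ip_add_right complex_norm_square del: of_real_power)
    qed
    finally have "0 \<le> Re (ip f f) + (\<Sum>e\<in>E. (cmod (ip e f))\<^sup>2)" by simp
    moreover have "0 \<le> (\<Sum>e\<in>E. (cmod (ip e f))\<^sup>2)" by (simp add: sum_nonneg)
    ultimately show ?thesis unfolding q_def by linarith
  qed
  have "closed {f. 0 \<le> q f}"
    unfolding q_def by (intro closed_Collect_le continuous_intros A.continuous_on_ip)
  then have "closure (Domain V) \<subseteq> {f. 0 \<le> q f}" using pos_D by (intro closure_minimal) auto
  then have pos: "0 \<le> q f" for f using dom by auto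
  have "closed {f. 0 \<le> q' f}"
    unfolding q'_def by (intro closed_Collect_le continuous_intros B.continuous_on_ip)
  moreover have "Range V \<subseteq> {f. 0 \<le> q' f}" using qq' pos by auto
  ultimately have "closure (Range V) \<subseteq> {f. 0 \<le> q' f}" by (intro closure_minimal) auto
  then have pos': "0 \<le> q' f" for f using ran by auto
  obtain c C where c: "c > 0" "C > 0" "\<And>f. c * (norm f)\<^sup>2 \<le> q f" "\<And>f. q f \<le> C * (norm f)\<^sup>2"
  proof (rule A.regularized_form_equivalent_to_norm[OF E(1), of "\<lambda>e. e"])
    show "ip e e' = (if e = e' then -1 else 0)" if "e \<in> E" "e' \<in> E" for e e'
      using E(3) that by (simp add: A.neg_orthonormal_def)
  qed (use pos in \<open>auto simp: q_def\<close>)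
  obtain c' C' where c': "c' > 0" "C' > 0" "\<And>f. c' * (norm f)\<^sup>2 \<le> q' f" "\<And>f. q' f \<le> C' * (norm f)\<^sup>2"
  proof (rule B.regularized_form_equivalent_to_norm[OF E(1), of \<phi>])
    show "ip' (\<phi> e) (\<phi> e') = (if e = e' then -1 else 0)" if "e \<in> E" "e' \<in> E" for e e'
      using iso[OF \<phi>[OF that(1)] \<phi>[OF that(2)]] E(3) that by (simp add: A.neg_orthonormal_def)
  qed (use pos' in \<open>auto simp: q'_def\<close>)
  define K where "K = C' / c + C / c'"
  have K: "K > 0" using c c' by (simp add: K_def add_pos_pos)
  have le: "x \<le> sqrt K * y" if "x\<^sup>2 \<le> K * y\<^sup>2" "y \<ge> 0" for x y :: real
  proof (rule power2_le_imp_le)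
    show "x\<^sup>2 \<le> (sqrt K * y)\<^sup>2" using that K by (simp add: power_mult_distrib)
    show "0 \<le> sqrt K * y" using that K by simp
  qed
  show thesis
  proof (rule bicontinuous_isometric_relation_extends[OF assms(1,2) V dom ran iso])
    show "sqrt K > 0" using K by simp
    fix f f' assume ff': "(f, f') \<in> V"
    have "c' * (norm f')\<^sup>2 \<le> C * (norm f)\<^sup>2" using c(4)[of f] c'(3)[of f'] qq'[OF ff'] by linarith
    then have "(norm f')\<^sup>2 \<le> C / c' * (norm f)\<^sup>2" using c' by (simp add: field_simps)
    also have "\<dots> \<le> K * (norm f)\<^sup>2" using c c' by (intro mult_right_mono) (auto simp: K_def)
    finally show "norm f' \<le> sqrt K * norm f" by (intro le) auto
    have "c * (norm f)\<^sup>2 \<le> C' * (norm f')\<^sup>2" using c(3)[of f] c'(4)[of f'] qq'[OF ff'] by linarith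
    then have "(norm f)\<^sup>2 \<le> C' / c * (norm f')\<^sup>2" using c by (simp add: field_simps)
    also have "\<dots> \<le> K * (norm f')\<^sup>2" using c c' by (intro mult_right_mono) (auto simp: K_def)
    finally show "norm f \<le> sqrt K * norm f'" by (intro le) auto
  qed (use that in auto)
qed

lemma isometric_relation_extends_to_unitary:
  fixes ip :: "'h::complex_hilbert_space \<Rightarrow> 'h \<Rightarrow> complex"
    and ip' :: "'k::complex_hilbert_space \<Rightarrow> 'k \<Rightarrow> complex"
  assumes p: "pontryagin_space ip J" and k': "krein_space ip' J'"
    and V: "csubspace V" and dom: "closure (Domain V) = UNIV" and ran: "closure (Range V) = UNIV"
    and iso: "\<And>f f' g g'. (f, f') \<in> V \<Longrightarrow> (g, g') \<in> V \<Longrightarrow> ip' f' g' = ip f g"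
  obtains U where "standard_unitary ip ip' U" "\<And>f f'. (f, f') \<in> V \<Longrightarrow> U f = f'"
  using p
proof (cases rule: pontryagin_cases)
  have k: "krein_space ip J" using p by (simp add: pontryagin_space_def)
  {
    case (1 B)
    show thesis using isometric_relation_extends_if_finite_negative_part[OF k k' 1 V dom ran iso] that by blast
  next
    case (2 B)
    have neg: "krein_space (\<lambda>f g. - ip f g) (\<lambda>f. - J f)" "krein_space (\<lambda>f g. - ip' f g) (\<lambda>f. - J' f)"
      using k k' krein.krein[OF krein.krein_uminus[OF krein.intro]] by blast+
    have "- ip' f' g' = - ip f g" if "(f, f') \<in> V" "(g, g') \<in> V" for f f' g g'
      using iso[OF that] by simp
    from isometric_relation_extends_if_finite_negative_part[OF neg 2 V dom ran this]
    obtain U where "standard_unitary (\<lambda>f g. - ip f g) (\<lambda>f g. - ip' f g) U"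
        "\<And>f f'. (f, f') \<in> V \<Longrightarrow> U f = f'"
      by blast
    then show thesis using that by (simp add: standard_unitary_def)
  }
qed

section \<open>Linear relations and their defect subspaces\<close>

lemma eigenspace_iff: "f \<in> eigenspace T z \<longleftrightarrow> (f, z *\<^sub>C f) \<in> T"
  by (auto simp: eigenspace_def rel_ker_def rel_shift_def)

lemma Range_rel_shift: "Range (rel_shift T z) = (\<lambda>p. snd p - z *\<^sub>C fst p) ` T"
  by (force simp: rel_shift_def)

lemma mem_Range_rel_shift_iff: "y \<in> Range (rel_shift T z) \<longleftrightarrow> (\<exists>t t'. (t, t') \<in> T \<and> y = t' - z *\<^sub>C t)"
  by (auto simp: rel_shift_def)

lemma csubspace_eigenspace:
  assumes T: "csubspace T"
  shows "csubspace (eigenspace T z)"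
proof (rule csubspaceI)
  show "0 \<in> eigenspace T z"
    using complex_vec.subspace_0[OF T] by (simp add: eigenspace_iff zero_prod_def)
next
  fix x y assume "x \<in> eigenspace T z" "y \<in> eigenspace T z"
  then show "x + y \<in> eigenspace T z"
    using complex_vec.subspace_add[OF T, of "(x, z *\<^sub>C x)" "(y, z *\<^sub>C y)"]
    by (simp add: eigenspace_iff scaleC_add_right)
next
  fix c x assume "x \<in> eigenspace T z"
  then show "c *\<^sub>C x \<in> eigenspace T z"
    using complex_vec.subspace_scale[OF T, of "(x, z *\<^sub>C x)" c]
    by (simp add: eigenspace_iff scaleC_scaleC mult.commute)
qed

lemma closed_eigenspace:
  assumes "closed T"
  shows "closed (eigenspace T z)"
proof -
  have "eigenspace T z = (\<lambda>f. (f, z *\<^sub>C f)) -` T" by (auto simp: eigenspace_iff)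
  moreover have "continuous_on UNIV (\<lambda>f. (f, z *\<^sub>C f))" by (intro continuous_intros)
  ultimately show ?thesis using closed_vimage[OF assms] by simp
qed

lemma csubspace_Range_rel_shift:
  assumes T: "csubspace T"
  shows "csubspace (Range (rel_shift T z))"
proof (rule csubspaceI)
  show "0 \<in> Range (rel_shift T z)"
    using complex_vec.subspace_0[OF T] unfolding mem_Range_rel_shift_iff
    by (intro exI[of _ 0]) (simp add: zero_prod_def)
next
  fix x y assume "x \<in> Range (rel_shift T z)" "y \<in> Range (rel_shift T z)"
  then obtain t t' s s' where *: "(t, t') \<in> T" "x = t' - z *\<^sub>C t" "(s, s') \<in> T" "y = s' - z *\<^sub>C s"
    unfolding mem_Range_rel_shift_iff by blast
  then have "(t + s, t' + s') \<in> T" using complex_vec.subspace_add[OF T *(1) *(3)] by simp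
  moreover have "x + y = (t' + s') - z *\<^sub>C (t + s)" using * by (simp add: scaleC_add_right)
  ultimately show "x + y \<in> Range (rel_shift T z)" unfolding mem_Range_rel_shift_iff by blast
next
  fix c x assume "x \<in> Range (rel_shift T z)"
  then obtain t t' where *: "(t, t') \<in> T" "x = t' - z *\<^sub>C t"
    unfolding mem_Range_rel_shift_iff by blast
  then have "(c *\<^sub>C t, c *\<^sub>C t') \<in> T" using complex_vec.subspace_scale[OF T *(1), of c] by simp
  moreover have "c *\<^sub>C x = c *\<^sub>C t' - z *\<^sub>C (c *\<^sub>C t)"
    using * by (simp add: scaleC_diff_right scaleC_scaleC mult.commute)
  ultimately show "c *\<^sub>C x \<in> Range (rel_shift T z)" unfolding mem_Range_rel_shift_iff by blast
qed

lemma rho_hat_imp_bounded_below: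
  assumes T: "csubspace T" "closed T" and z: "z \<in> rho_hat T"
  obtains c where "c > 0" "\<And>t t'. (t, t') \<in> T \<Longrightarrow> c * norm t \<le> norm (t' - z *\<^sub>C t)"
proof -
  let ?F = "\<lambda>p. snd p - z *\<^sub>C fst p"
  have F: "bounded_linear ?F"
    by (intro bounded_linear_sub bounded_linear_snd
        bounded_linear_compose[OF bounded_linear_scaleC bounded_linear_fst])
  have sub: "subspace T"
    using T(1) unfolding subspace_def scaleR_eq_scaleC
    by (auto intro: complex_vec.subspace_0 complex_vec.subspace_add complex_vec.subspace_scale)
  have closed: "closed (?F ` T)" using z unfolding rho_hat_def Range_rel_shift by simp
  have inj: "p = 0" if "p \<in> T" "?F p = 0" for p
  proof -
    obtain t t' where p: "p = (t, t')" by (cases p)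
    then have "t \<in> eigenspace T z" using that by (simp add: eigenspace_iff)
    then have "t = 0" using z unfolding rho_hat_def by blast
    then show ?thesis using that p by (simp add: zero_prod_def)
  qed
  obtain c where c: "c > 0" "\<And>p. p \<in> T \<Longrightarrow> c * norm p \<le> norm (?F p)"
    using bounded_below_if_closed_range[OF F sub T(2) closed inj] by blast
  show thesis
  proof (rule that[OF c(1)])
    fix t t' assume "(t, t') \<in> T"
    moreover have "c * norm t \<le> c * norm (t, t')"
      using c(1) norm_fst_le[of t t'] by (intro mult_left_mono) auto
    ultimately show "c * norm t \<le> norm (t' - z *\<^sub>C t)" using c(2) by fastforce
  qed
qed

lemma bounded_below_imp_rho_hat:
  assumes T: "csubspace T" "closed T" and c: "c > 0"
    and bound: "\<And>t t'. (t, t') \<in> T \<Longrightarrow> c * norm t \<le> norm (t' - z *\<^sub>C t)"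
  shows "z \<in> rho_hat T"
proof -
  have "t = 0" if "t \<in> eigenspace T z" for t
  proof -
    have "c * norm t \<le> 0" using bound[of t "z *\<^sub>C t"] that by (simp add: eigenspace_iff)
    then show ?thesis using c by (simp add: mult_le_0_iff)
  qed
  moreover have "0 \<in> eigenspace T z" by (rule complex_vec.subspace_0[OF csubspace_eigenspace[OF T(1)]])
  ultimately have "eigenspace T z = {0}" by blast
  moreover have "closed (Range (rel_shift T z))"
    unfolding closed_sequential_limits
  proof (intro allI impI)
    fix y l assume yl: "(\<forall>n. y n \<in> Range (rel_shift T z)) \<and> y \<longlonglongrightarrow> l"
    then have "\<forall>n. \<exists>p. p \<in> T \<and> y n = snd p - z *\<^sub>C fst p" unfolding Range_rel_shift by blast
    then obtain p where p: "\<And>n. p n \<in> T" "\<And>n. y n = snd (p n) - z *\<^sub>C fst (p n)" by metis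
    define t t' where "t n = fst (p n)" and "t' n = snd (p n)" for n
    have tt': "(t n, t' n) \<in> T" "y n = t' n - z *\<^sub>C t n" for n using p by (simp_all add: t_def t'_def)
    have "Cauchy y" using yl by (auto intro: LIMSEQ_imp_Cauchy)
    have "Cauchy t"
    proof (rule CauchyI)
      fix e :: real assume "e > 0"
      then have "c * e > 0" using c by simp
      then obtain M where M: "\<And>m n. m \<ge> M \<Longrightarrow> n \<ge> M \<Longrightarrow> norm (y m - y n) < c * e"
        using CauchyD[OF \<open>Cauchy y\<close>] by blast
      show "\<exists>M. \<forall>m\<ge>M. \<forall>n\<ge>M. norm (t m - t n) < e"
      proof (intro exI allI impI)
        fix m n assume mn: "m \<ge> M" "n \<ge> M"
        have "(t m - t n, t' m - t' n) \<in> T"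
          using complex_vec.subspace_diff[OF T(1) tt'(1)[of m] tt'(1)[of n]] by simp
        from bound[OF this] have "c * norm (t m - t n) \<le> norm (y m - y n)"
          by (simp add: tt'(2) scaleC_diff_right algebra_simps)
        also have "\<dots> < c * e" by (rule M[OF mn])
        finally show "norm (t m - t n) < e" using c by simp
      qed
    qed
    then obtain s where s: "t \<longlonglongrightarrow> s" using Cauchy_convergent convergent_def by blast
    have "(\<lambda>n. y n + z *\<^sub>C t n) \<longlonglongrightarrow> l + z *\<^sub>C s" using yl s by (intro tendsto_intros) auto
    then have "t' \<longlonglongrightarrow> l + z *\<^sub>C s" by (simp add: tt'(2))
    then have "(\<lambda>n. (t n, t' n)) \<longlonglongrightarrow> (s, l + z *\<^sub>C s)" using s by (rule tendsto_Pair[rotated])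
    then have "(s, l + z *\<^sub>C s) \<in> T" using closed_sequentially[OF T(2), of "\<lambda>n. (t n, t' n)"] tt'(1) by simp
    then show "l \<in> Range (rel_shift T z)"
      unfolding mem_Range_rel_shift_iff by (intro exI conjI) (assumption, simp)
  qed
  ultimately show ?thesis by (simp add: rho_hat_def)
qed

lemma bounded_below_perturbation:
  assumes bound: "c * norm t \<le> norm (t' - z *\<^sub>C t)" and w: "cmod (w - z) \<le> c / 2"
  shows "c / 2 * norm t \<le> norm (t' - w *\<^sub>C t)"
proof -
  have eq: "t' - z *\<^sub>C t = (t' - w *\<^sub>C t) + (w - z) *\<^sub>C t" by (simp add: scaleC_diff_left)
  have "norm (t' - z *\<^sub>C t) \<le> norm (t' - w *\<^sub>C t) + cmod (w - z) * norm t"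
    unfolding eq using norm_triangle_ineq[of "t' - w *\<^sub>C t" "(w - z) *\<^sub>C t"] by simp
  moreover have "cmod (w - z) * norm t \<le> c / 2 * norm t" using w by (rule mult_right_mono) simp
  ultimately show ?thesis using bound by simp
qed

context krein
begin

lemma krein_adjoint_iff:
  "(g, g') \<in> krein_adjoint ip T \<longleftrightarrow> (\<forall>f f'. (f, f') \<in> T \<longrightarrow> ip f g' = ip f' g)"
  by (auto simp: krein_adjoint_def)

lemma csubspace_krein_adjoint: "csubspace (krein_adjoint ip T)"
  by (rule csubspaceI)
    (auto simp: krein_adjoint_iff zero_prod_def ip_add_right ip_scaleC_right)

lemma closed_krein_adjoint: "closed (krein_adjoint ip T)"
proof -
  have "krein_adjoint ip T = (\<Inter>p\<in>T. {v. ip (fst p) (snd v) = ip (snd p) (fst v)})"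
    by (fastforce simp: krein_adjoint_def)
  also have "closed \<dots>"
    by (intro closed_INT ballI closed_Collect_eq continuous_on_ip continuous_intros)
  finally show ?thesis .
qed

text \<open>The defect subspace at \<open>z\<close> is the orthogonal complement of the range of \<open>T - cnj z\<close> in the indefinite
  inner product.\<close>

lemma eigenspace_adjoint_iff:
  "f \<in> eigenspace (krein_adjoint ip T) z \<longleftrightarrow> (\<forall>y \<in> Range (rel_shift T (cnj z)). ip y f = 0)"
proof -
  have "(\<forall>y \<in> Range (rel_shift T (cnj z)). ip y f = 0)
      \<longleftrightarrow> (\<forall>t t'. (t, t') \<in> T \<longrightarrow> ip (t' - cnj z *\<^sub>C t) f = 0)"
    unfolding Ball_def mem_Range_rel_shift_iff by blast
  then show ?thesis
    unfolding eigenspace_iff krein_adjoint_iff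
    by (auto simp: ip_scaleC_right ip_diff_left ip_scaleC_left)
qed

lemma orthogonal_to_eigenspace_imp_mem_Range:
  assumes T: "csubspace T" and cl: "closed (Range (rel_shift T (cnj z)))"
    and orth: "\<And>f. f \<in> eigenspace (krein_adjoint ip T) z \<Longrightarrow> ip y f = 0"
  shows "y \<in> Range (rel_shift T (cnj z))"
proof -
  obtain p where p: "p \<in> Range (rel_shift T (cnj z))"
    and perp: "\<And>x. x \<in> Range (rel_shift T (cnj z)) \<Longrightarrow> cinner x (y - p) = 0"
    using orthogonal_projection_exists[OF csubspace_Range_rel_shift[OF T] cl] by blast
  have J: "J (y - p) \<in> eigenspace (krein_adjoint ip T) z"
    using perp by (simp add: eigenspace_adjoint_iff cinner_eq_ip)
  have "cinner y (y - p) = 0" using orth[OF J] by (simp add: cinner_eq_ip)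
  then have "cinner (y - p) (y - p) = 0" using perp[OF p] by (simp add: cinner_diff_left)
  then have "y = p" by (simp add: cinner_self)
  then show ?thesis using p by simp
qed

text \<open>The vector \<open>g\<close> is obtained by removing from \<open>J f\<close> its Hilbert projection \<open>p = t' - cnj w t\<close> onto the range
  of \<open>T - cnj w\<close>. As \<open>f\<close> is orthogonal to \<open>t' - cnj z t\<close>, the square of \<open>norm p\<close> is
  \<open>\<bar>w - z\<bar> * \<bar>[t, f]\<bar>\<close>, and the lower bound for \<open>T - cnj w\<close> controls \<open>norm t\<close> by \<open>norm p\<close>.\<close>

lemma eigenspace_adjoint_near:
  assumes T: "csubspace T" and cl: "closed (Range (rel_shift T (cnj w)))"
    and c: "c > 0" and bound: "\<And>t t'. (t, t') \<in> T \<Longrightarrow> c * norm t \<le> norm (t' - cnj w *\<^sub>C t)"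
    and f: "f \<in> eigenspace (krein_adjoint ip T) z"
  obtains g where "g \<in> eigenspace (krein_adjoint ip T) w" "norm (f - g) \<le> cmod (w - z) / c * norm f"
proof -
  let ?R = "Range (rel_shift T (cnj w))"
  obtain p where p: "p \<in> ?R" and perp: "\<And>x. x \<in> ?R \<Longrightarrow> cinner x (J f - p) = 0"
    using orthogonal_projection_exists[OF csubspace_Range_rel_shift[OF T] cl] by blast
  obtain t t' where t: "(t, t') \<in> T" "p = t' - cnj w *\<^sub>C t"
    using p unfolding mem_Range_rel_shift_iff by blast
  have zero: "ip (t' - cnj z *\<^sub>C t) f = 0"
  proof -
    have "t' - cnj z *\<^sub>C t \<in> Range (rel_shift T (cnj z))"
      using t(1) unfolding mem_Range_rel_shift_iff by blast
    then show ?thesis using f unfolding eigenspace_adjoint_iff by blast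
  qed
  have peq: "p = (t' - cnj z *\<^sub>C t) + (cnj z - cnj w) *\<^sub>C t" by (simp add: t(2) scaleC_diff_left)
  have "complex_of_real ((norm p)\<^sup>2) = cinner p (J f)"
    using perp[OF p] by (simp add: cinner_diff_right cinner_self)
  also have "\<dots> = ip p f" by (simp add: ip_eq_cinner)
  also have "\<dots> = (z - w) * ip t f"
    unfolding peq using zero by (simp add: ip_add_left ip_scaleC_left)
  finally have "cmod (complex_of_real ((norm p)\<^sup>2)) = cmod (z - w) * cmod (ip t f)"
    by (simp only: norm_mult)
  then have "(norm p)\<^sup>2 = cmod (w - z) * cmod (ip t f)"
    by (simp add: norm_minus_commute norm_power)
  also have "\<dots> \<le> cmod (w - z) * (norm t * norm f)"
    by (intro mult_left_mono cmod_ip_le) simp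
  also have "\<dots> \<le> cmod (w - z) * (norm p / c * norm f)"
    using bound[OF t(1)] c by (intro mult_left_mono mult_right_mono) (auto simp: t(2) field_simps)
  finally have "norm p * norm p \<le> norm p * (cmod (w - z) / c * norm f)"
    by (simp add: power2_eq_square mult_ac)
  then have np: "norm p \<le> cmod (w - z) / c * norm f"
    using c by (cases "p = 0") (auto intro: mult_left_le_imp_le)
  show thesis
  proof (rule that)
    show "f - J p \<in> eigenspace (krein_adjoint ip T) w"
      using perp by (simp add: eigenspace_adjoint_iff cinner_eq_ip J_diff)
    show "norm (f - (f - J p)) \<le> cmod (w - z) / c * norm f" using np by simp
  qed
qed

text \<open>The set \<open>\<delta>(T)\<close> is open, and the defect subspaces depend continuously on the point, with one
  constant for both directions of comparison.\<close>

lemma delta_near: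
  assumes T: "csubspace T" "closed T" and z: "z \<in> delta T"
  obtains r K where "r > 0" "K > 0"
    "\<forall>w. cmod (w - z) < r \<longrightarrow> w \<in> delta T"
    "\<forall>v w. cmod (v - z) < r \<and> cmod (w - z) < r \<longrightarrow>
       (\<forall>f \<in> eigenspace (krein_adjoint ip T) v.
          \<exists>g \<in> eigenspace (krein_adjoint ip T) w. norm (f - g) \<le> K * cmod (w - v) * norm f)"
proof -
  have zz: "z \<notin> \<real>" "z \<in> rho_hat T" "cnj z \<in> rho_hat T" using z by (auto simp: delta_def)
  obtain a where a: "a > 0" "\<And>t t'. (t, t') \<in> T \<Longrightarrow> a * norm t \<le> norm (t' - z *\<^sub>C t)"
    using rho_hat_imp_bounded_below[OF T zz(2)] by blast
  obtain b where b: "b > 0" "\<And>t t'. (t, t') \<in> T \<Longrightarrow> b * norm t \<le> norm (t' - cnj z *\<^sub>C t)"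
    using rho_hat_imp_bounded_below[OF T zz(3)] by blast
  \<comment> \<open>The bound \<open>\<bar>Im z\<bar>\<close> keeps the points off the real axis.\<close>
  define r where "r = min (\<bar>Im z\<bar>) (min (a / 2) (b / 2))"
  have Imz: "\<bar>Im z\<bar> > 0" using zz(1) by (simp add: complex_is_Real_iff)
  have near: "w \<in> rho_hat T \<and> cnj w \<in> rho_hat T \<and> w \<notin> \<real>
      \<and> (\<forall>t t'. (t, t') \<in> T \<longrightarrow> b / 2 * norm t \<le> norm (t' - cnj w *\<^sub>C t))"
    if w: "cmod (w - z) < r" for w
  proof -
    have wa: "a / 2 * norm t \<le> norm (t' - w *\<^sub>C t)" if "(t, t') \<in> T" for t t'
      using a(2)[OF that] w by (intro bounded_below_perturbation) (auto simp: r_def)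
    have "cmod (cnj w - cnj z) = cmod (w - z)" by (metis complex_cnj_diff complex_mod_cnj)
    then have wb: "b / 2 * norm t \<le> norm (t' - cnj w *\<^sub>C t)" if "(t, t') \<in> T" for t t'
      using b(2)[OF that] w by (intro bounded_below_perturbation) (auto simp: r_def)
    have "Im w \<noteq> 0"
      using abs_Im_le_cmod[of "w - z"] w by (auto simp: r_def)
    then show ?thesis
      using bounded_below_imp_rho_hat[OF T _ wa] bounded_below_imp_rho_hat[OF T _ wb] a(1) b(1) wb
      by (simp add: complex_is_Real_iff)
  qed
  show thesis
  proof (rule that[of r "2 / b"])
    show "r > 0" "2 / b > 0" using Imz a(1) b(1) by (auto simp: r_def)
    show "\<forall>w. cmod (w - z) < r \<longrightarrow> w \<in> delta T" using near by (simp add: delta_def)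
    show "\<forall>v w. cmod (v - z) < r \<and> cmod (w - z) < r \<longrightarrow>
       (\<forall>f \<in> eigenspace (krein_adjoint ip T) v.
          \<exists>g \<in> eigenspace (krein_adjoint ip T) w. norm (f - g) \<le> 2 / b * cmod (w - v) * norm f)"
    proof (intro allI impI ballI)
      fix v w f assume "cmod (v - z) < r \<and> cmod (w - z) < r" and f: "f \<in> eigenspace (krein_adjoint ip T) v"
      then have w: "closed (Range (rel_shift T (cnj w)))"
          "\<And>t t'. (t, t') \<in> T \<Longrightarrow> b / 2 * norm t \<le> norm (t' - cnj w *\<^sub>C t)"
        using near unfolding rho_hat_def by blast+
      obtain g where "g \<in> eigenspace (krein_adjoint ip T) w" "norm (f - g) \<le> cmod (w - v) / (b / 2) * norm f"
        using eigenspace_adjoint_near[OF T(1) w(1) half_gt_zero[OF b(1)] w(2) f] by blast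
      then show "\<exists>g \<in> eigenspace (krein_adjoint ip T) w. norm (f - g) \<le> 2 / b * cmod (w - v) * norm f"
        by (intro bexI) (simp_all add: mult.commute)
    qed
  qed
qed

lemma uniformly_definite_near:
  assumes pont: "pontryagin_space ip J" and T: "csubspace T" "closed T" and z: "z \<in> delta T"
    and free: "\<And>f. f \<in> eigenspace (krein_adjoint ip T) z \<Longrightarrow> ip f f = 0 \<Longrightarrow> f = 0"
  obtains r d where "r > 0" "d > 0"
    "\<And>w g. cmod (w - z) < r \<Longrightarrow> g \<in> eigenspace (krein_adjoint ip T) w \<Longrightarrow> d * (norm g)\<^sup>2 \<le> cmod (ip g g)"
proof -
  let ?N = "eigenspace (krein_adjoint ip T)"
  obtain c where c: "c > 0" "\<And>f. f \<in> ?N z \<Longrightarrow> c * (norm f)\<^sup>2 \<le> cmod (ip f f)"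
    using neutral_free_imp_uniformly_definite[OF pont csubspace_eigenspace[OF csubspace_krein_adjoint]
        closed_eigenspace[OF closed_krein_adjoint] free] by blast
  obtain r K where r: "r > 0" and K: "K > 0"
    and near: "\<forall>v w. cmod (v - z) < r \<and> cmod (w - z) < r \<longrightarrow>
       (\<forall>f \<in> ?N v. \<exists>g \<in> ?N w. norm (f - g) \<le> K * cmod (w - v) * norm f)"
    by (rule delta_near[OF T z]) (rule that)
  \<comment> \<open>If \<open>norm (g - f) \<le> \<epsilon> * norm g\<close>, then \<open>[f, f]\<close> and \<open>[g, g]\<close> differ by at most
    \<open>5/2 * \<epsilon> * (norm g)\<^sup>2 \<le> c / 8 * (norm g)\<^sup>2\<close>, while \<open>norm f \<ge> norm g / 2\<close> leaves \<open>c / 4 * (norm g)\<^sup>2\<close>.\<close>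
  define \<epsilon> where "\<epsilon> = min (1/2) (c / 20)"
  have \<epsilon>: "\<epsilon> > 0" "\<epsilon> \<le> 1/2" "\<epsilon> \<le> c / 20" using c(1) by (auto simp: \<epsilon>_def)
  show thesis
  proof (rule that[of "min r (\<epsilon> / K)" "c / 8"])
    fix w g assume w: "cmod (w - z) < min r (\<epsilon> / K)" and g: "g \<in> ?N w"
    obtain f where f: "f \<in> ?N z" "norm (g - f) \<le> K * cmod (z - w) * norm g"
      using near[rule_format, of w z g] w g r by auto
    have "K * cmod (z - w) \<le> \<epsilon>" using w K by (simp add: field_simps norm_minus_commute)
    then have "K * cmod (z - w) * norm g \<le> \<epsilon> * norm g" by (rule mult_right_mono) simp
    then have gf: "norm (g - f) \<le> \<epsilon> * norm g" using f(2) by linarith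
    also have "\<dots> \<le> 1/2 * norm g" using \<epsilon>(2) by (rule mult_right_mono) simp
    finally have half: "norm (g - f) \<le> norm g / 2" by simp
    have f_low: "norm g / 2 \<le> norm f" using norm_triangle_sub[of g f] half by simp
    have f_up: "norm f \<le> 3/2 * norm g"
      using norm_triangle_sub[of f g] half by (simp add: norm_minus_commute)
    have "ip g g = ip f f + (ip (g - f) f + ip g (g - f))"
      by (simp add: ip_diff_left ip_diff_right)
    then have "cmod (ip f f) \<le> cmod (ip g g) + cmod (ip (g - f) f + ip g (g - f))"
      by (metis add_diff_cancel norm_triangle_ineq4)
    also have "cmod (ip (g - f) f + ip g (g - f)) \<le> norm (g - f) * norm f + norm g * norm (g - f)"
      using cmod_ip_le[of "g - f" f] cmod_ip_le[of g "g - f"]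
        norm_triangle_ineq[of "ip (g - f) f" "ip g (g - f)"] by linarith
    also have "\<dots> = norm (g - f) * (norm f + norm g)" by (simp add: algebra_simps)
    also have "\<dots> \<le> (\<epsilon> * norm g) * (5/2 * norm g)"
      using gf f_up \<epsilon>(1) by (intro mult_mono) auto
    also have "\<dots> = 5/2 * \<epsilon> * (norm g)\<^sup>2" by (simp add: power2_eq_square)
    also have "\<dots> \<le> c / 8 * (norm g)\<^sup>2" using \<epsilon>(3) by (intro mult_right_mono) auto
    finally have "c * (norm f)\<^sup>2 \<le> cmod (ip g g) + c / 8 * (norm g)\<^sup>2" using c(2)[OF f(1)] by linarith
    moreover have "c * (norm g / 2)\<^sup>2 \<le> c * (norm f)\<^sup>2"
      using f_low c(1) by (intro mult_left_mono power_mono) auto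
    ultimately show "c / 8 * (norm g)\<^sup>2 \<le> cmod (ip g g)" by (simp add: power_divide)
  qed (use r K c(1) \<epsilon>(1) in auto)
qed

section \<open>The set \<open>\<Delta>\<close> and neutral defect vectors\<close>

lemma ip_sq_J_sq: "ip_sq ip u (J_sq J v) = cinner u v"
  by (cases u; cases v)
    (simp add: cinner_prod_def cinner_eq_ip ip_scaleC_right ip_minus_right)

lemma orth_compl_iff: "v \<in> orth_compl ip J T \<longleftrightarrow> (\<forall>u\<in>T. cinner u v = 0)"
  by (simp add: orth_compl_def ip_sq_J_sq)

lemma ip_sq_eq: "ip_sq ip u v = - \<i> * (ip (fst u) (snd v) - ip (snd u) (fst v))"
  by (cases u; cases v) (simp add: algebra_simps)

lemma ip_sq_eq_0_iff: "ip_sq ip u v = 0 \<longleftrightarrow> ip (fst u) (snd v) = ip (snd u) (fst v)"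
  by (simp add: ip_sq_eq)

lemma ip_eq_0_if_eigenvector_neutral:
  assumes "ip_sq ip (x, w *\<^sub>C x) (x, w *\<^sub>C x) = 0" "w \<notin> \<real>"
  shows "ip x x = 0"
proof -
  have "ip x x = 0 \<or> cnj w = w"
    using assms(1) by (simp add: ip_sq_eq_0_iff ip_scaleC_left ip_scaleC_right algebra_simps)
  moreover have "cnj w \<noteq> w" using assms(2) by (auto simp: complex_is_Real_iff complex_eq_iff)
  ultimately show ?thesis by simp
qed

text \<open>Either failure of the conditions defining \<open>\<Delta>\<close>, a common vector of the ranges of \<open>T - w\<close> and \<open>N - w\<close> or
  an eigenvector of \<open>N\<close> at \<open>w\<close>, produces an eigenvector at \<open>w\<close> of the hyper-maximal neutral sum of \<open>T\<close>
  and \<open>N\<close>. Such a vector is a neutral element of the defect subspace at \<open>w\<close>.\<close>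

lemma neutral_free_imp_mem_Delta_0:
  assumes T: "csubspace T" "T \<subseteq> krein_adjoint ip T" and z: "z \<in> delta T"
    and free: "\<And>w f. w \<in> {z, cnj z} \<Longrightarrow> f \<in> eigenspace (krein_adjoint ip T) w \<Longrightarrow> ip f f = 0 \<Longrightarrow> f = 0"
  shows "z \<in> Delta_0 ip J T"
proof -
  have "z \<in> O_s T N \<and> z \<notin> sigma_p0 N \<and> cnj z \<notin> sigma_p0 N" if N: "N \<in> neutral_class ip J T" for N
  proof -
    define A where "A = {t + n | t n. t \<in> T \<and> n \<in> N}"
    have Nsub: "csubspace N" and Nadj: "N \<subseteq> krein_adjoint ip T" and Nperp: "N \<subseteq> orth_compl ip J T"
      and "hyper_maximal_neutral ip A"
      using N by (simp_all add: neutral_class_def neutral_subspace_def A_def)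
    then have A: "A = {v. \<forall>u\<in>A. ip_sq ip u v = 0}" by (simp add: hyper_maximal_neutral_def)
    have real: "w \<notin> \<real>" if "w \<in> {z, cnj z}" for w
      using z that by (auto simp: delta_def complex_is_Real_iff)
    have zero: "x = 0" if w: "w \<in> {z, cnj z}" and x: "(x, w *\<^sub>C x) \<in> A" for x w
    proof -
      have "ip_sq ip (x, w *\<^sub>C x) (x, w *\<^sub>C x) = 0" using x A by blast
      then have "ip x x = 0" using real[OF w] by (rule ip_eq_0_if_eigenvector_neutral)
      moreover have "x \<in> eigenspace (krein_adjoint ip T) w"
        using x T(2) Nadj complex_vec.subspace_add[OF csubspace_krein_adjoint]
        unfolding A_def eigenspace_iff by fastforce
      ultimately show ?thesis using free[OF w] by blast
    qed
    have T0: "0 \<in> T" and N0: "0 \<in> N" using T(1) Nsub by (auto intro: complex_vec.subspace_0)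
    have "Range (rel_shift T w) \<inter> Range (rel_shift N w) = {0}" if w: "w \<in> {z, cnj z}" for w
    proof -
      have "y = 0" if y: "y \<in> Range (rel_shift T w)" "y \<in> Range (rel_shift N w)" for y
      proof -
        obtain t t' n n' where tn: "(t, t') \<in> T" "y = t' - w *\<^sub>C t" "(n, n') \<in> N" "y = n' - w *\<^sub>C n"
          using y unfolding mem_Range_rel_shift_iff by blast
        have "(t, t') + - (n, n') \<in> A"
          unfolding A_def using tn(1,3) complex_vec.subspace_neg[OF Nsub] by blast
        moreover have "t' - n' = w *\<^sub>C (t - n)" using tn(2,4) by (simp add: scaleC_diff_right algebra_simps)
        ultimately have tn0: "t - n = 0" by (intro zero[OF w]) simp
        then have eq: "(t, t') = (n, n')" using tn(2,4) by simp
        then have "cinner (t, t') (t, t') = 0" using tn(1,3) Nperp orth_compl_iff by auto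
        then have "(t, t') = 0" unfolding cinner_self by simp
        then show ?thesis using tn(2) by (simp add: zero_prod_def)
      qed
      moreover have "0 \<in> Range (rel_shift T w)" "0 \<in> Range (rel_shift N w)"
        using complex_vec.subspace_0 csubspace_Range_rel_shift T(1) Nsub by blast+
      ultimately show ?thesis by blast
    qed
    moreover have "w \<notin> sigma_p0 N" if w: "w \<in> {z, cnj z}" for w
    proof -
      have "x = 0" if "x \<in> eigenspace N w" for x
      proof (rule zero[OF w])
        have "0 + (x, w *\<^sub>C x) \<in> A"
          unfolding A_def using that T0 eigenspace_iff by blast
        then show "(x, w *\<^sub>C x) \<in> A" by simp
      qed
      moreover have "0 \<in> eigenspace N w" using complex_vec.subspace_0[OF csubspace_eigenspace[OF Nsub]] .
      ultimately show ?thesis unfolding sigma_p0_def by blast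
    qed
    ultimately show ?thesis using z by (simp add: O_s_def)
  qed
  then show ?thesis unfolding Delta_0_def by blast
qed

end

text \<open>A single neutral vector of the boundary space spans no more than a symmetric relation, but an explicit
  selfadjoint relation contains it. If \<open>h0 = 0\<close>, the purely multivalued relation
  does; otherwise there is a selfadjoint operator \<open>B\<close> of rank at most two with \<open>B h0 = h1\<close>, where the
  last term in its definition compensates for the contribution counted by both of the first two.\<close>

lemma selfadjoint_relation_through_neutral_vector:
  fixes h0 h1 :: "'l::complex_hilbert_space"
  assumes h: "cinner h0 h1 = cinner h1 h0"
  obtains \<Theta> :: "('l \<times> 'l) set" where "csubspace \<Theta>" "(h0, h1) \<in> \<Theta>"
    "\<And>k0 k1. (k0, k1) \<in> \<Theta> \<longleftrightarrow> (\<forall>l0 l1. (l0, l1) \<in> \<Theta> \<longrightarrow> cinner l0 k1 = cinner l1 k0)"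
proof (cases "h0 = 0")
  case True
  let ?\<Theta> = "{0} \<times> (UNIV :: 'l set)"
  show thesis
  proof (rule that[of ?\<Theta>])
    show "csubspace ?\<Theta>" by (rule csubspaceI) (auto simp: zero_prod_def)
    show "(h0, h1) \<in> ?\<Theta>" using True by simp
    fix k0 k1 :: 'l
    show "(k0, k1) \<in> ?\<Theta> \<longleftrightarrow> (\<forall>l0 l1. (l0, l1) \<in> ?\<Theta> \<longrightarrow> cinner l0 k1 = cinner l1 k0)"
    proof
      assume "\<forall>l0 l1. (l0, l1) \<in> ?\<Theta> \<longrightarrow> cinner l0 k1 = cinner l1 k0"
      then have "cinner k0 k0 = 0" by (metis SigmaI UNIV_I cinner_zero(1) singletonI)
      then show "(k0, k1) \<in> ?\<Theta>" by (simp add: cinner_self)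
    qed auto
  qed
next
  case False
  define n where "n = cinner h0 h0"
  define r where "r = cinner h0 h1"
  have n0: "n \<noteq> 0" and n_real: "cnj n = n" using False by (simp_all add: n_def cinner_self)
  have r: "cnj r = r" "cinner h1 h0 = r" using h by (metis cinner_commute r_def)+
  define B where "B x = (cinner h0 x / n) *\<^sub>C h1 + (cinner h1 x / n) *\<^sub>C h0
      - (r * cinner h0 x / (n * n)) *\<^sub>C h0" for x
  have B_sym: "cinner (B x) y = cinner x (B y)" for x y
    using n0 by (simp add: B_def cinner_add_left cinner_add_right cinner_diff_left cinner_diff_right
        cinner_scaleC_left cinner_scaleC_right n_real r cinner_commute[symmetric] field_simps)
  have B_h0: "B h0 = h1"
    using n0 by (simp add: B_def n_def[symmetric] r)
  have B_add: "B (x + y) = B x + B y" for x y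
    by (simp add: B_def cinner_add_right add_divide_distrib distrib_left scaleC_add_left)
  have B_scale: "B (c *\<^sub>C x) = c *\<^sub>C B x" for c x
    by (simp add: B_def cinner_scaleC_right scaleC_add_right scaleC_diff_right scaleC_scaleC mult_ac)
  show thesis
  proof (rule that[of "{(x, B x) | x. True}"])
    show "csubspace {(x, B x) | x. True}"
      by (rule csubspaceI) (use B_scale[of 0 0] in \<open>auto simp: zero_prod_def B_add B_scale\<close>)
    show "(h0, h1) \<in> {(x, B x) | x. True}" using B_h0 by auto
    fix k0 k1
    show "(k0, k1) \<in> {(x, B x) | x. True}
        \<longleftrightarrow> (\<forall>l0 l1. (l0, l1) \<in> {(x, B x) | x. True} \<longrightarrow> cinner l0 k1 = cinner l1 k0)"
    proof
      assume "\<forall>l0 l1. (l0, l1) \<in> {(x, B x) | x. True} \<longrightarrow> cinner l0 k1 = cinner l1 k0"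
      then have "cinner x k1 = cinner x (B k0)" for x by (simp add: B_sym)
      then have "cinner (k1 - B k0) (k1 - B k0) = 0" by (simp add: cinner_diff_right)
      then show "(k0, k1) \<in> {(x, B x) | x. True}" by (simp add: cinner_self)
    qed (auto simp: B_sym)
  qed
qed

section \<open>Boundary triples of semi-standard simple operators\<close>

locale semi_standard_triple = krein ip J
  for ip :: "'h::complex_hilbert_space \<Rightarrow> 'h \<Rightarrow> complex" and J :: "'h \<Rightarrow> 'h" +
  fixes T :: "('h \<times> 'h) set"
    and \<Gamma>0 \<Gamma>1 :: "'h \<times> 'h \<Rightarrow> 'l::complex_hilbert_space"
  assumes pontryagin: "pontryagin_space ip J"
    and semi_standard: "semi_standard_simple ip J T"
    and triple: "boundary_triple ip (krein_adjoint ip T) \<Gamma>0 \<Gamma>1"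
begin

abbreviation "S \<equiv> krein_adjoint ip T"
abbreviation "\<Delta> \<equiv> Delta_0 ip J T"
abbreviation "defect \<equiv> eigenspace S"

lemma T_subspace: "csubspace T" and T_symmetric: "T \<subseteq> S" and T_closed: "closed T"
  and Delta_nonempty: "\<Delta> \<noteq> {}"
  and defect_total: "closure (cspan (\<Union>z\<in>\<Delta>. defect z)) = UNIV"
  using semi_standard
  by (auto simp: semi_standard_simple_def standard_symmetric_def symmetric_rel_def)

lemma S_subspace: "csubspace S" by (rule csubspace_krein_adjoint)

lemma bmap_iff: "(u, l) \<in> bmap S \<Gamma>0 \<Gamma>1 \<longleftrightarrow> u \<in> S \<and> l = (\<Gamma>0 u, \<Gamma>1 u)"
  by (cases u) (auto simp: bmap_def graph_def)

lemma bmap_subspace: "csubspace (bmap S \<Gamma>0 \<Gamma>1)"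
  using triple by (simp add: boundary_triple_def)

lemma boundary_map_add:
  assumes "u \<in> S" "v \<in> S"
  shows "\<Gamma>0 (u + v) = \<Gamma>0 u + \<Gamma>0 v" "\<Gamma>1 (u + v) = \<Gamma>1 u + \<Gamma>1 v"
proof -
  have "(u, \<Gamma>0 u, \<Gamma>1 u) + (v, \<Gamma>0 v, \<Gamma>1 v) \<in> bmap S \<Gamma>0 \<Gamma>1"
    using assms by (intro complex_vec.subspace_add[OF bmap_subspace]) (auto simp: bmap_iff)
  then show "\<Gamma>0 (u + v) = \<Gamma>0 u + \<Gamma>0 v" "\<Gamma>1 (u + v) = \<Gamma>1 u + \<Gamma>1 v"
    by (auto simp: bmap_iff)
qed

lemma boundary_map_scale:
  assumes "u \<in> S"
  shows "\<Gamma>0 (c *\<^sub>C u) = c *\<^sub>C \<Gamma>0 u" "\<Gamma>1 (c *\<^sub>C u) = c *\<^sub>C \<Gamma>1 u"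
proof -
  have "c *\<^sub>C (u, \<Gamma>0 u, \<Gamma>1 u) \<in> bmap S \<Gamma>0 \<Gamma>1"
    using assms by (intro complex_vec.subspace_scale[OF bmap_subspace]) (auto simp: bmap_iff)
  then show "\<Gamma>0 (c *\<^sub>C u) = c *\<^sub>C \<Gamma>0 u" "\<Gamma>1 (c *\<^sub>C u) = c *\<^sub>C \<Gamma>1 u"
    by (auto simp: bmap_iff)
qed

lemma boundary_map_surj:
  obtains u where "u \<in> S" "\<Gamma>0 u = l0" "\<Gamma>1 u = l1"
proof -
  have "(l0, l1) \<in> Range (bmap S \<Gamma>0 \<Gamma>1)" using triple by (simp add: boundary_triple_def)
  then show thesis using that by (auto simp: bmap_iff)
qed

lemma green:
  assumes "u \<in> S" "v \<in> S"
  shows "ip (fst u) (snd v) - ip (snd u) (fst v) = cinner (\<Gamma>0 u) (\<Gamma>1 v) - cinner (\<Gamma>1 u) (\<Gamma>0 v)"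
  using triple assms by (cases u; cases v) (fastforce simp: boundary_triple_def)

text \<open>By Green's identity the boundary values of an element of \<open>T\<close> are orthogonal to the range of the boundary
  map, which is everything.\<close>

lemma boundary_map_T:
  assumes u: "u \<in> T"
  shows "\<Gamma>0 u = 0" "\<Gamma>1 u = 0"
proof -
  \<comment> \<open>Pairing \<open>u\<close> with these boundary values yields the sum of the squared norms of its own.\<close>
  obtain v where v: "v \<in> S" "\<Gamma>0 v = - \<Gamma>1 u" "\<Gamma>1 v = \<Gamma>0 u" using boundary_map_surj by blast
  have "ip (fst u) (snd v) = ip (snd u) (fst v)"
    using u v(1) by (cases u; cases v) (simp add: krein_adjoint_iff)
  then have "cinner (\<Gamma>0 u) (\<Gamma>0 u) + cinner (\<Gamma>1 u) (\<Gamma>1 u) = 0"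
    using green[of u v] u v T_symmetric by (auto simp: cinner_minus_right)
  then have "(norm (\<Gamma>0 u))\<^sup>2 + (norm (\<Gamma>1 u))\<^sup>2 = 0"
    unfolding cinner_self of_real_add[symmetric] of_real_eq_0_iff .
  then show "\<Gamma>0 u = 0" "\<Gamma>1 u = 0" by (simp_all add: sum_power2_eq_zero_iff)
qed

lemma csubspace_boundary_preimage:
  assumes \<Theta>: "csubspace \<Theta>"
  shows "csubspace {u \<in> S. (\<Gamma>0 u, \<Gamma>1 u) \<in> \<Theta>}"
proof (rule csubspaceI)
  have "0 \<in> T" by (rule complex_vec.subspace_0[OF T_subspace])
  then show "0 \<in> {u \<in> S. (\<Gamma>0 u, \<Gamma>1 u) \<in> \<Theta>}"
    using T_symmetric complex_vec.subspace_0[OF \<Theta>] by (auto simp: boundary_map_T zero_prod_def)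
next
  fix u v assume "u \<in> {u \<in> S. (\<Gamma>0 u, \<Gamma>1 u) \<in> \<Theta>}" "v \<in> {u \<in> S. (\<Gamma>0 u, \<Gamma>1 u) \<in> \<Theta>}"
  then show "u + v \<in> {u \<in> S. (\<Gamma>0 u, \<Gamma>1 u) \<in> \<Theta>}"
    using complex_vec.subspace_add[OF S_subspace] complex_vec.subspace_add[OF \<Theta>]
    by (fastforce simp: boundary_map_add)
next
  fix c u assume "u \<in> {u \<in> S. (\<Gamma>0 u, \<Gamma>1 u) \<in> \<Theta>}"
  then show "c *\<^sub>C u \<in> {u \<in> S. (\<Gamma>0 u, \<Gamma>1 u) \<in> \<Theta>}"
    using complex_vec.subspace_scale[OF S_subspace] complex_vec.subspace_scale[OF \<Theta>]
    by (fastforce simp: boundary_map_scale)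
qed

lemma T_subset_boundary_preimage:
  assumes \<Theta>: "csubspace \<Theta>"
  shows "T \<subseteq> {u \<in> S. (\<Gamma>0 u, \<Gamma>1 u) \<in> \<Theta>}"
  using complex_vec.subspace_0[OF \<Theta>] T_symmetric by (auto simp: boundary_map_T zero_prod_def)

lemma canonical_extension_preimage:
  assumes \<Theta>: "csubspace \<Theta>"
  shows "canonical_extension ip T ((bmap S \<Gamma>0 \<Gamma>1)\<inverse> `` \<Theta>)"
proof -
  have "(bmap S \<Gamma>0 \<Gamma>1)\<inverse> `` \<Theta> = {u \<in> S. (\<Gamma>0 u, \<Gamma>1 u) \<in> \<Theta>}"
    unfolding Image_def converse_iff bmap_iff by auto
  then show ?thesis
    using csubspace_boundary_preimage[OF \<Theta>] T_subset_boundary_preimage[OF \<Theta>]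
    by (auto simp: canonical_extension_def)
qed

text \<open>The preimage \<open>A\<close> under the boundary map of a selfadjoint relation through the boundary values of
  \<open>(f, z f)\<close> is a hyper-maximal neutral extension of \<open>T\<close>. The member \<open>N\<close> of the neutral class is
  what remains of \<open>A\<close> after splitting off \<open>T\<close> orthogonally.\<close>

lemma neutral_eigenvector_in_hypermaximal_extension:
  assumes f: "f \<in> defect z" and neutral: "ip f f = 0"
  obtains N t n where "N \<in> neutral_class ip J T" "t \<in> T" "n \<in> N" "(f, z *\<^sub>C f) = t + n"
proof -
  let ?f = "(f, z *\<^sub>C f)"
  have fS: "?f \<in> S" using f by (simp add: eigenspace_iff)
  have "cinner (\<Gamma>0 ?f) (\<Gamma>1 ?f) = cinner (\<Gamma>1 ?f) (\<Gamma>0 ?f)"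
    using green[OF fS fS] neutral by (simp add: ip_scaleC_left ip_scaleC_right)
  then obtain \<Theta> where \<Theta>: "csubspace \<Theta>" "(\<Gamma>0 ?f, \<Gamma>1 ?f) \<in> \<Theta>"
    and selfadj: "\<And>k0 k1. (k0, k1) \<in> \<Theta> \<longleftrightarrow> (\<forall>l0 l1. (l0, l1) \<in> \<Theta> \<longrightarrow> cinner l0 k1 = cinner l1 k0)"
    by (rule selfadjoint_relation_through_neutral_vector) (rule that)
  define A where "A = {u \<in> S. (\<Gamma>0 u, \<Gamma>1 u) \<in> \<Theta>}"
  have TA: "T \<subseteq> A" unfolding A_def by (rule T_subset_boundary_preimage[OF \<Theta>(1)])
  have A: "csubspace A" unfolding A_def by (rule csubspace_boundary_preimage[OF \<Theta>(1)])
  have A_selfadj: "A = {v. \<forall>u\<in>A. ip_sq ip u v = 0}"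
  proof (intro set_eqI iffI CollectI ballI)
    fix v u assume "v \<in> A" "u \<in> A"
    then have "v \<in> S" "u \<in> S" "cinner (\<Gamma>0 u) (\<Gamma>1 v) = cinner (\<Gamma>1 u) (\<Gamma>0 v)"
      using selfadj[of "\<Gamma>0 v" "\<Gamma>1 v"] by (auto simp: A_def)
    then show "ip_sq ip u v = 0" using green[of u v] by (simp add: ip_sq_eq_0_iff)
  next
    fix v assume "v \<in> {v. \<forall>u\<in>A. ip_sq ip u v = 0}"
    then have v: "ip_sq ip u v = 0" if "u \<in> A" for u using that by blast
    have vS: "v \<in> S"
      using v TA by (cases v) (auto simp: krein_adjoint_iff ip_sq_eq_0_iff)
    moreover have "(\<Gamma>0 v, \<Gamma>1 v) \<in> \<Theta>"
      unfolding selfadj[of "\<Gamma>0 v"]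
    proof (intro allI impI)
      fix l0 l1 assume l: "(l0, l1) \<in> \<Theta>"
      obtain u where u: "u \<in> S" "\<Gamma>0 u = l0" "\<Gamma>1 u = l1" using boundary_map_surj by blast
      then have "u \<in> A" using l by (simp add: A_def)
      then show "cinner l0 (\<Gamma>1 v) = cinner l1 (\<Gamma>0 v)"
        using v[of u] green[OF u(1) vS] u by (simp add: ip_sq_eq_0_iff)
    qed
    ultimately show "v \<in> A" by (simp add: A_def)
  qed
  define N where "N = A \<inter> orth_compl ip J T"
  have sum: "{t + n | t n. t \<in> T \<and> n \<in> N} = A"
  proof (intro set_eqI iffI)
    fix u assume "u \<in> {t + n | t n. t \<in> T \<and> n \<in> N}"
    then show "u \<in> A" using TA complex_vec.subspace_add[OF A] by (auto simp: N_def)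
  next
    fix u assume u: "u \<in> A"
    obtain p where p: "p \<in> T" "\<And>y. y \<in> T \<Longrightarrow> cinner y (u - p) = 0"
      using orthogonal_projection_exists[OF T_subspace T_closed] by blast
    have "u - p \<in> N"
      using p u TA complex_vec.subspace_diff[OF A u, of p] by (auto simp: N_def orth_compl_iff)
    moreover have "u = p + (u - p)" by simp
    ultimately show "u \<in> {t + n | t n. t \<in> T \<and> n \<in> N}" using p(1) by blast
  qed
  have "N \<in> neutral_class ip J T"
    unfolding neutral_class_def
  proof (intro CollectI conjI)
    have "csubspace (orth_compl ip J T)"
      by (rule csubspaceI) (auto simp: orth_compl_iff cinner_add_right cinner_scaleC_right)
    then have "csubspace N" unfolding N_def using A by (intro complex_vec.subspace_inter)
    moreover have "closed N"
    proof -
      have "closed {v. ip_sq ip u v = 0}" for u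
        unfolding ip_sq_eq_0_iff by (intro closed_Collect_eq continuous_on_ip continuous_intros)
      moreover have "A = (\<Inter>u\<in>A. {v. ip_sq ip u v = 0})" by (subst A_selfadj) blast
      ultimately have clA: "closed A" by (metis (no_types, lifting) closed_INT)
      have "closed {v. cinner u v = 0}" for u :: "'h \<times> 'h"
        by (intro closed_Collect_eq bounded_bilinear.continuous_on[OF bounded_bilinear_cinner]
            continuous_intros)
      then have "closed (\<Inter>u\<in>T. {v. cinner u v = 0})" by (intro closed_INT) blast
      moreover have "orth_compl ip J T = (\<Inter>u\<in>T. {v. cinner u v = 0})" by (auto simp: orth_compl_iff)
      ultimately show ?thesis unfolding N_def using clA by (simp add: closed_Int)
    qed
    moreover have "\<forall>u\<in>N. ip_sq ip u u = 0" using A_selfadj by (auto simp: N_def)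
    ultimately show "neutral_subspace ip N" by (simp add: neutral_subspace_def)
    show "N \<subseteq> S \<inter> orth_compl ip J T" by (auto simp: N_def A_def)
    show "hyper_maximal_neutral ip {t + n | t n. t \<in> T \<and> n \<in> N}"
      unfolding sum hyper_maximal_neutral_def by (rule A_selfadj)
  qed
  moreover have "?f \<in> A" using fS \<Theta>(2) by (simp add: A_def)
  ultimately show thesis using that unfolding sum[symmetric] by blast
qed

text \<open>This guards against the degenerate case of an intersection over the empty family in the definition of
  \<open>\<Delta>\<close>, which would be the set of all complex numbers.\<close>

lemma ex_neutral_class: "neutral_class ip J T \<noteq> {}"
proof -
  have "0 \<in> defect 0" using complex_vec.subspace_0[OF csubspace_eigenspace[OF S_subspace]] .
  then show ?thesis by (rule neutral_eigenvector_in_hypermaximal_extension) auto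
qed

lemma Delta_imp_delta:
  assumes "z \<in> \<Delta>"
  shows "z \<in> delta T"
  using assms ex_neutral_class by (auto simp: Delta_0_def O_s_def)

text \<open>Split \<open>(f, w f) = t + n\<close> in the extension generated by a neutral \<open>f\<close>. The vectors obtained from \<open>t\<close> and
  \<open>n\<close> by applying \<open>T - w\<close> and \<open>N - w\<close> are opposite, hence zero. So \<open>t\<close> and \<open>n\<close> are eigenvectors at \<open>w\<close> of \<open>T\<close>
  and \<open>N\<close>, which have none but zero.\<close>

lemma Delta_imp_neutral_free:
  assumes z: "z \<in> \<Delta>" and w: "w \<in> {z, cnj z}" and f: "f \<in> defect w" and neutral: "ip f f = 0"
  shows "f = 0"
proof -
  obtain N t n where N: "N \<in> neutral_class ip J T" and t: "t \<in> T" and n: "n \<in> N"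
    and sum: "(f, w *\<^sub>C f) = t + n"
    using neutral_eigenvector_in_hypermaximal_extension[OF f neutral] by blast
  have "z \<in> O_s T N" "z \<notin> sigma_p0 N" "cnj z \<notin> sigma_p0 N"
    using z N by (auto simp: Delta_0_def)
  then have ranges: "Range (rel_shift T w) \<inter> Range (rel_shift N w) = {0}"
    and wN: "w \<notin> sigma_p0 N" and wT: "w \<in> rho_hat T" "w \<notin> \<real>"
    using w by (auto simp: O_s_def delta_def complex_is_Real_iff)
  obtain a a' b b' where ab: "t = (a, a')" "n = (b, b')" by (cases t; cases n)
  have Nsub: "csubspace N" using N by (simp add: neutral_class_def neutral_subspace_def)
  have "a' - w *\<^sub>C a = - (b' - w *\<^sub>C b)"
  proof -
    have "a' + b' = w *\<^sub>C (a + b)" using sum ab by (metis Pair_inject add_Pair)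
    then show ?thesis by (simp add: scaleC_add_right algebra_simps)
  qed
  moreover have "- (b' - w *\<^sub>C b) \<in> Range (rel_shift N w)"
    using n ab complex_vec.subspace_neg[OF csubspace_Range_rel_shift[OF Nsub]]
    unfolding mem_Range_rel_shift_iff[of "b' - w *\<^sub>C b"] by (metis mem_Range_rel_shift_iff)
  moreover have "a' - w *\<^sub>C a \<in> Range (rel_shift T w)"
    using t ab by (auto simp: mem_Range_rel_shift_iff)
  ultimately have "a' - w *\<^sub>C a = 0" "- (b' - w *\<^sub>C b) = 0" using ranges by (metis IntI singletonD)+
  then have zero: "a' - w *\<^sub>C a = 0" "b' - w *\<^sub>C b = 0" by simp_all
  then have "a \<in> eigenspace T w" "b \<in> eigenspace N w"
    using t n ab by (simp_all add: eigenspace_iff)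
  then have "a = 0" "b = 0" using wT wN by (auto simp: rho_hat_def sigma_p0_def)
  then show "f = 0" using sum ab by simp
qed

text \<open>The set \<open>\<Delta>\<close> is open, with a uniform bound for definiteness near each point. The points near
  \<open>cnj z\<close> enter because membership of \<open>w\<close> is a condition on the defect subspaces at \<open>w\<close> and \<open>cnj w\<close>.\<close>

lemma Delta_near:
  assumes z: "z \<in> \<Delta>"
  obtains r d K where "r > 0" "d > 0" "K > 0"
    "\<forall>w. cmod (w - z) < r \<longrightarrow> w \<in> \<Delta> \<and> (\<forall>g \<in> defect w. d * (norm g)\<^sup>2 \<le> cmod (ip g g))
       \<and> (\<forall>f \<in> defect z. \<exists>g \<in> defect w. norm (f - g) \<le> K * cmod (w - z) * norm f)"
proof -
  have dz: "z \<in> delta T" using z by (rule Delta_imp_delta)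
  then have dcz: "cnj z \<in> delta T" by (auto simp: delta_def complex_is_Real_iff)
  obtain r1 K where r1: "r1 > 0" "K > 0" "\<forall>w. cmod (w - z) < r1 \<longrightarrow> w \<in> delta T"
    and near: "\<forall>v w. cmod (v - z) < r1 \<and> cmod (w - z) < r1 \<longrightarrow>
       (\<forall>f \<in> defect v. \<exists>g \<in> defect w. norm (f - g) \<le> K * cmod (w - v) * norm f)"
    by (rule delta_near[OF T_subspace T_closed dz]) (rule that)
  obtain r2 d where r2: "r2 > 0" "d > 0"
    "\<And>w g. cmod (w - z) < r2 \<Longrightarrow> g \<in> defect w \<Longrightarrow> d * (norm g)\<^sup>2 \<le> cmod (ip g g)"
    by (rule uniformly_definite_near[OF pontryagin T_subspace T_closed dz])
      (use Delta_imp_neutral_free[OF z, of z] in auto)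
  obtain r3 e where r3: "r3 > 0" "e > 0"
    "\<And>w g. cmod (w - cnj z) < r3 \<Longrightarrow> g \<in> defect w \<Longrightarrow> e * (norm g)\<^sup>2 \<le> cmod (ip g g)"
    by (rule uniformly_definite_near[OF pontryagin T_subspace T_closed dcz])
      (use Delta_imp_neutral_free[OF z, of "cnj z"] in auto)
  have inDelta: "w \<in> \<Delta>" if w: "cmod (w - z) < r1" "cmod (w - z) < r2" "cmod (w - z) < r3" for w
  proof (rule neutral_free_imp_mem_Delta_0[OF T_subspace T_symmetric])
    show "w \<in> delta T" using r1(3) w(1) by blast
    fix v f assume v: "v \<in> {w, cnj w}" "f \<in> defect v" "ip f f = 0"
    have "cmod (cnj w - cnj z) < r3" using w(3) by (metis complex_cnj_diff complex_mod_cnj)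
    then have "d * (norm f)\<^sup>2 \<le> 0 \<or> e * (norm f)\<^sup>2 \<le> 0"
      using v r2(3)[OF w(2), of f] r3(3)[of "cnj w" f] by auto
    then show "f = 0" using r2(2) r3(2) by (auto simp: mult_le_0_iff)
  qed
  show thesis
  proof (rule that[of "min r1 (min r2 r3)" d K])
    show "\<forall>w. cmod (w - z) < min r1 (min r2 r3) \<longrightarrow> w \<in> \<Delta>
       \<and> (\<forall>g \<in> defect w. d * (norm g)\<^sup>2 \<le> cmod (ip g g))
       \<and> (\<forall>f \<in> defect z. \<exists>g \<in> defect w. norm (f - g) \<le> K * cmod (w - z) * norm f)"
      using inDelta r2(3) near[rule_format, of z] r1(1) by auto
  qed (use r1 r2 r3 in auto)
qed

lemma defect_approximated_nearby:
  assumes z: "z \<in> \<Delta>" and f: "f \<in> defect z" and d: "d > 0"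
  obtains w g where "\<And>n. w n \<in> \<Delta>" "\<And>n. w n \<noteq> z" "\<And>n. cmod (w n - z) < d"
    "\<And>n. g n \<in> defect (w n)" "w \<longlonglongrightarrow> z" "g \<longlonglongrightarrow> f"
proof -
  obtain r c K where r: "r > 0" "K > 0"
    and near: "\<forall>w. cmod (w - z) < r \<longrightarrow> w \<in> \<Delta> \<and> (\<forall>g \<in> defect w. c * (norm g)\<^sup>2 \<le> cmod (ip g g))
       \<and> (\<forall>f \<in> defect z. \<exists>g \<in> defect w. norm (f - g) \<le> K * cmod (w - z) * norm f)"
    by (rule Delta_near[OF z]) (rule that)
  define s where "s n = min r d * inverse (real (Suc (Suc n)))" for n
  have s: "s n > 0" "s n < min r d" for n
  proof -
    have m: "min r d > 0" using r(1) d by simp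
    then show "s n > 0" by (simp add: s_def)
    have "inverse (real (Suc (Suc n))) < 1" by (simp add: field_simps)
    from mult_strict_left_mono[OF this m] show "s n < min r d" by (simp add: s_def)
  qed
  have "(\<lambda>n. inverse (real (Suc (Suc n)))) \<longlonglongrightarrow> 0"
    by (rule LIMSEQ_Suc[OF LIMSEQ_inverse_real_of_nat])
  then have s0: "s \<longlonglongrightarrow> 0" unfolding s_def by (rule tendsto_mult_right_zero)
  define w where "w n = z + complex_of_real (s n)" for n
  have wz: "cmod (w n - z) = s n" for n using s(1)[of n] by (simp add: w_def)
  have "\<forall>n. \<exists>g \<in> defect (w n). norm (f - g) \<le> K * s n * norm f"
    using near f wz s(2) by (metis min_less_iff_conj)
  then obtain g where g: "\<And>n. g n \<in> defect (w n)" "\<And>n. norm (f - g n) \<le> K * s n * norm f" by metis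
  show thesis
  proof (rule that[of w g])
    show "w n \<in> \<Delta>" "cmod (w n - z) < d" for n using near wz[of n] s(2)[of n] by auto
    show "w n \<noteq> z" for n using wz[of n] s(1)[of n] by auto
    have "(\<lambda>n. z + complex_of_real (s n)) \<longlonglongrightarrow> z + complex_of_real 0" by (intro tendsto_intros s0)
    then show "w \<longlonglongrightarrow> z" by (simp add: w_def[abs_def])
    have "(\<lambda>n. g n - f) \<longlonglongrightarrow> 0"
    proof (rule Lim_null_comparison)
      show "\<forall>\<^sub>F n in sequentially. norm (g n - f) \<le> K * s n * norm f"
        using g(2) by (simp add: norm_minus_commute)
      show "(\<lambda>n. K * s n * norm f) \<longlonglongrightarrow> 0"
        by (intro tendsto_mult_left_zero tendsto_mult_right_zero s0)
    qed
    then show "g \<longlonglongrightarrow> f" by (rule LIM_zero_cancel)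
  qed (rule g(1))
qed

text \<open>The defect subspaces over \<open>\<Delta>\<close> remain total when the point \<open>z\<close> is removed, since defect vectors at
  \<open>z\<close> are limits of defect vectors at other points.\<close>

lemma closed_subspace_containing_punctured_defects:
  assumes X: "csubspace X" "closed X" and sub: "\<And>w. w \<in> \<Delta> \<Longrightarrow> w \<noteq> z \<Longrightarrow> defect w \<subseteq> X"
  shows "X = UNIV"
proof -
  have "f \<in> X" if w: "w \<in> \<Delta>" and f: "f \<in> defect w" for w f
  proof (cases "w = z")
    case True
    obtain v g where "\<And>n. v n \<in> \<Delta>" "\<And>n. v n \<noteq> w" "\<And>n. g n \<in> defect (v n)" "g \<longlonglongrightarrow> f"
      using defect_approximated_nearby[OF w f zero_less_one] by metis
    then show ?thesis using sub True closed_sequentially[OF X(2), of g f] by blast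
  qed (use assms that in auto)
  then have "cspan (\<Union>z\<in>\<Delta>. defect z) \<subseteq> X" by (intro complex_vec.span_minimal X(1)) auto
  then have "closure (cspan (\<Union>z\<in>\<Delta>. defect z)) \<subseteq> X" using X(2) by (rule closure_minimal)
  then show ?thesis using defect_total by auto
qed

text \<open>Fix \<open>z \<in> \<Delta>\<close>. The vector \<open>x' - cnj z x\<close> is orthogonal to the defect subspace at \<open>z\<close>, so it equals
  \<open>t' - cnj z t\<close> for some \<open>(t, t') \<in> T\<close>. The difference \<open>(x, x') - (t, t')\<close> has the form \<open>(y, cnj z y)\<close> and
  satisfies the same equations, that is, \<open>(w - z) [y, f] = 0\<close> for \<open>f\<close> in the defect subspace at \<open>w\<close>. So \<open>y\<close>
  is orthogonal to all defect subspaces except possibly the one at \<open>z\<close>, and these are total.\<close>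

lemma graph_determined_by_defects:
  assumes x: "\<And>w f. w \<in> \<Delta> \<Longrightarrow> f \<in> defect w \<Longrightarrow> ip x (w *\<^sub>C f) = ip x' f"
  shows "(x, x') \<in> T"
proof -
  obtain z where z: "z \<in> \<Delta>" using Delta_nonempty by blast
  have "x' - cnj z *\<^sub>C x \<in> Range (rel_shift T (cnj z))"
  proof (rule orthogonal_to_eigenspace_imp_mem_Range[OF T_subspace])
    show "closed (Range (rel_shift T (cnj z)))"
      using Delta_imp_delta[OF z] by (simp add: delta_def rho_hat_def)
    show "ip (x' - cnj z *\<^sub>C x) f = 0" if "f \<in> defect z" for f
      using x[OF z that] by (simp add: ip_diff_left ip_scaleC_left ip_scaleC_right)
  qed
  then obtain t t' where t: "(t, t') \<in> T" "x' - cnj z *\<^sub>C x = t' - cnj z *\<^sub>C t"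
    unfolding mem_Range_rel_shift_iff by blast
  define y where "y = x - t"
  have y': "x' - t' = cnj z *\<^sub>C y" using t(2) by (simp add: y_def scaleC_diff_right algebra_simps)
  have "{f. ip y f = 0} = UNIV"
  proof (rule closed_subspace_containing_punctured_defects[OF _ closed_ip_left])
    show "csubspace {f. ip y f = 0}" by (rule csubspaceI) (auto simp: ip_add_right ip_scaleC_right)
    fix w assume w: "w \<in> \<Delta>" "w \<noteq> z"
    show "defect w \<subseteq> {f. ip y f = 0}"
    proof
      fix f assume f: "f \<in> defect w"
      have "ip t (w *\<^sub>C f) = ip t' f"
        using f t(1) by (simp add: eigenspace_iff krein_adjoint_iff)
      then have "ip y (w *\<^sub>C f) = ip (x' - t') f"
        using x[OF w(1) f] by (simp add: y_def ip_diff_left)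
      then have "(w - z) * ip y f = 0"
        unfolding y' by (simp add: ip_scaleC_left ip_scaleC_right algebra_simps)
      then show "f \<in> {f. ip y f = 0}" using w(2) by simp
    qed
  qed
  then have "y = 0" using eq_zero_if_orthogonal_to_dense[of UNIV y] ip_commute[of _ y] by auto
  then show ?thesis using t(1) y' by (simp add: y_def)
qed

end

section \<open>Two boundary triples with the same Weyl family\<close>

locale equal_weyl_families =
  A: semi_standard_triple ip J T \<Gamma>0 \<Gamma>1 + B: semi_standard_triple ip' J' T' \<Gamma>0' \<Gamma>1'
  for ip :: "'h::complex_hilbert_space \<Rightarrow> 'h \<Rightarrow> complex" and J T
    and \<Gamma>0 \<Gamma>1 :: "'h \<times> 'h \<Rightarrow> 'l::complex_hilbert_space"
    and ip' :: "'k::complex_hilbert_space \<Rightarrow> 'k \<Rightarrow> complex" and J' T'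
    and \<Gamma>0' \<Gamma>1' :: "'k \<times> 'k \<Rightarrow> 'l" +
  assumes same_Delta: "B.\<Delta> = A.\<Delta>"
    and same_weyl: "\<And>z. z \<in> A.\<Delta> \<Longrightarrow> weyl_family A.S \<Gamma>0 \<Gamma>1 z = weyl_family B.S \<Gamma>0' \<Gamma>1' z"
begin

definition same_boundary_values :: "'h \<times> 'h \<Rightarrow> 'k \<times> 'k \<Rightarrow> bool" where
  "same_boundary_values u v \<longleftrightarrow> \<Gamma>0' v = \<Gamma>0 u \<and> \<Gamma>1' v = \<Gamma>1 u"

definition matched :: "complex \<Rightarrow> 'h \<Rightarrow> 'k \<Rightarrow> bool" where
  "matched z f f' \<longleftrightarrow> z \<in> A.\<Delta> \<and> f \<in> A.defect z \<and> f' \<in> B.defect z \<and>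
     same_boundary_values (f, z *\<^sub>C f) (f', z *\<^sub>C f')"

lemma matched_exists:
  assumes z: "z \<in> A.\<Delta>" and f: "f \<in> A.defect z"
  shows "\<exists>f'. matched z f f'"
proof -
  let ?u = "(f, z *\<^sub>C f)"
  have "(\<Gamma>0 ?u, \<Gamma>1 ?u) \<in> weyl_family A.S \<Gamma>0 \<Gamma>1 z"
    using f unfolding weyl_family_def Image_iff A.bmap_iff
    by (intro bexI[of _ ?u]) (auto simp: eigenspace_iff scalar_rel_def)
  then have "(\<Gamma>0 ?u, \<Gamma>1 ?u) \<in> weyl_family B.S \<Gamma>0' \<Gamma>1' z" using same_weyl[OF z] by simp
  then show ?thesis using z f
    by (auto simp: weyl_family_def Image_iff B.bmap_iff scalar_rel_def matched_def eigenspace_iff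
        same_boundary_values_def)
qed

lemma matched_exists':
  assumes z: "z \<in> A.\<Delta>" and f': "f' \<in> B.defect z"
  shows "\<exists>f. matched z f f'"
proof -
  let ?u = "(f', z *\<^sub>C f')"
  have "(\<Gamma>0' ?u, \<Gamma>1' ?u) \<in> weyl_family B.S \<Gamma>0' \<Gamma>1' z"
    using f' unfolding weyl_family_def Image_iff B.bmap_iff
    by (intro bexI[of _ ?u]) (auto simp: eigenspace_iff scalar_rel_def)
  then have "(\<Gamma>0' ?u, \<Gamma>1' ?u) \<in> weyl_family A.S \<Gamma>0 \<Gamma>1 z" using same_weyl[OF z] by simp
  then show ?thesis using z f'
    by (auto simp: weyl_family_def Image_iff A.bmap_iff scalar_rel_def matched_def eigenspace_iff
        same_boundary_values_def)
qed

lemma green_same_boundary_values: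
  assumes u: "u \<in> A.S" "u' \<in> B.S" "same_boundary_values u u'"
    and v: "v \<in> A.S" "v' \<in> B.S" "same_boundary_values v v'"
  shows "ip (fst u) (snd v) - ip (snd u) (fst v) = ip' (fst u') (snd v') - ip' (snd u') (fst v')"
  using A.green[OF u(1) v(1)] B.green[OF u(2) v(2)] u(3) v(3)
  by (simp add: same_boundary_values_def)

lemma matched_pairing_off_conjugate:
  assumes f: "matched z f f'" and g: "matched w g g'" and zw: "z \<noteq> cnj w"
  shows "ip' f' g' = ip f g"
proof -
  have "ip f (w *\<^sub>C g) - ip (z *\<^sub>C f) g = ip' f' (w *\<^sub>C g') - ip' (z *\<^sub>C f') g'"
    using green_same_boundary_values[of "(f, z *\<^sub>C f)" "(f', z *\<^sub>C f')" "(g, w *\<^sub>C g)" "(g', w *\<^sub>C g')"] f g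
    by (simp add: matched_def eigenspace_iff)
  then have "(w - cnj z) * ip f g = (w - cnj z) * ip' f' g'"
    by (simp add: A.ip_scaleC_left A.ip_scaleC_right B.ip_scaleC_left B.ip_scaleC_right algebra_simps)
  moreover have "w \<noteq> cnj z" using zw by auto
  ultimately show ?thesis by simp
qed

text \<open>In the case \<open>z = cnj w\<close> left open by Green's identity, approximate \<open>f\<close> by defect vectors \<open>p n\<close> at points
  \<open>v n \<rightarrow> z\<close> different from \<open>z\<close>, matched with \<open>p' n\<close>. Uniform definiteness near \<open>z\<close> bounds the \<open>p' n\<close>
  through \<open>[p' n, p' n] = [p n, p n]\<close>. Against defect vectors at points other than \<open>w\<close> the \<open>p' n\<close> converge
  to \<open>f'\<close>, as all products involved are given by Green's identity, and these vectors are total. Hence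
  \<open>p' n\<close> converges weakly to \<open>f'\<close>, and \<open>[p' n, g'] = [p n, g]\<close> passes to the limit.\<close>

lemma matched_pairing:
  assumes f: "matched z f f'" and g: "matched w g g'"
  shows "ip' f' g' = ip f g"
proof (cases "z = cnj w")
  case True
  have z: "z \<in> A.\<Delta>" "z \<in> B.\<Delta>" and fz: "f \<in> A.defect z" using f same_Delta by (auto simp: matched_def)
  obtain r d K where r: "r > 0" "d > 0" and definite: "\<forall>w. cmod (w - z) < r \<longrightarrow> w \<in> B.\<Delta>
       \<and> (\<forall>g \<in> B.defect w. d * (norm g)\<^sup>2 \<le> cmod (ip' g g))
       \<and> (\<forall>f \<in> B.defect z. \<exists>g \<in> B.defect w. norm (f - g) \<le> K * cmod (w - z) * norm f)"
    by (rule B.Delta_near[OF z(2)]) (rule that)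
  obtain v p where v: "\<And>n. v n \<in> A.\<Delta>" "\<And>n. v n \<noteq> z" "\<And>n. cmod (v n - z) < r" "v \<longlonglongrightarrow> z"
    and p: "\<And>n. p n \<in> A.defect (v n)" "p \<longlonglongrightarrow> f"
    by (rule A.defect_approximated_nearby[OF z(1) fz r(1)]) (rule that)
  have "\<forall>n. \<exists>p'. matched (v n) (p n) p'" using matched_exists v(1) p(1) by blast
  then obtain p' where p': "\<And>n. matched (v n) (p n) (p' n)" by metis
  have real: "v n \<noteq> cnj (v n)" for n
    using A.Delta_imp_delta[OF v(1)[of n]] by (auto simp: delta_def complex_is_Real_iff complex_eq_iff)
  obtain b where b: "\<And>n. norm (p n) \<le> b" using convergent_imp_bounded[OF p(2)]
    unfolding bounded_iff by auto
  have p'_bound: "norm (p' n) \<le> sqrt (b\<^sup>2 / d)" for n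
  proof -
    have "d * (norm (p' n))\<^sup>2 \<le> cmod (ip' (p' n) (p' n))"
      using definite v(3)[of n] p'[of n] by (simp add: matched_def)
    also have "ip' (p' n) (p' n) = ip (p n) (p n)"
      by (rule matched_pairing_off_conjugate[OF p' p' real])
    also have "cmod (ip (p n) (p n)) \<le> b\<^sup>2"
      using A.cmod_ip_le[of "p n" "p n"] mult_mono[OF b[of n] b[of n]] norm_ge_zero[of "p n"] b[of n]
      unfolding power2_eq_square by linarith
    finally have "(norm (p' n))\<^sup>2 \<le> b\<^sup>2 / d" using r(2) by (simp add: field_simps)
    then show ?thesis by (rule real_le_rsqrt)
  qed
  define X where "X = {x. (\<lambda>n. ip' (p' n - f') x) \<longlonglongrightarrow> 0}"
  have "norm (p' n - f') \<le> sqrt (b\<^sup>2 / d) + norm f'" for n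
    using p'_bound[of n] norm_triangle_ineq4[of "p' n" f'] by simp
  note bounded = this
  have "X = UNIV"
  proof (rule B.closed_subspace_containing_punctured_defects)
    show "csubspace X" unfolding X_def by (rule B.csubspace_weak_null)
    show "closed X" unfolding X_def using bounded by (rule B.closed_weak_null)
    fix u assume u: "u \<in> B.\<Delta>" "u \<noteq> w"
    show "B.defect u \<subseteq> X"
    proof
      fix k' assume k': "k' \<in> B.defect u"
      then obtain k where k: "matched u k k'" using matched_exists' u same_Delta by blast
      have "z \<noteq> cnj u" using u(2) True by auto
      then have fk: "ip' f' k' = ip f k" by (rule matched_pairing_off_conjugate[OF f k])
      have "(\<lambda>n. dist (v n) (cnj u)) \<longlonglongrightarrow> dist z (cnj u)" by (intro tendsto_intros v(4))
      moreover have "dist z (cnj u) > 0" using \<open>z \<noteq> cnj u\<close> by simp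
      ultimately have "\<forall>\<^sub>F n in sequentially. 0 < dist (v n) (cnj u)" by (rule order_tendstoD(1))
      then have ev: "\<forall>\<^sub>F n in sequentially. ip (p n - f) k = ip' (p' n - f') k'"
      proof eventually_elim
        case (elim n)
        then have "ip' (p' n) k' = ip (p n) k"
          using matched_pairing_off_conjugate[OF p'[of n] k] by auto
        then show ?case using fk by (simp add: A.ip_diff_left B.ip_diff_left)
      qed
      have "(\<lambda>n. ip (p n - f) k) \<longlonglongrightarrow> ip (f - f) k"
        using p(2) by (intro A.tendsto_ip tendsto_intros)
      then have "(\<lambda>n. ip (p n - f) k) \<longlonglongrightarrow> 0" by simp
      from Lim_transform_eventually[OF this ev] show "k' \<in> X" by (simp add: X_def)
    qed
  qed
  then have "(\<lambda>n. ip' (p' n - f') g') \<longlonglongrightarrow> 0" by (auto simp: X_def)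
  then have "(\<lambda>n. ip' (p' n - f') g' + ip' f' g') \<longlonglongrightarrow> 0 + ip' f' g'" by (intro tendsto_intros)
  then have "(\<lambda>n. ip' (p' n) g') \<longlonglongrightarrow> ip' f' g'" by (simp add: B.ip_diff_left)
  moreover have "ip' (p' n) g' = ip (p n) g" for n
    using v(2)[of n] True by (intro matched_pairing_off_conjugate[OF p' g]) simp
  moreover have "(\<lambda>n. ip (p n) g) \<longlonglongrightarrow> ip f g" using p(2) by (intro A.tendsto_ip tendsto_intros)
  ultimately show ?thesis using LIMSEQ_unique by simp
qed (use assms matched_pairing_off_conjugate in blast)

lemma matched_unitary:
  obtains U where "standard_unitary ip ip' U" "\<And>z f f'. matched z f f' \<Longrightarrow> U f = f'"
proof -
  define G where "G = {(f, f'). \<exists>z. matched z f f'}"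
  define V where "V = cspan G"
  have V: "csubspace V" unfolding V_def by (rule complex_vec.subspace_span)
  have GV: "G \<subseteq> V" unfolding V_def by (rule complex_vec.span_superset)
  have pair1: "ip' (snd p) (snd q) = ip (fst p) (fst q)" if p: "p \<in> G" and q: "q \<in> V" for p q
  proof -
    have "V \<subseteq> {q. ip' (snd p) (snd q) = ip (fst p) (fst q)}"
      unfolding V_def
    proof (rule complex_vec.span_minimal)
      show "G \<subseteq> {q. ip' (snd p) (snd q) = ip (fst p) (fst q)}"
        using p matched_pairing by (auto simp: G_def)
      show "csubspace {q. ip' (snd p) (snd q) = ip (fst p) (fst q)}"
        by (rule csubspaceI) (auto simp: A.ip_add_right B.ip_add_right A.ip_scaleC_right B.ip_scaleC_right)
    qed
    then show ?thesis using q by blast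
  qed
  have pair: "ip' (snd p) (snd q) = ip (fst p) (fst q)" if p: "p \<in> V" and q: "q \<in> V" for p q
  proof -
    have "V \<subseteq> {p. ip' (snd p) (snd q) = ip (fst p) (fst q)}"
      unfolding V_def
    proof (rule complex_vec.span_minimal)
      show "G \<subseteq> {p. ip' (snd p) (snd q) = ip (fst p) (fst q)}"
        using q pair1 by auto
      show "csubspace {p. ip' (snd p) (snd q) = ip (fst p) (fst q)}"
        by (rule csubspaceI) (auto simp: A.ip_add_left B.ip_add_left A.ip_scaleC_left B.ip_scaleC_left)
    qed
    then show ?thesis using p by blast
  qed
  have iso: "ip' f' g' = ip f g" if "(f, f') \<in> V" "(g, g') \<in> V" for f f' g g'
    using pair[OF that] by simp
  have "(\<Union>z\<in>A.\<Delta>. A.defect z) \<subseteq> Domain V"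
    using matched_exists GV by (fastforce simp: G_def)
  then have "cspan (\<Union>z\<in>A.\<Delta>. A.defect z) \<subseteq> Domain V" using csubspace_Domain[OF V] by (rule complex_vec.span_minimal)
  then have D: "closure (Domain V) = UNIV" using A.defect_total closure_mono by blast
  have "(\<Union>z\<in>B.\<Delta>. B.defect z) \<subseteq> Range V"
    using matched_exists' GV same_Delta by (fastforce simp: G_def)
  then have "cspan (\<Union>z\<in>B.\<Delta>. B.defect z) \<subseteq> Range V" using csubspace_Range[OF V] by (rule complex_vec.span_minimal)
  then have R: "closure (Range V) = UNIV" using B.defect_total closure_mono by blast
  obtain U where U: "standard_unitary ip ip' U" "\<And>f f'. (f, f') \<in> V \<Longrightarrow> U f = f'"
    using isometric_relation_extends_to_unitary[OF A.pontryagin B.krein V D R iso] by blast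
  show thesis
  proof (rule that[OF U(1)])
    fix z f f' assume "matched z f f'"
    then have "(f, f') \<in> V" using GV by (auto simp: G_def)
    then show "U f = f'" by (rule U(2))
  qed
qed

text \<open>Green's identity gives \<open>u\<close> and \<open>v\<close> the same products with matched defect vectors. Since \<open>U\<close> preserves
  products and maps defect vectors to their matches, \<open>v\<close> minus the image of \<open>u\<close> satisfies the equations
  that characterize \<open>T'\<close>.\<close>

lemma same_boundary_values_modulo_T:
  assumes U: "standard_unitary ip ip' U" and U_matched: "\<And>z f f'. matched z f f' \<Longrightarrow> U f = f'"
    and u: "u \<in> A.S" and v: "v \<in> B.S" and uv: "same_boundary_values u v"
  shows "v - map_prod U U u \<in> T'"
proof -
  have Uip: "ip' (U f) (U g) = ip f g" for f g using U by (simp add: standard_unitary_def)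
  have "(fst v - U (fst u), snd v - U (snd u)) \<in> T'"
  proof (rule B.graph_determined_by_defects)
    fix w f' assume w: "w \<in> B.\<Delta>" and f': "f' \<in> B.defect w"
    then obtain f where f: "matched w f f'" using matched_exists' same_Delta by blast
    have Uf: "U f = f'" using U_matched[OF f] .
    have "ip (fst u) (w *\<^sub>C f) - ip (snd u) f = ip' (fst v) (w *\<^sub>C f') - ip' (snd v) f'"
      using green_same_boundary_values[OF u v uv, of "(f, w *\<^sub>C f)" "(f', w *\<^sub>C f')"] f
      by (simp add: matched_def eigenspace_iff)
    then show "ip' (fst v - U (fst u)) (w *\<^sub>C f') = ip' (snd v - U (snd u)) f'"
      by (simp add: B.ip_diff_left A.ip_scaleC_right B.ip_scaleC_right Uip algebra_simps flip: Uf)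
  qed
  then show ?thesis by (cases u; cases v) simp
qed

lemma boundary_map_unitary:
  assumes U: "standard_unitary ip ip' U" and U_matched: "\<And>z f f'. matched z f f' \<Longrightarrow> U f = f'"
    and u: "u \<in> A.S"
  shows "map_prod U U u \<in> B.S" "same_boundary_values u (map_prod U U u)"
proof -
  obtain v where v: "v \<in> B.S" "\<Gamma>0' v = \<Gamma>0 u" "\<Gamma>1' v = \<Gamma>1 u" using B.boundary_map_surj by blast
  define t where "t = v - map_prod U U u"
  have t: "t \<in> T'"
    using same_boundary_values_modulo_T[OF U U_matched u v(1)] v(2,3)
    by (simp add: t_def same_boundary_values_def)
  have tS: "t \<in> B.S" using t B.T_symmetric by blast
  have Uu: "map_prod U U u = v - t" by (simp add: t_def)
  show S: "map_prod U U u \<in> B.S" unfolding Uu using B.S_subspace v(1) tS by (rule complex_vec.subspace_diff)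
  have "v = map_prod U U u + t" by (simp add: t_def)
  then show "same_boundary_values u (map_prod U U u)"
    using B.boundary_map_add[OF S tS] B.boundary_map_T[OF t] v(2,3) by (simp add: same_boundary_values_def)
qed

text \<open>That the image of the first adjoint under \<open>U\<close> is all of the second one is shown by comparing an element
  with an arbitrary one having the same boundary values: their difference is mapped into \<open>T'\<close>, hence lies
  in \<open>T\<close>, because the equations characterizing \<open>T\<close> are transported by \<open>U\<close>.\<close>

lemma unitarily_similar:
  obtains U where "standard_unitary ip ip' U"
    "\<And>u. u \<in> A.S \<longleftrightarrow> map_prod U U u \<in> B.S"
    "\<And>u. u \<in> A.S \<Longrightarrow> same_boundary_values u (map_prod U U u)"
proof -
  obtain U where U: "standard_unitary ip ip' U" and U_matched: "\<And>z f f'. matched z f f' \<Longrightarrow> U f = f'"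
    using matched_unitary by blast
  have lin: "U (f - g) = U f - U g" for f g
    using U by (simp add: standard_unitary_def linear_diff bounded_linear.linear)
  have pullback: "u \<in> A.S" if Uu: "map_prod U U u \<in> B.S" for u
  proof -
    obtain v where v: "v \<in> A.S" "\<Gamma>0 v = \<Gamma>0' (map_prod U U u)" "\<Gamma>1 v = \<Gamma>1' (map_prod U U u)"
      using A.boundary_map_surj by blast
    have "map_prod U U u - map_prod U U v \<in> T'"
      using same_boundary_values_modulo_T[OF U U_matched v(1) Uu] v(2,3)
      by (simp add: same_boundary_values_def)
    then have d: "map_prod U U (u - v) \<in> T'" by (cases u; cases v) (simp add: lin)
    have "u - v \<in> T"
    proof -
      have "(fst (u - v), snd (u - v)) \<in> T"
      proof (rule A.graph_determined_by_defects)
        fix w f assume w: "w \<in> A.\<Delta>" and f: "f \<in> A.defect w"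
        then obtain f' where f': "matched w f f'" using matched_exists by blast
        have "(U (fst (u - v)), U (snd (u - v))) \<in> T'" using d by (cases "u - v") simp
        moreover have "(f', w *\<^sub>C f') \<in> B.S" using f' by (simp add: matched_def eigenspace_iff)
        ultimately have "ip' (U (fst (u - v))) (w *\<^sub>C f') = ip' (U (snd (u - v))) f'"
          by (simp add: B.krein_adjoint_iff)
        then show "ip (fst (u - v)) (w *\<^sub>C f) = ip (snd (u - v)) f"
          using U U_matched[OF f']
          by (simp add: standard_unitary_def A.ip_scaleC_right B.ip_scaleC_right) metis
      qed
      then show ?thesis unfolding prod.collapse .
    qed
    then have "u - v \<in> A.S" using A.T_symmetric by blast
    then have "(u - v) + v \<in> A.S" using v(1) by (rule complex_vec.subspace_add[OF A.S_subspace])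
    then show ?thesis by simp
  qed
  have forward: "map_prod U U u \<in> B.S" "same_boundary_values u (map_prod U U u)" if "u \<in> A.S" for u
    using boundary_map_unitary[OF U _ that] U_matched by blast+
  show thesis
    by (rule that[OF U]) (use pullback forward in blast)+
qed

end

theorem corollary6p13:
  fixes ip :: "'h::complex_hilbert_space \<Rightarrow> 'h \<Rightarrow> complex" and J :: "'h \<Rightarrow> 'h"
    and ip' :: "'k::complex_hilbert_space \<Rightarrow> 'k \<Rightarrow> complex" and J' :: "'k \<Rightarrow> 'k"
    and T :: "('h \<times> 'h) set" and T' :: "('k \<times> 'k) set"
    and \<Gamma>0 \<Gamma>1 :: "'h \<times> 'h \<Rightarrow> 'l::complex_hilbert_space"
    and \<Gamma>0' \<Gamma>1' :: "'k \<times> 'k \<Rightarrow> 'l"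
    and \<Delta> :: "complex set"
  defines "\<Gamma> \<equiv> bmap (krein_adjoint ip T) \<Gamma>0 \<Gamma>1"
    and "\<Gamma>' \<equiv> bmap (krein_adjoint ip' T') \<Gamma>0' \<Gamma>1'"
  assumes "pontryagin_space ip J" and "pontryagin_space ip' J'"
    and "semi_standard_simple ip J T" and "semi_standard_simple ip' J' T'"
    and "Delta_0 ip J T = \<Delta>" and "Delta_0 ip' J' T' = \<Delta>"
    and "boundary_triple ip (krein_adjoint ip T) \<Gamma>0 \<Gamma>1"
    and "boundary_triple ip' (krein_adjoint ip' T') \<Gamma>0' \<Gamma>1'"
    and "\<And>z. z \<in> \<Delta> \<Longrightarrow>
           weyl_family (krein_adjoint ip T) \<Gamma>0 \<Gamma>1 z = weyl_family (krein_adjoint ip' T') \<Gamma>0' \<Gamma>1' z"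
  shows "\<exists>U. standard_unitary ip ip' U \<and>
           \<Gamma>' = (graph UNIV (map_prod U U))\<inverse> O \<Gamma> \<and>
           (\<forall>\<Theta>. csubspace \<Theta> \<longrightarrow>
              canonical_extension ip T (\<Gamma>\<inverse> `` \<Theta>) \<and>
              canonical_extension ip' T' (\<Gamma>'\<inverse> `` \<Theta>) \<and>
              \<Gamma>'\<inverse> `` \<Theta> = (graph UNIV U)\<inverse> O (\<Gamma>\<inverse> `` \<Theta>) O graph UNIV U)"
proof -
  interpret equal_weyl_families ip J T \<Gamma>0 \<Gamma>1 ip' J' T' \<Gamma>0' \<Gamma>1'
    using assms(3-) by unfold_locales (auto simp: pontryagin_space_def)
  obtain U where U: "standard_unitary ip ip' U"
    and dom: "\<And>u. u \<in> A.S \<longleftrightarrow> map_prod U U u \<in> B.S"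
    and same: "\<And>u. u \<in> A.S \<Longrightarrow> same_boundary_values u (map_prod U U u)"
    using unitarily_similar by blast
  have surj: "\<exists>u. v = map_prod U U u" for v
    using U by (cases v) (metis bij_pointE map_prod_simp standard_unitary_def)
  have \<Gamma>: "(u, l) \<in> \<Gamma> \<longleftrightarrow> u \<in> A.S \<and> l = (\<Gamma>0 u, \<Gamma>1 u)" for u l
    unfolding \<Gamma>_def by (rule A.bmap_iff)
  have \<Gamma>': "(u, l) \<in> \<Gamma>' \<longleftrightarrow> u \<in> B.S \<and> l = (\<Gamma>0' u, \<Gamma>1' u)" for u l
    unfolding \<Gamma>'_def by (rule B.bmap_iff)
  have similar: "(map_prod U U u, l) \<in> \<Gamma>' \<longleftrightarrow> (u, l) \<in> \<Gamma>" for u l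
    using dom[of u] same[of u] by (auto simp: \<Gamma> \<Gamma>' same_boundary_values_def)
  have comp: "\<Gamma>' = (graph UNIV (map_prod U U))\<inverse> O \<Gamma>"
  proof (rule set_eqI, rule iffI)
    fix x assume x: "x \<in> \<Gamma>'"
    obtain u l where ul: "x = (map_prod U U u, l)" using surj by (cases x) metis
    have "(map_prod U U u, u) \<in> (graph UNIV (map_prod U U))\<inverse>" unfolding graph_def by blast
    moreover have "(u, l) \<in> \<Gamma>" using x ul similar by blast
    ultimately show "x \<in> (graph UNIV (map_prod U U))\<inverse> O \<Gamma>" unfolding ul by (rule relcompI)
  next
    fix x assume "x \<in> (graph UNIV (map_prod U U))\<inverse> O \<Gamma>"
    then obtain u l where "x = (map_prod U U u, l)" "(u, l) \<in> \<Gamma>" by (auto simp: graph_def)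
    then show "x \<in> \<Gamma>'" using similar by blast
  qed
  have "canonical_extension ip T (\<Gamma>\<inverse> `` \<Theta>) \<and> canonical_extension ip' T' (\<Gamma>'\<inverse> `` \<Theta>) \<and>
      \<Gamma>'\<inverse> `` \<Theta> = (graph UNIV U)\<inverse> O (\<Gamma>\<inverse> `` \<Theta>) O graph UNIV U" if \<Theta>: "csubspace \<Theta>" for \<Theta>
  proof (intro conjI)
    show "canonical_extension ip T (\<Gamma>\<inverse> `` \<Theta>)"
      unfolding \<Gamma>_def by (rule A.canonical_extension_preimage[OF \<Theta>])
    show "canonical_extension ip' T' (\<Gamma>'\<inverse> `` \<Theta>)"
      unfolding \<Gamma>'_def by (rule B.canonical_extension_preimage[OF \<Theta>])
    show "\<Gamma>'\<inverse> `` \<Theta> = (graph UNIV U)\<inverse> O (\<Gamma>\<inverse> `` \<Theta>) O graph UNIV U"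
    proof (rule set_eqI, rule iffI)
      fix v assume v: "v \<in> \<Gamma>'\<inverse> `` \<Theta>"
      obtain f f' where f: "v = map_prod U U (f, f')" using surj[of v] by auto
      then have "(f, f') \<in> \<Gamma>\<inverse> `` \<Theta>" using v similar[of "(f, f')"] by auto
      then show "v \<in> (graph UNIV U)\<inverse> O (\<Gamma>\<inverse> `` \<Theta>) O graph UNIV U"
        using f by (auto simp: graph_def)
    next
      fix v assume "v \<in> (graph UNIV U)\<inverse> O (\<Gamma>\<inverse> `` \<Theta>) O graph UNIV U"
      then obtain f f' where f: "v = map_prod U U (f, f')" "(f, f') \<in> \<Gamma>\<inverse> `` \<Theta>"
        by (auto simp: graph_def)
      then show "v \<in> \<Gamma>'\<inverse> `` \<Theta>" using similar[of "(f, f')"] by auto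
    qed
  qed
  then show ?thesis using U comp by blast
qed

end
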